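(* Let $\Omega\subset\mathbb{R}^2$ be a strictly convex domain whose boundary curve $\Gamma(s)$ is of class $C^k$, $k\ge 3$, and let $\rho_{min}>0$ be the minimum radius of curvature of $\Gamma$. Let $T$ be the return map, in Birkhoff coordinates $(s_0,u_0)\mapsto(s_2,u_2)$, of the inverse magnetic billiard in $\Omega$ with Larmor radius $\mu>0$. If $\mu<\rho_{min}$, then $T$ is a twist map, whose unique generating function (up to an additive constant) is $$G(s_0,s_2)=-\ell_1-|\gamma|+\frac{1}{\mu}\mathcal{S},$$ where $\ell_1$ is the length of the line segment of the trajectory inside $\Omega$, $|\gamma|$ is the length of the circular arc $\gamma$ of Larmor radius $\mu$, and $\mathcal{S}$ is the area inside the circular arc $\gamma$ but outside $\Omega$.
   Context: Inverse magnetic billiard: $\Omega\subset\mathbb{R}^2$ is a connected, bounded, strictly convex domain whose boundary $\partial\Omega$ has length $L$ and is parametrized counterclockwise by arc length, $\Gamma(s)$, $s\in\mathbb{R}/L\mathbb{Z}$. The curvature $\kappa(s)$ is strictly positive, and the radius of curvature is $\rho(s)=1/\kappa(s)$. A particle moves at constant speed, along straight lines inside $\Omega$ and along counterclockwise circular arcs of radius $\mu$ (the Larmor radius) outside $\Omega$, its velocity being continuous across $\partial\Omega$. Starting from $P_0=\Gamma(s_0)$ with velocity pointing into $\Omega$, it follows the segment $P_0P_1$ of length $\ell_1$ inside $\Omega$, exits at $P_1=\Gamma(s_1)$, follows a counterclockwise arc $\gamma$ of radius $\mu$ outside $\Omega$, and re-enters $\Omega$ at the first return point $P_2=\Gamma(s_2)$.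 Let $\theta_i\in[0,\pi]$ be the angle between the positively oriented tangent to $\Gamma$ at $P_i$ and the velocity of the particle at $P_i$, and put $u_i=-\cos\theta_i$. The pairs $(s_i,u_i)$ are the Birkhoff coordinates. The return map is $T:(s_0,u_0)\mapsto(s_2,u_2)$ on the annulus $\mathcal{P}=\mathbb{R}/L\mathbb{Z}\times[-1,1]$, and it is the identity on $\partial\mathcal{P}$. The area $\mathcal S$ is that of the region enclosed by $\gamma$ and the arc of $\partial\Omega$ between $P_1$ and $P_2$, lying inside the Larmor circle and outside $\Omega$. Twist map: an area-preserving (symplectic for $ds\wedge du$) map of the annulus is a (monotone) twist map if its lift $(s_0,u_0)\mapsto(s_2,u_2)$ to the universal cover satisfies: (i) the lift commutes with the translation $(s,u)\mapsto(s+L,u)$; (ii) $\partial s_2/\partial u_0>0$ (twist condition, in the interior of the annulus); (iii) there is a function $G(s_0,s_2)$, invariant under $(s_0,s_2)\mapsto(s_0+L,s_2+L)$, called a generating function, with $u_2\,ds_2-u_0\,ds_0=dG(s_0,s_2)$, i.e. $u_2=\partial G/\partial s_2$ and $u_0=-\partial G/\partial s_0$. *)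

theory Defs
  imports
    "HOL-Analysis.Analysis"
    "HOL-Complex_Analysis.Winding_Numbers"
    "HOL-Library.Real_Mod"
begin

text \<open>The plane is identified with the complex numbers.\<close>

section \<open>Tables\<close>

definition C_k_curve :: "nat \<Rightarrow> (real \<Rightarrow> complex) \<Rightarrow> bool" where
  "C_k_curve k \<Gamma> \<longleftrightarrow>
     (\<exists>D. D 0 = \<Gamma> \<and>
          (\<forall>i<k. \<forall>t. (D i has_vector_derivative D (Suc i) t) (at t)) \<and>
          continuous_on UNIV (D k))"

definition strictly_convex :: "complex set \<Rightarrow> bool" where
  "strictly_convex S \<longleftrightarrow>
     (\<forall>x\<in>closure S. \<forall>y\<in>closure S. x \<noteq> y \<longrightarrow> open_segment x y \<subseteq> interior S)"

definition tangent :: "(real \<Rightarrow> complex) \<Rightarrow> real \<Rightarrow> complex" where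
  "tangent \<Gamma> s = vector_derivative \<Gamma> (at s)"

text \<open>Signed curvature of a curve parametrized by arc length, i.e. the determinant of
  the first and second derivatives; it is positive where the curve turns left.\<close>

definition curvature :: "(real \<Rightarrow> complex) \<Rightarrow> real \<Rightarrow> real" where
  "curvature \<Gamma> s = Im (cnj (tangent \<Gamma> s) * vector_derivative (tangent \<Gamma>) (at s))"

definition radius_of_curvature :: "(real \<Rightarrow> complex) \<Rightarrow> real \<Rightarrow> real" where
  "radius_of_curvature \<Gamma> s = 1 / curvature \<Gamma> s"

text \<open>For a periodic \<open>C\<^sup>2\<close> curve of positive curvature the infimum is attained.\<close>

definition min_radius_of_curvature :: "(real \<Rightarrow> complex) \<Rightarrow> real" where
  "min_radius_of_curvature \<Gamma> = (INF s. radius_of_curvature \<Gamma> s)"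

text \<open>The domain \<open>\<Omega>\<close> has a \<open>C\<^sup>k\<close> boundary of length \<open>L\<close>; the \<open>L\<close>-periodic map \<open>\<Gamma>\<close> is its
  counterclockwise arc length parametrization, lifted from \<open>\<real>/L\<int>\<close> to the reals.\<close>

definition billiard_table ::
    "nat \<Rightarrow> complex set \<Rightarrow> real \<Rightarrow> (real \<Rightarrow> complex) \<Rightarrow> bool" where
  "billiard_table k \<Omega> L \<Gamma> \<longleftrightarrow>
     open \<Omega> \<and> connected \<Omega> \<and> bounded \<Omega> \<and> \<Omega> \<noteq> {} \<and> strictly_convex \<Omega> \<and>
     L > 0 \<and> C_k_curve k \<Gamma> \<and>
     (\<forall>s. \<Gamma> (s + L) = \<Gamma> s) \<and> inj_on \<Gamma> {0..<L} \<and> range \<Gamma> = frontier \<Omega> \<and>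
     (\<forall>s. norm (tangent \<Gamma> s) = 1) \<and>
     (\<forall>z\<in>\<Omega>. winding_number (\<lambda>t. \<Gamma> (L * t)) z = 1) \<and>
     (\<forall>s. curvature \<Gamma> s > 0)"

section \<open>Inverse magnetic billiard\<close>

text \<open>First positive time at which the path \<open>z\<close> meets the boundary of \<open>\<Omega>\<close>. It is applied to
  unit speed paths only, so that it is also the length of the path travelled.\<close>

definition hitting_time :: "complex set \<Rightarrow> (real \<Rightarrow> complex) \<Rightarrow> real" where
  "hitting_time \<Omega> z = Inf {t. 0 < t \<and> z t \<in> frontier \<Omega>}"

text \<open>The particle has unit speed. At \<open>\<Gamma> s\<close>, the velocity making the angle \<open>\<theta> = arccos (- u)\<close>
  (so \<open>u = - cos \<theta>\<close>) with the tangent and pointing into \<open>\<Omega>\<close> is the tangent turned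
  counterclockwise by \<open>\<theta>\<close>, because \<open>\<Omega>\<close> lies to the left of \<open>\<Gamma>\<close>.\<close>

definition inward_velocity :: "(real \<Rightarrow> complex) \<Rightarrow> real \<Rightarrow> real \<Rightarrow> complex" where
  "inward_velocity \<Gamma> s u = cis (arccos (- u)) * tangent \<Gamma> s"

definition chord_length :: "complex set \<Rightarrow> (real \<Rightarrow> complex) \<Rightarrow> real \<Rightarrow> real \<Rightarrow> real" where
  "chord_length \<Omega> \<Gamma> s u = hitting_time \<Omega> (\<lambda>t. \<Gamma> s + of_real t * inward_velocity \<Gamma> s u)"

definition exit_point :: "complex set \<Rightarrow> (real \<Rightarrow> complex) \<Rightarrow> real \<Rightarrow> real \<Rightarrow> complex" where
  "exit_point \<Omega> \<Gamma> s u = \<Gamma> s + of_real (chord_length \<Omega> \<Gamma> s u) * inward_velocity \<Gamma> s u"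

text \<open>A counterclockwise Larmor circle has its center to the left of the velocity.\<close>

definition larmor_center ::
    "complex set \<Rightarrow> (real \<Rightarrow> complex) \<Rightarrow> real \<Rightarrow> real \<Rightarrow> real \<Rightarrow> complex" where
  "larmor_center \<Omega> \<Gamma> \<mu> s u = exit_point \<Omega> \<Gamma> s u + of_real \<mu> * \<i> * inward_velocity \<Gamma> s u"

definition larmor_path ::
    "complex set \<Rightarrow> (real \<Rightarrow> complex) \<Rightarrow> real \<Rightarrow> real \<Rightarrow> real \<Rightarrow> real \<Rightarrow> complex" where
  "larmor_path \<Omega> \<Gamma> \<mu> s u t =
     larmor_center \<Omega> \<Gamma> \<mu> s u
       + (exit_point \<Omega> \<Gamma> s u - larmor_center \<Omega> \<Gamma> \<mu> s u) * cis (t / \<mu>)"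

definition arc_length ::
    "complex set \<Rightarrow> (real \<Rightarrow> complex) \<Rightarrow> real \<Rightarrow> real \<Rightarrow> real \<Rightarrow> real" where
  "arc_length \<Omega> \<Gamma> \<mu> s u = hitting_time \<Omega> (larmor_path \<Omega> \<Gamma> \<mu> s u)"

definition return_point ::
    "complex set \<Rightarrow> (real \<Rightarrow> complex) \<Rightarrow> real \<Rightarrow> real \<Rightarrow> real \<Rightarrow> complex" where
  "return_point \<Omega> \<Gamma> \<mu> s u = larmor_path \<Omega> \<Gamma> \<mu> s u (arc_length \<Omega> \<Gamma> \<mu> s u)"

definition return_velocity ::
    "complex set \<Rightarrow> (real \<Rightarrow> complex) \<Rightarrow> real \<Rightarrow> real \<Rightarrow> real \<Rightarrow> complex" where
  "return_velocity \<Omega> \<Gamma> \<mu> s u =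
     vector_derivative (larmor_path \<Omega> \<Gamma> \<mu> s u) (at (arc_length \<Omega> \<Gamma> \<mu> s u))"

text \<open>The Larmor disc minus \<open>\<Omega>\<close>. When the Larmor circle meets the boundary only at the exit
  and return points, as it does for \<open>\<mu>\<close> below the minimal radius of curvature, this is the
  region enclosed by the Larmor arc and the boundary arc between these two points.\<close>

definition outer_area ::
    "complex set \<Rightarrow> (real \<Rightarrow> complex) \<Rightarrow> real \<Rightarrow> real \<Rightarrow> real \<Rightarrow> real" where
  "outer_area \<Omega> \<Gamma> \<mu> s u = measure lebesgue (cball (larmor_center \<Omega> \<Gamma> \<mu> s u) \<mu> - \<Omega>)"

section \<open>The phase annulus and the return map\<close>

text \<open>The circle \<open>\<real>/L\<int>\<close> is represented by \<open>[0, L)\<close>.\<close>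

definition annulus :: "real \<Rightarrow> (real \<times> real) set" where
  "annulus L = {0..<L} \<times> {-1..1}"

definition boundary_param :: "real \<Rightarrow> (real \<Rightarrow> complex) \<Rightarrow> complex \<Rightarrow> real" where
  "boundary_param L \<Gamma> p = (THE s. s \<in> {0..<L} \<and> \<Gamma> s = p)"

text \<open>The second component of the result is \<open>- cos \<theta>\<close> for the angle \<open>\<theta>\<close> between two unit
  vectors, the velocity and the tangent.\<close>

definition return_map ::
    "complex set \<Rightarrow> real \<Rightarrow> (real \<Rightarrow> complex) \<Rightarrow> real \<Rightarrow> real \<times> real \<Rightarrow> real \<times> real" where
  "return_map \<Omega> L \<Gamma> \<mu> = (\<lambda>(s, u).
     if \<bar>u\<bar> = 1 then (s, u)
     else let s' = boundary_param L \<Gamma> (return_point \<Omega> \<Gamma> \<mu> s u)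
          in (s', - (return_velocity \<Omega> \<Gamma> \<mu> s u \<bullet> tangent \<Gamma> s')))"

section \<open>Twist maps\<close>

definition strip :: "(real \<times> real) set" where
  "strip = UNIV \<times> {-1..1}"

definition open_strip :: "(real \<times> real) set" where
  "open_strip = UNIV \<times> {-1<..<1}"

definition cover_proj :: "real \<Rightarrow> real \<times> real \<Rightarrow> real \<times> real" where
  "cover_proj L = (\<lambda>(s, u). (s rmod L, u))"

definition is_lift ::
    "real \<Rightarrow> (real \<times> real \<Rightarrow> real \<times> real) \<Rightarrow> (real \<times> real \<Rightarrow> real \<times> real) \<Rightarrow> bool" where
  "is_lift L T F \<longleftrightarrow>
     continuous_on strip F \<and> F \<in> strip \<rightarrow> strip \<and>
     (\<forall>x\<in>strip. cover_proj L (F x) = T (cover_proj L x))"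

text \<open>The standard area form \<open>ds \<and> du\<close>.\<close>

definition area_form :: "real \<times> real \<Rightarrow> real \<times> real \<Rightarrow> real" where
  "area_form v w = fst v * snd w - snd v * fst w"

definition symplectic :: "(real \<times> real \<Rightarrow> real \<times> real) \<Rightarrow> bool" where
  "symplectic F \<longleftrightarrow>
     (\<exists>F'. (\<forall>x\<in>open_strip. (F has_derivative F' x) (at x)) \<and>
           (\<forall>v. continuous_on open_strip (\<lambda>x. F' x v)) \<and>
           (\<forall>x\<in>open_strip. \<forall>v w. area_form (F' x v) (F' x w) = area_form v w))"

definition generating_domain :: "(real \<times> real \<Rightarrow> real \<times> real) \<Rightarrow> (real \<times> real) set" where
  "generating_domain F = (\<lambda>x. (fst x, fst (F x))) ` open_strip"

text \<open>The derivative condition says that \<open>dG = u' ds' - u ds\<close> at \<open>(s, s')\<close>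
  whenever \<open>F (s, u) = (s', u')\<close>. Values of \<open>G\<close> outside \<open>generating_domain F\<close> are irrelevant.\<close>

definition generating_function ::
    "real \<Rightarrow> (real \<times> real \<Rightarrow> real \<times> real) \<Rightarrow> (real \<times> real \<Rightarrow> real) \<Rightarrow> bool" where
  "generating_function L F G \<longleftrightarrow>
     (\<forall>(s, s')\<in>generating_domain F. G (s + L, s' + L) = G (s, s')) \<and>
     (\<forall>(s, u)\<in>open_strip.
        (G has_derivative (\<lambda>(h, h'). snd (F (s, u)) * h' - u * h)) (at (s, fst (F (s, u)))))"

text \<open>Two lifts differ by a translation \<open>(s, u) \<mapsto> (s + m L, u)\<close> with \<open>m\<close> an integer, so the
  conditions below do not depend on the choice of \<open>F\<close>.\<close>

definition twist_map :: "real \<Rightarrow> (real \<times> real \<Rightarrow> real \<times> real) \<Rightarrow> bool" where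
  "twist_map L T \<longleftrightarrow>
     T \<in> annulus L \<rightarrow> annulus L \<and>
     (\<exists>F. is_lift L T F \<and> symplectic F \<and>
          (\<forall>(s, u)\<in>strip. F (s + L, u) = F (s, u) + (L, 0)) \<and>
          (\<forall>(s, u)\<in>open_strip. \<exists>d>0.
             ((\<lambda>u. fst (F (s, u))) has_real_derivative d) (at u)) \<and>
          (\<exists>G. generating_function L F G))"

end

theory Submission
  imports Defs
begin

text \<open>Describe the boundary by its tangent angle: the tangent at \<open>\<Gamma> s\<close> is \<open>cis (\<phi> s)\<close>, and
  \<open>\<phi>' = \<kappa> > 0\<close>. A trajectory that leaves \<open>\<Gamma> s\<^sub>0\<close> in the direction \<open>\<alpha>\<close> reaches the boundary at
  \<open>\<Gamma> s\<^sub>1\<close>, still in direction \<open>\<alpha>\<close>, then follows the Larmor circle with center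
  \<open>c = \<Gamma> s\<^sub>1 + \<mu> \<i> cis \<alpha>\<close> and re-enters at \<open>\<Gamma> s\<^sub>2\<close> in a direction \<open>\<beta>\<close>, with
  \<open>c = \<Gamma> s\<^sub>2 + \<mu> \<i> cis \<beta>\<close>. Let \<open>\<theta>\<^sub>0 = \<alpha> - \<phi> s\<^sub>0\<close>, \<open>\<theta>\<^sub>1 = \<phi> s\<^sub>1 - \<alpha>\<close>, \<open>\<theta>\<^sub>2 = \<beta> - \<phi> s\<^sub>2\<close>.

  Because \<open>\<mu> \<kappa> < 1\<close>, the inner parallel curve \<open>E = \<Gamma> + \<mu> \<i> cis \<phi>\<close>, for which
  \<open>E' = (1 - \<mu> \<kappa>) cis \<phi>\<close>, turns like \<open>\<Gamma>\<close> and is again a closed convex curve. It follows that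
  a disc of radius \<open>\<mu>\<close> rolls inside the table (lemma \<open>rolling_disc\<close>), and hence that the distance
  from a point to the boundary has at most one critical point of value at most \<open>\<mu>\<close> (lemma
  \<open>nearest_boundary_point_unique\<close>). So the Larmor circle meets the boundary exactly at the exit and the
  entry point (lemma \<open>larmor_entry\<close>), both times transversally, and implicit differentiation shows that
  \<open>s\<^sub>1\<close>, \<open>c\<close>, \<open>s\<^sub>2\<close>, \<open>u\<^sub>2\<close> are continuously differentiable functions of \<open>(s\<^sub>0, u\<^sub>0)\<close>.

  The map preserves area because the area form of the plane, at the Larmor center \<open>c\<close>, is
  \<open>- \<mu> ds \<and> du\<close> both in terms of \<open>(s\<^sub>0, u\<^sub>0)\<close> and in terms of \<open>(s\<^sub>2, u\<^sub>2)\<close> (lemma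
  \<open>area_preserving\<close>). It twists because, up to positive factors, \<open>\<partial>s\<^sub>2/\<partial>u\<^sub>0\<close> is
  \<open>\<ell>\<^sub>1 sin (\<beta> - \<phi> s\<^sub>1) - \<mu> sin \<theta>\<^sub>1 sin (\<beta> - \<alpha>)\<close>. Convexity and the rolling disc at \<open>\<Gamma> s\<^sub>1\<close>
  give \<open>\<ell>\<^sub>1 > 2 \<mu> sin \<theta>\<^sub>1\<close> and \<open>\<theta>\<^sub>1 < \<beta> - \<phi> s\<^sub>1 < \<pi>\<close> (lemmas \<open>chord_gt\<close> and
  \<open>angle_bounds\<close>), and these make the difference positive (lemma \<open>twist_inequality\<close>).

  As for the generating function, moving the center by \<open>dc\<close> changes the area \<open>S\<close> of the Larmor disc
  outside \<open>\<Omega>\<close> by the flux of \<open>dc\<close> through the outer arc, \<open>dS = \<mu> (cis \<alpha> - cis \<beta>) \<bullet> dc\<close> (lemma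
  \<open>has_derivative_outside_area\<close>). Together with
  \<open>d\<ell>\<^sub>1 = cos \<theta>\<^sub>1 ds\<^sub>1 - cos \<theta>\<^sub>0 ds\<^sub>0\<close> and \<open>|\<gamma>| = \<mu> (\<beta> - \<alpha>)\<close> this gives
  \<open>d (- \<ell>\<^sub>1 - |\<gamma>| + S / \<mu>) = u\<^sub>2 ds\<^sub>2 - u\<^sub>0 ds\<^sub>0\<close> (lemma \<open>action_has_derivative\<close>); by the twist
  condition \<open>(s\<^sub>0, s\<^sub>2)\<close> may serve as coordinates, in which the action is the generating function.

  The lift that equals \<open>(s, -1) \<mapsto> (s, -1)\<close> and \<open>(s, 1) \<mapsto> (s + L, 1)\<close> on the boundary of the strip is
  continuous there, since \<open>s\<^sub>2 - s\<^sub>1\<close> is at most a constant times \<open>sin \<theta>\<^sub>1\<close> and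
  \<open>\<bar>\<theta>\<^sub>2 - \<theta>\<^sub>1\<bar> < \<phi> s\<^sub>2 - \<phi> s\<^sub>1\<close>. Any other lift differs from it by a translation by a multiple
  of \<open>L\<close>, and two generating functions have the same derivative along the connected image of the
  strip, so they differ by a constant.\<close>

section \<open>The area of a moving disc outside an open set\<close>

lemma indicator_integrable_Icc:
  fixes S :: "real set"
  assumes "closed S"
  shows "(indicator S :: real \<Rightarrow> real) integrable_on {a..b}"
proof -
  have "compact ({a..b} \<inter> S)"
    using assms by (intro compact_Int_closed) auto
  then have "integrable lborel (indicator ({a..b} \<inter> S) :: real \<Rightarrow> real)"
    using emeasure_compact_finite by (intro integrable_real_indicator) (auto intro: borel_compact)
  then have "set_integrable lborel {a..b} (indicator S :: real \<Rightarrow> real)"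
    by (simp add: set_integrable_def flip: indicator_inter_arith)
  then show ?thesis
    by (rule set_borel_integral_eq_integral(1))
qed

lemma primitive_indicator_lipschitz:
  fixes S :: "real set"
  assumes "closed S" "a \<le> x" "a \<le> y"
  shows "\<bar>integral {a..x} (indicator S) - integral {a..y} (indicator S :: real \<Rightarrow> real)\<bar> \<le> \<bar>x - y\<bar>"
  using assms(2,3)
proof (induction x y rule: linorder_wlog)
  case (le x y)
  have "integral {a..x} (indicator S) + integral {x..y} (indicator S) = integral {a..y} (indicator S :: real \<Rightarrow> real)"
    using le by (intro Henstock_Kurzweil_Integration.integral_combine indicator_integrable_Icc assms) auto
  moreover have "0 \<le> integral {x..y} (indicator S :: real \<Rightarrow> real)"
    by (rule integral_nonneg[OF indicator_integrable_Icc[OF assms(1)]]) auto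
  moreover have "integral {x..y} (indicator S :: real \<Rightarrow> real) \<le> integral {x..y} (\<lambda>_. 1)"
    by (rule integral_le[OF indicator_integrable_Icc[OF assms(1)]]) (auto simp: indicator_def)
  ultimately show ?case using le by simp
next
  case (sym x y)
  then show ?case by (simp add: abs_minus_commute)
qed

text \<open>The overlap of a fixed closed set with a sliding interval grows at the front end and shrinks at the
  rear end. The derivative only sees whether the two ends lie in the set, which is why it exists as soon as
  neither end is on the frontier.\<close>

lemma sliding_window:
  fixes S :: "real set"
  assumes S: "closed S" and w: "w \<ge> 0"
  defines "J \<equiv> \<lambda>c. integral {c - w..c + w} (indicator S :: real \<Rightarrow> real)"
  shows sliding_window_lipschitz: "\<bar>J c - J d\<bar> \<le> 2 * \<bar>c - d\<bar>"
    and sliding_window_derivative: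
      "c + w \<notin> frontier S \<Longrightarrow> c - w \<notin> frontier S \<Longrightarrow>
       (J has_real_derivative indicator S (c + w) - indicator S (c - w)) (at c)"
proof -
  have split: "J e = integral {a..e + w} (indicator S) - integral {a..e - w} (indicator S)"
    if "a \<le> e - w" for a e
  proof -
    have "integral {a..e - w} (indicator S) + integral {e - w..e + w} (indicator S) =
        integral {a..e + w} (indicator S :: real \<Rightarrow> real)"
      using that w by (intro Henstock_Kurzweil_Integration.integral_combine indicator_integrable_Icc S) auto
    then show ?thesis by (simp add: J_def)
  qed
  show "\<bar>J c - J d\<bar> \<le> 2 * \<bar>c - d\<bar>"
  proof -
    define a where "a = min (c - w) (d - w)"
    have "J c = integral {a..c + w} (indicator S) - integral {a..c - w} (indicator S)"
         "J d = integral {a..d + w} (indicator S) - integral {a..d - w} (indicator S)"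
      by (intro split; simp add: a_def)+
    moreover have "\<bar>integral {a..c + w} (indicator S) - integral {a..d + w} (indicator S :: real \<Rightarrow> real)\<bar> \<le> \<bar>c - d\<bar>"
      by (rule order_trans[OF primitive_indicator_lipschitz[OF S]]) (use w in \<open>auto simp: a_def\<close>)
    moreover have "\<bar>integral {a..c - w} (indicator S) - integral {a..d - w} (indicator S :: real \<Rightarrow> real)\<bar> \<le> \<bar>c - d\<bar>"
      by (rule order_trans[OF primitive_indicator_lipschitz[OF S]]) (use w in \<open>auto simp: a_def\<close>)
    moreover have "\<bar>(p - q) - (p' - q')\<bar> \<le> 2 * e" if "\<bar>p - p'\<bar> \<le> e" "\<bar>q - q'\<bar> \<le> e"
      for p q p' q' e :: real
      using that by linarith
    ultimately show ?thesis by simp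
  qed
  show "(J has_real_derivative indicator S (c + w) - indicator S (c - w)) (at c)"
    if fr: "c + w \<notin> frontier S" "c - w \<notin> frontier S"
  proof -
    define a where "a = c - w - 1"
    define b where "b = c + w + 1"
    define P where "P z = integral {a..z} (indicator S :: real \<Rightarrow> real)" for z
    have P: "(P has_real_derivative indicator S z) (at z)" if "z \<in> {a<..<b}" "z \<notin> frontier S" for z
    proof -
      have "(P has_vector_derivative indicator S z) (at z within ({a..b} - {}))"
        unfolding P_def
      proof (rule integral_has_vector_derivative_continuous_at)
        show "(indicator S :: real \<Rightarrow> real) integrable_on {a..b}"
          by (rule indicator_integrable_Icc[OF S])
        show "continuous (at z within {a..b} - {}) (indicator S :: real \<Rightarrow> real)"
          by (rule continuous_at_imp_continuous_at_within) (use that in \<open>simp add: isCont_indicator\<close>)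
      qed (use that in auto)
      then show ?thesis
        using that by (simp add: has_real_derivative_iff_has_vector_derivative at_within_Icc_at)
    qed
    have "(P has_real_derivative indicator S (c + w)) (at (c + w))"
         "(P has_real_derivative indicator S (c - w)) (at (c - w))"
      by (intro P; use fr w in \<open>simp add: a_def b_def\<close>)+
    then have deriv: "((\<lambda>e. P (e + w) - P (e - w)) has_real_derivative indicator S (c + w) - indicator S (c - w)) (at c)"
      by (auto intro!: derivative_eq_intros DERIV_chain2[where f = P])
    have ev: "\<forall>\<^sub>F e in nhds c. P (e + w) - P (e - w) = J e"
    proof -
      have "\<forall>\<^sub>F e in nhds c. e \<in> {c - 1<..<c + 1}"
        by (rule eventually_nhds_in_open) auto
      then show ?thesis
        by eventually_elim (subst split[of a]; simp add: a_def P_def)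
    qed
    show ?thesis
      by (rule DERIV_cong_ev[OF refl ev refl, THEN iffD1, OF deriv])
  qed
qed

lemma lborel_complex_distr:
  "(lborel :: complex measure) = distr (lborel \<Otimes>\<^sub>M lborel) borel (\<lambda>(y, x). Complex x y)"
proof (rule lborel_eqI)
  fix l u :: complex
  assume le: "\<And>b. b \<in> Basis \<Longrightarrow> l \<bullet> b \<le> u \<bullet> b"
  have m [measurable]: "(\<lambda>(y, x). Complex x y) \<in> (lborel \<Otimes>\<^sub>M lborel) \<rightarrow>\<^sub>M borel"
    unfolding lborel_prod by (auto intro!: borel_measurable_continuous_onI continuous_intros
        simp: split_beta' Complex_eq)
  have "(\<lambda>(y, x). Complex x y) -` box l u \<inter> space (lborel \<Otimes>\<^sub>M lborel) =
      {Im l<..<Im u} \<times> {Re l<..<Re u}"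
    by (auto simp: box_def Basis_complex_def space_pair_measure inner_complex_def)
  moreover have "Re l \<le> Re u" "Im l \<le> Im u"
    using le[of 1] le[of \<i>] by (auto simp: Basis_complex_def inner_complex_def)
  ultimately show "emeasure (distr (lborel \<Otimes>\<^sub>M lborel) borel (\<lambda>(y, x). Complex x y)) (box l u)
      = ennreal (\<Prod>b\<in>Basis. (u - l) \<bullet> b)"
    by (subst emeasure_distr)
       (auto simp: lborel.emeasure_pair_measure_Times Basis_complex_def inner_complex_def
         ennreal_mult mult.commute)
qed auto

text \<open>Reflection in the diagonal. It exchanges the two coordinate directions, so that only
  horizontal translations of a disc have to be studied.\<close>

definition flip :: "complex \<Rightarrow> complex" where
  "flip z = Complex (Im z) (Re z)"

lemma lborel_flip: "(lborel :: complex measure) = distr lborel borel flip"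
proof (rule lborel_eqI)
  fix l u :: complex
  assume le: "\<And>b. b \<in> Basis \<Longrightarrow> l \<bullet> b \<le> u \<bullet> b"
  have m [measurable]: "flip \<in> lborel \<rightarrow>\<^sub>M borel"
    by (auto intro!: borel_measurable_continuous_onI continuous_intros simp: flip_def Complex_eq)
  have "flip -` box l u \<inter> space lborel = box (flip l) (flip u)"
    by (auto simp: box_def Basis_complex_def flip_def inner_complex_def)
  then show "emeasure (distr lborel borel flip) (box l u) = ennreal (\<Prod>b\<in>Basis. (u - l) \<bullet> b)"
    using le[of 1] le[of \<i>] by (subst emeasure_distr)
      (auto simp: emeasure_lborel_box_eq Basis_complex_def flip_def inner_complex_def mult.commute)
qed auto

lemma measure_by_slices:
  fixes K :: "complex set"
  assumes "compact K"
  shows "measure lborel K = (\<integral>y. (\<integral>x. indicator K (Complex x y) \<partial>lborel) \<partial>lborel)"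
    and "integrable lborel (\<lambda>y. (\<integral>x. indicator K (Complex x y) \<partial>lborel :: real))"
proof -
  have K [measurable]: "K \<in> sets borel" using assms by (simp add: borel_compact)
  have m [measurable]: "(\<lambda>(y, x). Complex x y) \<in> (lborel \<Otimes>\<^sub>M lborel) \<rightarrow>\<^sub>M borel"
    unfolding lborel_prod by (auto intro!: borel_measurable_continuous_onI continuous_intros
        simp: split_beta' Complex_eq)
  have "integrable lborel (indicator K :: complex \<Rightarrow> real)"
    using emeasure_compact_finite[OF assms] by simp
  then have int: "integrable (lborel \<Otimes>\<^sub>M lborel) (\<lambda>p. indicator K ((\<lambda>(y, x). Complex x y) p) :: real)"
    by (subst (asm) lborel_complex_distr, subst (asm) integrable_distr_eq) auto
  have "measure lborel K = (\<integral>z. indicator K z \<partial>(lborel :: complex measure) :: real)"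
    by simp
  also have "\<dots> = (\<integral>p. indicator K ((\<lambda>(y, x). Complex x y) p) \<partial>(lborel \<Otimes>\<^sub>M lborel) :: real)"
    by (subst lborel_complex_distr, subst integral_distr) auto
  also have "\<dots> = (\<integral>y. (\<integral>x. indicator K (Complex x y) \<partial>lborel) \<partial>lborel)"
    using lborel_pair.integral_fst'[OF int] by simp
  finally show "measure lborel K = (\<integral>y. (\<integral>x. indicator K (Complex x y) \<partial>lborel) \<partial>lborel)" .
  show "integrable lborel (\<lambda>y. (\<integral>x. indicator K (Complex x y) \<partial>lborel :: real))"
    using lborel_pair.integrable_fst'[OF int] by simp
qed

definition outside_area :: "complex set \<Rightarrow> real \<Rightarrow> complex \<Rightarrow> real" where
  "outside_area \<Omega> r z = measure lborel (cball z r - \<Omega>)"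

lemma outside_area_flip:
  assumes "open \<Omega>"
  shows "outside_area (flip ` \<Omega>) r (flip z) = outside_area \<Omega> r z"
proof -
  have m [measurable]: "flip \<in> lborel \<rightarrow>\<^sub>M borel"
    by (auto intro!: borel_measurable_continuous_onI continuous_intros simp: flip_def Complex_eq)
  have flip2: "flip (flip z) = z" for z by (simp add: flip_def)
  have d: "dist (flip z) (flip w) = dist z w" for z w
    by (auto simp: flip_def dist_norm cmod_def add.commute)
  have "cball (flip z) r - flip ` \<Omega> = flip -` (cball z r - \<Omega>)"
    using d flip2 by (auto simp: image_iff) (metis+)
  moreover have "measure (distr lborel borel flip) (cball z r - \<Omega>) = measure lborel (flip -` (cball z r - \<Omega>))"
    using assms by (subst measure_distr) auto
  ultimately show ?thesis
    unfolding outside_area_def using lborel_flip by simp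
qed

definition outside_slice :: "complex set \<Rightarrow> real \<Rightarrow> real set" where
  "outside_slice \<Omega> y = {x. Complex x y \<notin> \<Omega>}"

lemma closed_outside_slice: "open \<Omega> \<Longrightarrow> closed (outside_slice \<Omega> y)"
proof -
  assume "open \<Omega>"
  then have "closed ((\<lambda>x. Complex x y) -` (- \<Omega>))"
    by (intro closed_vimage) (auto simp: Complex_eq intro!: continuous_intros)
  then show ?thesis by (simp add: outside_slice_def vimage_def)
qed

lemma frontier_outside_slice:
  assumes "Complex x y \<notin> frontier \<Omega>"
  shows "x \<notin> frontier (outside_slice \<Omega> y)"
proof -
  have "isCont (indicator (- \<Omega>) :: complex \<Rightarrow> real) (Complex x y)"
    using assms by (simp add: isCont_indicator frontier_complement)
  moreover have "isCont (\<lambda>x. Complex x y) x"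
    by (auto simp: Complex_eq intro!: continuous_intros)
  ultimately have "isCont (\<lambda>x. indicator (- \<Omega>) (Complex x y) :: real) x"
    by (rule isCont_o2[rotated])
  moreover have "(\<lambda>x. indicator (- \<Omega>) (Complex x y) :: real) = indicator (outside_slice \<Omega> y)"
    by (auto simp: outside_slice_def indicator_def)
  ultimately show ?thesis by (simp add: isCont_indicator)
qed

lemma cball_slice:
  assumes "r > 0"
  shows "Complex x y \<in> cball (Complex c b) r \<longleftrightarrow>
    y \<in> {b - r..b + r} \<and> x \<in> {c - sqrt (r\<^sup>2 - (y - b)\<^sup>2)..c + sqrt (r\<^sup>2 - (y - b)\<^sup>2)}"
proof -
  have "Complex x y \<in> cball (Complex c b) r \<longleftrightarrow> sqrt ((x - c)\<^sup>2 + (y - b)\<^sup>2) \<le> r"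
    by (simp add: dist_norm cmod_def power2_commute)
  also have "\<dots> \<longleftrightarrow> (x - c)\<^sup>2 + (y - b)\<^sup>2 \<le> r\<^sup>2"
    using assms by (metis less_imp_le real_sqrt_le_iff real_sqrt_unique)
  also have "\<dots> \<longleftrightarrow> (y - b)\<^sup>2 \<le> r\<^sup>2 \<and> \<bar>x - c\<bar> \<le> sqrt (r\<^sup>2 - (y - b)\<^sup>2)"
  proof -
    have "\<bar>x - c\<bar> \<le> sqrt (r\<^sup>2 - (y - b)\<^sup>2) \<longleftrightarrow> (x - c)\<^sup>2 \<le> r\<^sup>2 - (y - b)\<^sup>2"
      by (metis real_sqrt_abs real_sqrt_le_iff)
    moreover have "(x - c)\<^sup>2 \<ge> 0" by simp
    ultimately show ?thesis by linarith
  qed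
  also have "(y - b)\<^sup>2 \<le> r\<^sup>2 \<longleftrightarrow> \<bar>y - b\<bar> \<le> r"
    using assms by (simp add: abs_le_square_iff[symmetric])
  finally show ?thesis by (auto simp: abs_le_iff)
qed

lemma outside_area_slices:
  fixes b :: real
  assumes "open \<Omega>" "r > 0"
  defines "J \<equiv> \<lambda>c y. integral {c - sqrt (r\<^sup>2 - (y - b)\<^sup>2)..c + sqrt (r\<^sup>2 - (y - b)\<^sup>2)}
                    (indicator (outside_slice \<Omega> y) :: real \<Rightarrow> real)"
  shows "outside_area \<Omega> r (Complex c b) = (\<integral>y. indicator {b - r..b + r} y * J c y \<partial>lborel)"
    and "integrable lborel (\<lambda>y. indicator {b - r..b + r} y * J c y)"
proof -
  define K where "K = cball (Complex c b) r - \<Omega>"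
  have K: "compact K"
    unfolding K_def using assms by (intro compact_diff) auto
  have "(\<integral>x. indicator K (Complex x y) \<partial>lborel) = indicator {b - r..b + r} y * J c y" for y
  proof -
    define I where "I = {c - sqrt (r\<^sup>2 - (y - b)\<^sup>2)..c + sqrt (r\<^sup>2 - (y - b)\<^sup>2)}"
    have "compact (I \<inter> outside_slice \<Omega> y)"
      using closed_outside_slice[OF assms(1)] unfolding I_def by (intro compact_Int_closed) auto
    then have "integrable lborel (indicator (I \<inter> outside_slice \<Omega> y) :: real \<Rightarrow> real)"
      using emeasure_compact_finite by (intro integrable_real_indicator) (auto intro: borel_compact)
    then have si: "set_integrable lborel I (indicator (outside_slice \<Omega> y) :: real \<Rightarrow> real)"
      by (simp add: set_integrable_def flip: indicator_inter_arith)
    have "(\<integral>x. indicator K (Complex x y) \<partial>lborel :: real) =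
      (\<integral>x. indicator {b - r..b + r} y * (indicator I x *\<^sub>R indicator (outside_slice \<Omega> y) x) \<partial>lborel)"
    proof (rule Bochner_Integration.integral_cong[OF refl])
      fix x
      have "Complex x y \<in> K \<longleftrightarrow> y \<in> {b - r..b + r} \<and> x \<in> I \<and> x \<in> outside_slice \<Omega> y"
        unfolding K_def I_def Diff_iff cball_slice[OF assms(2)] outside_slice_def mem_Collect_eq by blast
      then show "(indicator K (Complex x y) :: real) =
          indicator {b - r..b + r} y * (indicator I x *\<^sub>R indicator (outside_slice \<Omega> y) x)"
        by (simp only: indicator_def of_bool_conj real_scaleR_def)
    qed
    also have "\<dots> = indicator {b - r..b + r} y * (LBINT x:I. indicator (outside_slice \<Omega> y) x)"
      unfolding set_lebesgue_integral_def by (rule integral_mult_right_zero)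
    also have "(LBINT x:I. indicator (outside_slice \<Omega> y) x) = J c y"
      using set_borel_integral_eq_integral(2)[OF si] by (simp add: J_def I_def)
    finally show ?thesis .
  qed
  note inner = this
  show "outside_area \<Omega> r (Complex c b) = (\<integral>y. indicator {b - r..b + r} y * J c y \<partial>lborel)"
    using measure_by_slices(1)[OF K] unfolding inner by (simp only: outside_area_def K_def)
  show "integrable lborel (\<lambda>y. indicator {b - r..b + r} y * J c y)"
    using measure_by_slices(2)[OF K] unfolding inner .
qed

text \<open>A horizontal motion of the disc slides its horizontal slices. The difference quotients of the slices
  are bounded by 2, and all but the finitely many slices that end on the frontier have a derivative,
  so dominated convergence applies.\<close>

lemma outside_area_partial_slices:
  fixes b :: real
  assumes "open \<Omega>" "r > 0" and fin: "finite (sphere (Complex c b) r \<inter> frontier \<Omega>)"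
  defines "w \<equiv> \<lambda>y. sqrt (r\<^sup>2 - (y - b)\<^sup>2)"
  shows "((\<lambda>c. outside_area \<Omega> r (Complex c b)) has_real_derivative
    (\<integral>y. indicator {b - r..b + r} y *
        (indicator (outside_slice \<Omega> y) (c + w y) - indicator (outside_slice \<Omega> y) (c - w y)) \<partial>lborel)) (at c)"
    (is "(?A has_real_derivative integral\<^sup>L lborel ?D) (at c)")
proof -
  define J where "J c y = integral {c - w y..c + w y} (indicator (outside_slice \<Omega> y) :: real \<Rightarrow> real)" for c y
  have slices: "?A c = (\<integral>y. indicator {b - r..b + r} y * J c y \<partial>lborel)"
    "integrable lborel (\<lambda>y. indicator {b - r..b + r} y * J c y)" for c
    unfolding J_def w_def by (rule outside_area_slices[OF assms(1,2)])+
  have w: "w y \<ge> 0" if "y \<in> {b - r..b + r}" for y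
  proof -
    have "\<bar>y - b\<bar> \<le> \<bar>r\<bar>" using that by auto
    then show ?thesis by (simp add: w_def abs_le_square_iff)
  qed
  have meas: "?D \<in> borel_measurable lborel"
  proof -
    have *: "indicator (outside_slice \<Omega> y) x = (indicator (- \<Omega>) (Complex x y) :: real)" for x y
      by (auto simp: outside_slice_def indicator_def)
    have [measurable]: "- \<Omega> \<in> sets borel" using assms(1) by auto
    have [measurable]: "(\<lambda>y. Complex (c + w y) y) \<in> borel_measurable borel"
      "(\<lambda>y. Complex (c - w y) y) \<in> borel_measurable borel"
      unfolding w_def by (auto simp: Complex_eq intro!: borel_measurable_continuous_onI continuous_intros)
    show ?thesis unfolding * by measurable
  qed
  show ?thesis
    unfolding DERIV_def tendsto_at_iff_sequentially comp_def
  proof (intro allI impI)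
    fix X :: "nat \<Rightarrow> real"
    assume X: "\<forall>i. X i \<in> UNIV - {0}" "X \<longlonglongrightarrow> 0"
    have quot: "(?A (c + X i) - ?A c) / X i =
        (\<integral>y. (indicator {b - r..b + r} y * J (c + X i) y - indicator {b - r..b + r} y * J c y) / X i \<partial>lborel)" for i
      by (simp only: slices(1) Bochner_Integration.integral_diff[OF slices(2) slices(2)] integral_divide_zero)
    show "(\<lambda>i. (?A (c + X i) - ?A c) / X i) \<longlonglongrightarrow> integral\<^sup>L lborel ?D"
      unfolding quot
    proof (rule integral_dominated_convergence[where w = "\<lambda>y. 2 * indicator {b - r..b + r} y"])
      show "?D \<in> borel_measurable lborel" by (fact meas)
      show "(\<lambda>y. (indicator {b - r..b + r} y * J (c + X i) y - indicator {b - r..b + r} y * J c y) / X i)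
          \<in> borel_measurable lborel" for i
        using slices(2) by (intro borel_measurable_divide borel_measurable_diff borel_measurable_integrable) auto
      show "integrable lborel (\<lambda>y. 2 * indicator {b - r..b + r} y :: real)"
        by (intro integrable_mult_right integrable_real_indicator emeasure_compact_finite) auto
      show "AE y in lborel. norm ((indicator {b - r..b + r} y * J (c + X i) y - indicator {b - r..b + r} y * J c y) / X i)
          \<le> 2 * indicator {b - r..b + r} y" for i
      proof (rule AE_I2)
        fix y
        show "norm ((indicator {b - r..b + r} y * J (c + X i) y - indicator {b - r..b + r} y * J c y) / X i)
          \<le> 2 * indicator {b - r..b + r} y"
        proof (cases "y \<in> {b - r..b + r}")
          case True
          have "\<bar>J (c + X i) y - J c y\<bar> \<le> 2 * \<bar>c + X i - c\<bar>"
            unfolding J_def by (rule sliding_window_lipschitz[OF closed_outside_slice[OF assms(1)] w[OF True]])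
          moreover have "\<bar>X i\<bar> > 0" using X(1) by (metis DiffD2 singletonI zero_less_abs_iff)
          ultimately have "\<bar>J (c + X i) y - J c y\<bar> / \<bar>X i\<bar> \<le> 2"
            by (simp only: pos_divide_le_eq add_diff_cancel_left')
          then show ?thesis
            using True by (simp only: indicator_simps mult_1 real_norm_def abs_divide)
        next
          case False
          then show ?thesis
            by (simp only: indicator_simps simp_thms not_False_eq_True mult_zero_left diff_self div_0 norm_zero mult_zero_right order_refl)
        qed
      qed
      have "AE y in lborel. y \<notin> Im ` (sphere (Complex c b) r \<inter> frontier \<Omega>)"
        by (rule AE_not_in[OF finite_imp_null_set_lborel[OF finite_imageI[OF fin]]])
      then show "AE y in lborel. (\<lambda>i. (indicator {b - r..b + r} y * J (c + X i) y - indicator {b - r..b + r} y * J c y) / X i)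
          \<longlonglongrightarrow> ?D y"
      proof eventually_elim
        case (elim y)
        show ?case
        proof (cases "y \<in> {b - r..b + r}")
          case True
          have on: "Complex (c + w y) y \<in> sphere (Complex c b) r" "Complex (c - w y) y \<in> sphere (Complex c b) r"
          proof -
            have "(w y)\<^sup>2 = r\<^sup>2 - (y - b)\<^sup>2"
              using w[OF True] by (simp add: w_def)
            then show "Complex (c + w y) y \<in> sphere (Complex c b) r" "Complex (c - w y) y \<in> sphere (Complex c b) r"
              using \<open>r > 0\<close> by (simp_all add: dist_norm cmod_def power2_commute[of b y])
          qed
          have "Complex (c + w y) y \<notin> frontier \<Omega>" "Complex (c - w y) y \<notin> frontier \<Omega>"
            using elim on by (metis IntI complex.sel(2) imageI)+
          then have "(J' has_real_derivative indicator (outside_slice \<Omega> y) (c + w y) - indicator (outside_slice \<Omega> y) (c - w y)) (at c)"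
            if "J' = (\<lambda>c. J c y)" for J'
            unfolding that J_def
            by (intro sliding_window_derivative closed_outside_slice assms w True frontier_outside_slice)
          then have "((\<lambda>h. (J (c + h) y - J c y) / h) \<longlongrightarrow>
              indicator (outside_slice \<Omega> y) (c + w y) - indicator (outside_slice \<Omega> y) (c - w y)) (at 0)"
            by (auto simp: DERIV_def)
          then show ?thesis
            using X True unfolding tendsto_at_iff_sequentially comp_def
            by (simp only: indicator_simps mult_1) blast
        qed simp
      qed
    qed
  qed
qed

definition circle_outside :: "complex set \<Rightarrow> real \<Rightarrow> complex \<Rightarrow> real \<Rightarrow> real" where
  "circle_outside \<Omega> r z t = indicator (- \<Omega>) (z + of_real r * cis t)"

text \<open>Flux of the horizontal unit vector through the part of the circle outside \<open>\<Omega>\<close>. The angles \<open>t\<close> and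
  \<open>pi - t\<close> parametrize the right and the left half of the circle by the same height.\<close>

definition outside_flux :: "complex set \<Rightarrow> real \<Rightarrow> complex \<Rightarrow> real" where
  "outside_flux \<Omega> r z =
    (LBINT t:{-pi/2..pi/2}. (circle_outside \<Omega> r z t - circle_outside \<Omega> r z (pi - t)) * (r * cos t))"

lemma circle_outside_measurable [measurable]:
  assumes "open \<Omega>"
  shows "circle_outside \<Omega> r z \<in> borel_measurable borel"
proof -
  have [measurable]: "- \<Omega> \<in> sets borel" using assms by auto
  have [measurable]: "(\<lambda>t. z + of_real r * cis t) \<in> borel_measurable borel"
    by (intro borel_measurable_continuous_onI continuous_intros)
  show ?thesis unfolding circle_outside_def by measurable
qed

text \<open>Substituting \<open>y = Im z + r sin t\<close> turns the integral over heights into one over angles, whose domain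
  does not depend on \<open>z\<close>.\<close>

lemma outside_area_partial:
  assumes "open \<Omega>" "r > 0" and fin: "finite (sphere z r \<inter> frontier \<Omega>)"
  shows "((\<lambda>x. outside_area \<Omega> r (Complex x (Im z))) has_real_derivative outside_flux \<Omega> r z) (at (Re z))"
proof -
  define c b where "c = Re z" and "b = Im z"
  have z: "z = Complex c b" by (simp add: c_def b_def)
  define w where "w y = sqrt (r\<^sup>2 - (y - b)\<^sup>2)" for y
  define f :: "real \<Rightarrow> real" where
    "f y = indicator (outside_slice \<Omega> y) (c + w y) - indicator (outside_slice \<Omega> y) (c - w y)" for y
  define g where "g t = b + r * sin t" for t
  have ends: "g (-pi/2) = b - r" "g (pi/2) = b + r" by (simp_all add: g_def)
  have "(\<integral>y. indicator {b - r..b + r} y * f y \<partial>lborel) = (LBINT y. f y * indicator {g (-pi/2)..g (pi/2)} y)"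
    unfolding ends by (simp add: mult.commute)
  also have "\<dots> = (LBINT t. f (g t) * (r * cos t) * indicator {-pi/2..pi/2} t)"
  proof (rule integral_substitution(2))
    have *: "indicator (outside_slice \<Omega> y) x = (indicator (- \<Omega>) (Complex x y) :: real)" for x y
      by (auto simp: outside_slice_def indicator_def)
    have [measurable]: "- \<Omega> \<in> sets borel" using assms(1) by auto
    have [measurable]: "(\<lambda>y. Complex (c + w y) y) \<in> borel_measurable borel"
      "(\<lambda>y. Complex (c - w y) y) \<in> borel_measurable borel"
      unfolding w_def by (auto simp: Complex_eq intro!: borel_measurable_continuous_onI continuous_intros)
    have [measurable]: "f \<in> borel_measurable borel"
      unfolding f_def * by measurable
    show "set_integrable lborel {g (-pi/2)..g (pi/2)} f"
      unfolding set_integrable_def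
    proof (rule Bochner_Integration.integrable_bound)
      show "integrable lborel (indicator {g (-pi/2)..g (pi/2)} :: real \<Rightarrow> real)"
        by (intro integrable_real_indicator emeasure_compact_finite) auto
      show "(\<lambda>x. indicator {g (-pi/2)..g (pi/2)} x *\<^sub>R f x) \<in> borel_measurable lborel"
        by measurable
      show "AE x in lborel. norm (indicator {g (-pi/2)..g (pi/2)} x *\<^sub>R f x)
          \<le> norm (indicator {g (-pi/2)..g (pi/2)} x :: real)"
        by (rule AE_I2) (simp add: f_def indicator_def)
    qed
    show "(g has_real_derivative r * cos t) (at t)" for t
      unfolding g_def by (auto intro!: derivative_eq_intros)
    show "continuous_on {-pi/2..pi/2} (\<lambda>t. r * cos t)"
      by (intro continuous_intros)
    show "0 \<le> r * cos t" if "t \<in> {-pi/2..pi/2}" for t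
      using that assms(2) by (auto intro!: mult_nonneg_nonneg cos_ge_zero)
  qed auto
  also have "\<dots> = outside_flux \<Omega> r z"
    unfolding outside_flux_def set_lebesgue_integral_def
  proof (rule Bochner_Integration.integral_cong[OF refl])
    fix t
    show "f (g t) * (r * cos t) * indicator {-pi/2..pi/2} t =
      indicator {-pi/2..pi/2} t *\<^sub>R ((circle_outside \<Omega> r z t - circle_outside \<Omega> r z (pi - t)) * (r * cos t))"
    proof (cases "t \<in> {-pi/2..pi/2}")
      case True
      then have "cos t \<ge> 0" by (auto intro!: cos_ge_zero)
      moreover have "r\<^sup>2 - (g t - b)\<^sup>2 = (r * cos t)\<^sup>2"
        by (simp add: g_def power_mult_distrib cos_squared_eq algebra_simps)
      ultimately have "w (g t) = r * cos t"
        using assms(2) by (simp add: w_def)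
      then have "f (g t) = circle_outside \<Omega> r z t - circle_outside \<Omega> r z (pi - t)"
        by (simp add: f_def circle_outside_def outside_slice_def indicator_def z g_def Complex_eq
            cis_conv_exp[symmetric] cis.code algebra_simps)
      then show ?thesis by simp
    qed simp
  qed
  finally have "(\<integral>y. indicator {b - r..b + r} y * f y \<partial>lborel) = outside_flux \<Omega> r z" .
  then show ?thesis
    using outside_area_partial_slices[OF assms(1,2) fin[unfolded z]]
    unfolding f_def w_def z complex.sel by (simp only:)
qed

text \<open>At every angle where the circle avoids the frontier the integrand is locally constant in \<open>z\<close>.\<close>

lemma outside_flux_continuous:
  assumes "open \<Omega>" "r > 0" and fin: "finite (sphere z r \<inter> frontier \<Omega>)"
  shows "isCont (outside_flux \<Omega> r) z"
proof -
  \<comment> \<open>Half of the circle, run through in either direction, meets the boundary at finitely many angles.\<close>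
  have bad: "finite {t \<in> {-pi/2..pi/2}. z + of_real r * cis (f t) \<in> frontier \<Omega>}"
    if f: "\<And>t. sin (f t) = sin t" for f
  proof (rule finite_imageD)
    show "finite ((\<lambda>t. z + of_real r * cis (f t)) ` {t \<in> {-pi/2..pi/2}. z + of_real r * cis (f t) \<in> frontier \<Omega>})"
      by (rule finite_subset[OF _ fin]) (use assms(2) in \<open>auto simp: dist_norm norm_mult\<close>)
    show "inj_on (\<lambda>t. z + of_real r * cis (f t)) {t \<in> {-pi/2..pi/2}. z + of_real r * cis (f t) \<in> frontier \<Omega>}"
    proof (rule inj_onI)
      fix s t
      assume st: "s \<in> {t \<in> {-pi/2..pi/2}. z + of_real r * cis (f t) \<in> frontier \<Omega>}"
        "t \<in> {t \<in> {-pi/2..pi/2}. z + of_real r * cis (f t) \<in> frontier \<Omega>}"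
        "z + of_real r * cis (f s) = z + of_real r * cis (f t)"
      then have "cis (f s) = cis (f t)" using assms(2) by simp
      then have "sin s = sin t" using f by (metis cis.sel(2))
      then show "s = t" using st sin_inj_pi[of s t] by auto
    qed
  qed
  have conv: "(\<lambda>i. circle_outside \<Omega> r (X i) t) \<longlonglongrightarrow> circle_outside \<Omega> r z t"
    if "X \<longlonglongrightarrow> z" "z + of_real r * cis t \<notin> frontier \<Omega>" for X t
  proof -
    have "isCont (indicator (- \<Omega>) :: complex \<Rightarrow> real) (z + of_real r * cis t)"
      using that by (simp add: isCont_indicator frontier_complement)
    then show ?thesis
      unfolding circle_outside_def using that(1)
      by (intro isCont_tendsto_compose[of "z + of_real r * cis t" "indicator (- \<Omega>)"] tendsto_intros)
  qed
  have [measurable]: "circle_outside \<Omega> r x \<in> borel_measurable borel" for x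
    by (rule circle_outside_measurable[OF assms(1)])
  have [measurable]: "(\<lambda>t. circle_outside \<Omega> r x (pi - t)) \<in> borel_measurable borel" for x
    by measurable
  have "(\<lambda>i. outside_flux \<Omega> r (X i)) \<longlonglongrightarrow> outside_flux \<Omega> r z" if X: "X \<longlonglongrightarrow> z" for X
    unfolding outside_flux_def set_lebesgue_integral_def
  proof (rule integral_dominated_convergence[where w = "\<lambda>t. 2 * r * indicator {-pi/2..pi/2} t"])
    show "integrable lborel (\<lambda>t. 2 * r * indicator {-pi/2..pi/2} t)"
      by (intro integrable_mult_right integrable_real_indicator emeasure_compact_finite) auto
    show "AE t in lborel. norm (indicator {-pi/2..pi/2} t *\<^sub>R
       ((circle_outside \<Omega> r (X i) t - circle_outside \<Omega> r (X i) (pi - t)) * (r * cos t)))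
      \<le> 2 * r * indicator {-pi/2..pi/2} t" for i
    proof (rule AE_I2)
      fix t
      have "\<bar>circle_outside \<Omega> r (X i) t - circle_outside \<Omega> r (X i) (pi - t)\<bar> \<le> 2"
        by (auto simp: circle_outside_def indicator_def)
      moreover have "\<bar>r * cos t\<bar> \<le> r"
        using assms(2) by (simp add: abs_mult mult_left_le)
      ultimately have "\<bar>circle_outside \<Omega> r (X i) t - circle_outside \<Omega> r (X i) (pi - t)\<bar> * \<bar>r * cos t\<bar> \<le> 2 * r"
        by (intro mult_mono) auto
      then show "norm (indicator {-pi/2..pi/2} t *\<^sub>R
       ((circle_outside \<Omega> r (X i) t - circle_outside \<Omega> r (X i) (pi - t)) * (r * cos t)))
      \<le> 2 * r * indicator {-pi/2..pi/2} t"
        by (auto simp: indicator_def abs_mult)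
    qed
    have "AE t in lborel. t \<notin> {t \<in> {-pi/2..pi/2}. z + of_real r * cis t \<in> frontier \<Omega>} \<union>
        {t \<in> {-pi/2..pi/2}. z + of_real r * cis (pi - t) \<in> frontier \<Omega>}"
      by (rule AE_not_in[OF finite_imp_null_set_lborel[OF finite_UnI[OF bad[of "\<lambda>t. t"] bad[of "\<lambda>t. pi - t"]]]]) simp_all
    then show "AE t in lborel. (\<lambda>i. indicator {-pi/2..pi/2} t *\<^sub>R
       ((circle_outside \<Omega> r (X i) t - circle_outside \<Omega> r (X i) (pi - t)) * (r * cos t)))
      \<longlonglongrightarrow> indicator {-pi/2..pi/2} t *\<^sub>R
       ((circle_outside \<Omega> r z t - circle_outside \<Omega> r z (pi - t)) * (r * cos t))"
    proof eventually_elim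
      case (elim t)
      show ?case
      proof (cases "t \<in> {-pi/2..pi/2}")
        case True
        then show ?thesis
          using elim by (intro tendsto_intros conv X) auto
      qed simp
    qed
  qed measurable
  then show ?thesis
    by (simp add: continuous_at_sequentially comp_def)
qed

text \<open>The base interval is fixed, whereas the arc \<open>(a, b)\<close> may stick out beyond its right end; the part that
  does reappears, shifted by a full turn, at the left end.\<close>

lemma has_integral_arc_indicator:
  fixes h :: "real \<Rightarrow> real"
  assumes per: "\<And>t. h (t + 2 * pi) = h t"
    and ab: "a < b" "b < a + 2 * pi"
    and one: "\<And>t. a < t \<Longrightarrow> t < b \<Longrightarrow> h t = 1"
    and zero: "\<And>t. b < t \<Longrightarrow> t < a + 2 * pi \<Longrightarrow> h t = 0"
    and base: "- pi / 2 \<le> a" "a < 3 * pi / 2"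
  shows "((\<lambda>t. h t * cos t) has_integral (sin b - sin a)) {- pi / 2..3 * pi / 2}"
proof -
  have on: "((\<lambda>t. h t * cos t) has_integral (sin d - sin c)) {c..d}"
    if "c \<le> d" "\<And>t. c < t \<Longrightarrow> t < d \<Longrightarrow> h t = 1" for c d
  proof -
    have "(cos has_integral (sin d - sin c)) (cbox c d)"
      unfolding cbox_interval
      by (rule fundamental_theorem_of_calculus[OF that(1)])
         (auto intro!: derivative_eq_intros simp flip: has_real_derivative_iff_has_vector_derivative)
    then show ?thesis
      unfolding cbox_interval[symmetric]
      by (rule has_integral_spike_interior) (auto simp: that box_real)
  qed
  have off: "((\<lambda>t. h t * cos t) has_integral 0) {c..d}"
    if "\<And>t. c < t \<Longrightarrow> t < d \<Longrightarrow> h t = 0" for c d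
    unfolding cbox_interval[symmetric]
    by (rule has_integral_spike_interior[OF has_integral_0]) (auto simp: that box_real)
  have shift: "h t = 1" if "a < t + 2 * pi" "t + 2 * pi < b" for t
    using one[of "t + 2 * pi"] per[of t] that by simp
  have shift0: "h t = 0" if "b < t + 2 * pi" "t < a" for t
    using zero[of "t + 2 * pi"] per[of t] that by simp
  note comb = has_integral_combine[where f = "\<lambda>t. h t * cos t"]
  show ?thesis
  proof (cases "b \<le> 3 * pi / 2")
    case True
    have 1: "((\<lambda>t. h t * cos t) has_integral 0) {- pi / 2..a}"
      by (rule off) (use True base shift0 in auto)
    have 2: "((\<lambda>t. h t * cos t) has_integral (sin b - sin a)) {a..b}"
      by (rule on) (use ab one in auto)
    have 3: "((\<lambda>t. h t * cos t) has_integral 0) {b..3 * pi / 2}"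
      by (rule off) (use base zero in auto)
    have 12: "((\<lambda>t. h t * cos t) has_integral (0 + (sin b - sin a))) {- pi / 2..b}"
      by (rule comb[OF _ _ 1 2]) (use base ab in auto)
    have "((\<lambda>t. h t * cos t) has_integral (0 + (sin b - sin a) + 0)) {- pi / 2..3 * pi / 2}"
      by (rule comb[OF _ _ 12 3]) (use base ab True in auto)
    then show ?thesis by simp
  next
    case False
    have 1: "((\<lambda>t. h t * cos t) has_integral (sin (b - 2 * pi) - sin (- pi / 2))) {- pi / 2..b - 2 * pi}"
      by (rule on) (use False base shift in auto)
    have 2: "((\<lambda>t. h t * cos t) has_integral 0) {b - 2 * pi..a}"
      by (rule off) (use shift0 in auto)
    have 3: "((\<lambda>t. h t * cos t) has_integral (sin (3 * pi / 2) - sin a)) {a..3 * pi / 2}"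
      by (rule on) (use base one False in auto)
    have 12: "((\<lambda>t. h t * cos t) has_integral (sin (b - 2 * pi) - sin (- pi / 2) + 0)) {- pi / 2..a}"
      by (rule comb[OF _ _ 1 2]) (use False ab in auto)
    have "((\<lambda>t. h t * cos t) has_integral
        (sin (b - 2 * pi) - sin (- pi / 2) + 0 + (sin (3 * pi / 2) - sin a))) {- pi / 2..3 * pi / 2}"
      by (rule comb[OF _ _ 12 3]) (use base in auto)
    moreover have "sin (3 * pi / 2) = -1"
      using sin_periodic[of "- pi / 2"] by (simp add: algebra_simps)
    ultimately show ?thesis
      using sin_periodic[of "b - 2 * pi"] by simp
  qed
qed

text \<open>The integral of \<open>cos\<close> over the outer arc. Rotating by full turns brings \<open>a\<close> into the base interval.\<close>

lemma outside_flux_arc: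
  assumes "open \<Omega>" and ab: "a < b" "b < a + 2 * pi"
    and out: "\<And>t. a < t \<Longrightarrow> t < b \<Longrightarrow> z + of_real r * cis t \<notin> \<Omega>"
    and ins: "\<And>t. b < t \<Longrightarrow> t < a + 2 * pi \<Longrightarrow> z + of_real r * cis t \<in> \<Omega>"
  shows "outside_flux \<Omega> r z = r * (sin b - sin a)"
proof -
  define n where "n = \<lfloor>(a + pi / 2) / (2 * pi)\<rfloor>"
  \<comment> \<open>Then \<open>a - N\<close> lies in \<open>[-pi/2, 3 * pi/2)\<close>.\<close>
  define N where "N = 2 * pi * of_int n"
  define h where "h = circle_outside \<Omega> r z"
  have cisN: "cis (t + N) = cis t" "sin (t - N) = sin t" for t
    unfolding N_def by (auto simp: complex_eq_iff sin_add cos_add sin_diff)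
  have "of_int n \<le> (a + pi / 2) / (2 * pi)" "(a + pi / 2) / (2 * pi) < of_int n + 1"
    unfolding n_def by linarith+
  then have N: "N \<le> a + pi / 2" "a + pi / 2 < N + 2 * pi"
    by (simp_all add: N_def field_simps)
  have hN: "h t = indicator (- \<Omega>) (z + of_real r * cis (t + N))" for t
    by (simp only: h_def circle_outside_def cisN)
  have int: "((\<lambda>t. h t * cos t) has_integral (sin (b - N) - sin (a - N))) {- pi / 2..3 * pi / 2}"
  proof (rule has_integral_arc_indicator)
    show "h (t + 2 * pi) = h t" for t
      by (simp add: h_def circle_outside_def cis.code)
    show "h t = 1" if "a - N < t" "t < b - N" for t
      unfolding hN using out[of "t + N"] that by simp
    show "h t = 0" if "b - N < t" "t < a - N + 2 * pi" for t
      unfolding hN using ins[of "t + N"] that by simp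
  qed (use N ab in auto)
  define I1 where "I1 = integral {- pi / 2..pi / 2} (\<lambda>t. h t * cos t)"
  define I2 where "I2 = integral {pi / 2..3 * pi / 2} (\<lambda>t. h t * cos t)"
  have 1: "((\<lambda>t. h t * cos t) has_integral I1) {- pi / 2..pi / 2}"
    unfolding I1_def
    by (rule integrable_integral[OF integrable_subinterval_real[OF has_integral_integrable[OF int]]]) auto
  have 2: "((\<lambda>t. h t * cos t) has_integral I2) {pi / 2..3 * pi / 2}"
    unfolding I2_def
    by (rule integrable_integral[OF integrable_subinterval_real[OF has_integral_integrable[OF int]]]) auto
  have "((\<lambda>t. h t * cos t) has_integral (I1 + I2)) {- pi / 2..3 * pi / 2}"
    by (rule has_integral_combine[OF _ _ 1 2]) auto
  then have sum: "I1 + I2 = sin b - sin a"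
    using int cisN(2) by (metis has_integral_unique)
  have "((\<lambda>t. h ((- 1) * t + pi) * cos ((- 1) * t + pi)) has_integral I2) ((\<lambda>t. (1 / (- 1)) * t + - ((1 / (- 1)) * pi)) ` cbox (pi / 2) (3 * pi / 2))"
    using has_integral_affinity[OF 2[unfolded cbox_interval[symmetric]], of "-1" pi] by simp
  moreover have "(\<lambda>t. (1 / (- 1)) * t + - ((1 / (- 1)) * pi)) ` cbox (pi / 2) (3 * pi / 2) = {- pi / 2..pi / 2}"
  proof -
    have "t \<in> (\<lambda>t. (1 / (- 1)) * t + - ((1 / (- 1)) * pi)) ` cbox (pi / 2) (3 * pi / 2)"
      if "t \<in> {- pi / 2..pi / 2}" for t
      by (rule image_eqI[of _ _ "pi - t"]) (use that in auto)
    then show ?thesis by auto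
  qed
  ultimately have 3: "((\<lambda>t. - (h (pi - t) * cos t)) has_integral I2) {- pi / 2..pi / 2}"
    by (simp add: algebra_simps)
  have "((\<lambda>t. (h t - h (pi - t)) * (r * cos t)) has_integral r * (I1 + I2)) {- pi / 2..pi / 2}"
    using has_integral_mult_right[OF has_integral_add[OF 1 3], of r] by (simp add: algebra_simps)
  moreover have "set_integrable lborel {- pi / 2..pi / 2} (\<lambda>t. (h t - h (pi - t)) * (r * cos t))"
    unfolding set_integrable_def
  proof (rule Bochner_Integration.integrable_bound)
    have [measurable]: "h \<in> borel_measurable borel"
      unfolding h_def by (rule circle_outside_measurable[OF assms(1)])
    show "integrable lborel (\<lambda>t. 2 * \<bar>r\<bar> * indicator {- pi / 2..pi / 2} t :: real)"
      by (intro integrable_mult_right integrable_real_indicator emeasure_compact_finite) auto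
    show "(\<lambda>t. indicator {- pi / 2..pi / 2} t *\<^sub>R ((h t - h (pi - t)) * (r * cos t))) \<in> borel_measurable lborel"
      by measurable
    show "AE t in lborel. norm (indicator {- pi / 2..pi / 2} t *\<^sub>R ((h t - h (pi - t)) * (r * cos t)))
        \<le> norm (2 * \<bar>r\<bar> * indicator {- pi / 2..pi / 2} t)"
    proof (rule AE_I2)
      fix t
      have "\<bar>h t - h (pi - t)\<bar> \<le> 2"
        by (auto simp: h_def circle_outside_def indicator_def)
      moreover have "\<bar>r * cos t\<bar> \<le> \<bar>r\<bar>"
        by (simp add: abs_mult mult_left_le)
      ultimately have "\<bar>h t - h (pi - t)\<bar> * \<bar>r * cos t\<bar> \<le> 2 * \<bar>r\<bar>"
        by (intro mult_mono) auto
      then show "norm (indicator {- pi / 2..pi / 2} t *\<^sub>R ((h t - h (pi - t)) * (r * cos t)))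
        \<le> norm (2 * \<bar>r\<bar> * indicator {- pi / 2..pi / 2} t)"
        by (simp add: indicator_def abs_mult)
    qed
  qed
  ultimately have "outside_flux \<Omega> r z = r * (I1 + I2)"
    unfolding outside_flux_def h_def[symmetric]
    using set_borel_integral_eq_integral(2) by (metis integral_unique minus_divide_left)
  then show ?thesis using sum by simp
qed

lemma flip_cis: "flip (z + of_real r * cis t) = flip z + of_real r * cis (pi / 2 - t)"
  by (simp add: flip_def complex_eq_iff sin_diff cos_diff)

lemma flip_flip [simp]: "flip (flip z) = z"
  by (simp add: flip_def)

lemma mem_flip_image: "z \<in> flip ` S \<longleftrightarrow> flip z \<in> S"
  by (metis flip_flip image_iff)

lemma flip_image_eq_vimage: "flip ` S = flip -` S"
  by (auto simp: mem_flip_image)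

lemma continuous_on_flip: "continuous_on S flip"
  unfolding flip_def Complex_eq by (intro continuous_intros)

lemma open_flip: "open S \<Longrightarrow> open (flip ` S)"
  unfolding flip_image_eq_vimage by (rule open_vimage[OF _ continuous_on_flip])

lemma frontier_flip: "frontier (flip ` S) = flip ` frontier S"
proof -
  have "closure (flip ` S) = flip ` closure S" for S
  proof
    show "closure (flip ` S) \<subseteq> flip ` closure S"
      unfolding flip_image_eq_vimage
      by (rule closure_minimal) (use closure_subset in \<open>auto intro!: closed_vimage continuous_on_flip\<close>)
    show "flip ` closure S \<subseteq> closure (flip ` S)"
      by (rule image_closure_subset[OF continuous_on_flip]) (auto simp: closure_subset)
  qed
  moreover have "- flip ` S = flip ` (- S)" for S
    by (rule set_eqI) (simp add: mem_flip_image)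
  ultimately show ?thesis
    unfolding frontier_closures by (intro set_eqI) (simp add: mem_flip_image)
qed

lemma dist_flip: "dist (flip z) (flip w) = dist z w"
  by (simp add: flip_def dist_norm cmod_def add.commute)

text \<open>The rate of change of the area is the flux of the velocity through the outer arc. Horizontal and
  vertical derivatives come from the flux lemmas, for \<open>\<Omega>\<close> and for its reflection; as the latter is
  continuous, they combine to a total derivative.\<close>

theorem has_derivative_outside_area:
  assumes "open \<Omega>" "r > 0" and fin: "\<And>z. finite (sphere z r \<inter> frontier \<Omega>)"
    and ab: "a < b" "b < a + 2 * pi"
    and out: "\<And>t. a < t \<Longrightarrow> t < b \<Longrightarrow> z + of_real r * cis t \<notin> \<Omega>"
    and ins: "\<And>t. b < t \<Longrightarrow> t < a + 2 * pi \<Longrightarrow> z + of_real r * cis t \<in> \<Omega>"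
  shows "(outside_area \<Omega> r has_derivative
    (\<lambda>h. Re h * (r * (sin b - sin a)) + Im h * (r * (cos a - cos b)))) (at z)"
proof -
  have fin': "finite (sphere z r \<inter> frontier (flip ` \<Omega>))" for z
  proof -
    have "sphere z r \<inter> frontier (flip ` \<Omega>) = flip ` (sphere (flip z) r \<inter> frontier \<Omega>)"
      unfolding frontier_flip by (rule set_eqI) (simp add: mem_flip_image dist_flip)
    then show ?thesis using fin by simp
  qed
  define f where "f x y = outside_area \<Omega> r (Complex x y)" for x y
  define D where "D x y = outside_flux (flip ` \<Omega>) r (Complex y x)" for x y
  have fx: "((\<lambda>x. f x (Im z)) has_derivative (\<lambda>h. h * outside_flux \<Omega> r z)) (at (Re z) within UNIV)"
    using outside_area_partial[OF assms(1,2) fin, of z]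
    by (simp add: f_def has_field_derivative_def mult.commute[of _ "outside_flux \<Omega> r z"])
  have fy: "((\<lambda>y. f x y) has_derivative blinfun_apply (blinfun_scaleR_left (D x y))) (at y within UNIV)" for x y
  proof -
    have "((\<lambda>y. outside_area (flip ` \<Omega>) r (Complex y x)) has_real_derivative D x y) (at y)"
      using outside_area_partial[OF open_flip[OF assms(1)] assms(2) fin', of "Complex y x"] by (simp add: D_def)
    moreover have "outside_area (flip ` \<Omega>) r (Complex y x) = f x y" for y
      using outside_area_flip[OF assms(1), of r "Complex x y"] by (simp add: f_def flip_def)
    ultimately show ?thesis
      by (simp add: has_field_derivative_def mult.commute[of _ "D x y"])
  qed
  have cont: "continuous (at (Re z, Im z) within UNIV \<times> UNIV) (\<lambda>(x, y). blinfun_scaleR_left (D x y) :: real \<Rightarrow>\<^sub>L real)"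
  proof -
    have "isCont (\<lambda>p. outside_flux (flip ` \<Omega>) r (Complex (snd p) (fst p))) (Re z, Im z)"
      by (rule isCont_o2[where g = "outside_flux (flip ` \<Omega>) r"])
         (auto intro!: continuous_intros outside_flux_continuous open_flip assms fin' simp: Complex_eq)
    then have "isCont (\<lambda>p. blinfun_scaleR_left (outside_flux (flip ` \<Omega>) r (Complex (snd p) (fst p))) :: real \<Rightarrow>\<^sub>L real) (Re z, Im z)"
      by (rule bounded_linear.isCont[OF bounded_linear_blinfun_scaleR_left])
    then show ?thesis
      by (simp add: D_def split_beta')
  qed
  have "((\<lambda>(x, y). f x y) has_derivative
    (\<lambda>(tx, ty). tx * outside_flux \<Omega> r z + blinfun_apply (blinfun_scaleR_left (D (Re z) (Im z))) ty))
      (at (Re z, Im z) within UNIV \<times> UNIV)"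
    by (rule has_derivative_partialsI[OF fx fy cont]) auto
  then have "((\<lambda>(x, y). f x y) has_derivative (\<lambda>(tx, ty). tx * outside_flux \<Omega> r z + ty * D (Re z) (Im z)))
      (at (Re z, Im z))"
    by simp
  moreover have "((\<lambda>z. (Re z, Im z)) has_derivative (\<lambda>h. (Re h, Im h))) (at z)"
    by (auto intro!: derivative_eq_intros)
  ultimately have "((\<lambda>z. case (Re z, Im z) of (x, y) \<Rightarrow> f x y) has_derivative
     (\<lambda>h. case (Re h, Im h) of (tx, ty) \<Rightarrow> tx * outside_flux \<Omega> r z + ty * D (Re z) (Im z))) (at z)"
    by (rule has_derivative_compose[rotated])
  moreover have "outside_flux \<Omega> r z = r * (sin b - sin a)"
    by (rule outside_flux_arc[OF assms(1) ab out ins])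
  moreover have "D (Re z) (Im z) = r * (sin (pi / 2 - a) - sin (pi / 2 - b))"
  proof -
    have *: "flip z + of_real r * cis t \<in> flip ` \<Omega> \<longleftrightarrow> z + of_real r * cis (pi / 2 - t) \<in> \<Omega>" for t
      using flip_cis[of "flip z" r t] by (simp add: mem_flip_image)
    have "outside_flux (flip ` \<Omega>) r (flip z) = r * (sin (pi / 2 - a) - sin (pi / 2 - b))"
    proof (rule outside_flux_arc[OF open_flip[OF assms(1)]], unfold *)
      show "z + of_real r * cis (pi / 2 - t) \<in> \<Omega>" if "pi / 2 - a < t" "t < pi / 2 - b + 2 * pi" for t
      proof -
        have "cis (pi / 2 - t + 2 * pi) = cis (pi / 2 - t)"
          by (simp only: cis.code sin_periodic cos_periodic)
        moreover have "z + of_real r * cis (pi / 2 - t + 2 * pi) \<in> \<Omega>"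
          by (rule ins) (use that in auto)
        ultimately show ?thesis by (simp only:)
      qed
    qed (use ab out in auto)
    then show ?thesis by (simp add: D_def flip_def)
  qed
  ultimately show ?thesis
    by (simp add: f_def sin_diff algebra_simps)
qed

section \<open>Plane vectors and angles\<close>

text \<open>The oriented area spanned by two plane vectors; it is positive if \<open>w\<close> points to the left of \<open>v\<close>.\<close>

definition cross :: "complex \<Rightarrow> complex \<Rightarrow> real" where
  "cross v w = Im (cnj v * w)"

lemma abs_cross_le: "\<bar>cross v w\<bar> \<le> norm v * norm w"
  unfolding cross_def by (metis abs_Im_le_cmod complex_mod_cnj norm_mult)

lemma bounded_bilinear_cross: "bounded_bilinear cross"
proof
  show "\<exists>K. \<forall>v w. norm (cross v w) \<le> norm v * norm w * K"
    by (rule exI[of _ 1]) (simp add: abs_cross_le)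
qed (simp_all add: cross_def algebra_simps)

interpretation cross: bounded_bilinear cross
  by (rule bounded_bilinear_cross)

lemma cross_cis: "cross (cis a) (cis b) = sin (b - a)"
  by (simp add: cross_def cis_cnj cis_mult)

lemma inner_cis: "cis a \<bullet> cis b = cos (b - a)"
  by (simp add: inner_complex_def cos_diff mult.commute)

lemma inner_ii_left: "(\<i> * v) \<bullet> w = cross v w"
  by (simp add: cross_def inner_complex_def)

lemma inner_ii_right: "v \<bullet> (\<i> * w) = - cross v w"
  by (simp add: cross_def inner_complex_def)

lemma cross_ii_right: "cross v (\<i> * w) = v \<bullet> w"
  by (simp add: cross_def inner_complex_def)

lemma cross_ii_left: "cross (\<i> * v) w = - (v \<bullet> w)"
  by (simp add: cross_def inner_complex_def)

lemma cross_self [simp]: "cross v v = 0"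
  by (simp add: cross_def)

lemma cross_commute: "cross v w = - cross w v"
  by (simp add: cross_def)

lemma norm_sq_cross_inner:
  assumes "norm v = 1"
  shows "(norm w)\<^sup>2 = (v \<bullet> w)\<^sup>2 + (cross v w)\<^sup>2"
proof -
  have "(norm w)\<^sup>2 = (norm (cnj v * w))\<^sup>2"
    using assms by (simp add: norm_mult)
  then show ?thesis
    by (simp add: cmod_power2 inner_complex_def cross_def algebra_simps)
qed

text \<open>Moving by \<open>c\<close> along the left normal of the direction \<open>a\<close>; \<open>cross (cis a) w\<close> is the component of
  \<open>w\<close> along that normal.\<close>

lemma norm_sq_add_normal:
  "(norm (w + c *\<^sub>R (\<i> * cis a)))\<^sup>2 = (norm w)\<^sup>2 + 2 * c * cross (cis a) w + c\<^sup>2"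
proof -
  have "(norm (w + v))\<^sup>2 = (norm w)\<^sup>2 + 2 * (v \<bullet> w) + (norm v)\<^sup>2" for v :: complex
    by (simp add: power2_norm_eq_inner inner_add_left inner_add_right inner_commute)
  then show ?thesis
    by (simp add: inner_ii_left norm_mult)
qed

lemma cis_decomp: "w = of_real (cis a \<bullet> w) * cis a + of_real (cross (cis a) w) * (\<i> * cis a)"
proof -
  have "w = cis a * (cnj (cis a) * w)"
    by (simp add: cis_cnj cis_mult mult.assoc[symmetric])
  also have "cnj (cis a) * w = of_real (cis a \<bullet> w) + \<i> * of_real (cross (cis a) w)"
    by (simp add: complex_eq_iff inner_complex_def cross_def)
  finally show ?thesis by (simp add: algebra_simps)
qed

lemma unit_vector_angle:
  assumes "norm v = 1" "cross (cis a) v > 0"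
  shows "v = cis (a + arccos (cis a \<bullet> v))" "0 < arccos (cis a \<bullet> v)" "arccos (cis a \<bullet> v) < pi"
proof -
  define c where "c = cis a \<bullet> v"
  define d where "d = cross (cis a) v"
  have cd: "c\<^sup>2 + d\<^sup>2 = 1" using norm_sq_cross_inner[of "cis a" v] assms by (simp add: c_def d_def)
  have d: "d > 0" using assms by (simp add: d_def)
  have "c\<^sup>2 < 1" using cd d by (smt (verit) zero_less_power)
  then have c: "-1 < c" "c < 1" by (auto simp: abs_square_less_1[symmetric] power2_less_1_iff)
  have "sin (arccos c) = sqrt (1 - c\<^sup>2)" using c by (simp add: sin_arccos)
  also have "1 - c\<^sup>2 = d\<^sup>2" using cd by simp
  finally have s: "sin (arccos c) = d" using d by simp
  have "cis (a + arccos c) = cis a * cis (arccos c)" by (simp add: cis_mult)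
  also have "cis (arccos c) = of_real c + \<i> * of_real d" using c s by (simp add: complex_eq_iff)
  finally show "v = cis (a + arccos (cis a \<bullet> v))"
    using cis_decomp[of v a] by (simp add: c_def d_def algebra_simps)
  show "0 < arccos (cis a \<bullet> v)" "arccos (cis a \<bullet> v) < pi"
    using arccos_lt_bounded[of c] c by (simp_all add: c_def)
qed

lemma cross_has_real_derivative:
  assumes "(X has_vector_derivative X') (at t)"
  shows "((\<lambda>t. cross v (X t - p)) has_real_derivative cross v X') (at t)"
proof -
  have "((\<lambda>t. X t - p) has_vector_derivative X') (at t)"
    using assms by (auto intro!: derivative_eq_intros)
  then show ?thesis
    unfolding has_real_derivative_iff_has_vector_derivative
    by (rule bounded_linear.has_vector_derivative[OF cross.bounded_linear_right])
qed

lemma has_derivative_cis: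
  assumes "(f has_derivative f') (at x within S)"
  shows "((\<lambda>x. cis (f x)) has_derivative (\<lambda>h. f' h *\<^sub>R (\<i> * cis (f x)))) (at x within S)"
proof -
  have "(cis has_vector_derivative (\<i> * cis t)) (at t)" for t
    by (auto simp: has_vector_derivative_complex_iff intro!: derivative_eq_intros)
  then show ?thesis
    using has_derivative_compose[OF assms, of cis "\<lambda>h. h *\<^sub>R (\<i> * cis (f x))"]
    by (simp add: has_vector_derivative_def)
qed

text \<open>Here \<open>\<theta>\<^sub>1\<close> and \<open>\<theta>\<^sub>2\<close> are the angles of exit and entry, \<open>\<Delta>\<close> is the turning of the boundary
  between the two points, so \<open>\<Delta> + \<theta>\<^sub>1 + \<theta>\<^sub>2\<close> is the turning of the Larmor arc. The
  hypotheses \<open>left1\<close> and \<open>left2\<close> say that each of the two points lies to the left of the tangent at the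
  other one, and \<open>roll\<close> says that the entry point is outside the rolling disc at the exit point.\<close>

lemma larmor_angle_bounds:
  fixes \<theta>\<^sub>1 \<theta>\<^sub>2 \<Delta> :: real
  assumes \<theta>: "0 < \<theta>\<^sub>1" "\<theta>\<^sub>1 < pi" "0 < \<theta>\<^sub>2" "\<theta>\<^sub>2 < pi" and \<Delta>: "0 < \<Delta>" "\<Delta> < pi"
    and left1: "0 < sin ((\<Delta> + \<theta>\<^sub>1 + \<theta>\<^sub>2) / 2) * sin ((\<Delta> + \<theta>\<^sub>2 - \<theta>\<^sub>1) / 2)"
    and left2: "0 < sin ((\<Delta> + \<theta>\<^sub>1 + \<theta>\<^sub>2) / 2) * sin ((\<Delta> - \<theta>\<^sub>2 + \<theta>\<^sub>1) / 2)"
    and roll: "sin ((\<Delta> + \<theta>\<^sub>1 + \<theta>\<^sub>2) / 2) * sin ((\<Delta> + \<theta>\<^sub>2 - \<theta>\<^sub>1) / 2) < (sin ((\<Delta> + \<theta>\<^sub>1 + \<theta>\<^sub>2) / 2))\<^sup>2"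
  shows "\<Delta> + \<theta>\<^sub>1 + \<theta>\<^sub>2 < 2 * pi" "\<bar>\<theta>\<^sub>2 - \<theta>\<^sub>1\<bar> < \<Delta>" "\<Delta> + \<theta>\<^sub>2 < pi"
proof -
  define S where "S = sin ((\<Delta> + \<theta>\<^sub>1 + \<theta>\<^sub>2) / 2)"
  define y where "y = (\<Delta> + \<theta>\<^sub>2 - \<theta>\<^sub>1) / 2"
  define y' where "y' = (\<Delta> - \<theta>\<^sub>2 + \<theta>\<^sub>1) / 2"
  have neg: "x < 0" if "sin x < 0" "- pi < x" "x < pi" for x :: real
    using that by (metis linorder_neqE_linordered_idom order_less_asym sin_gt_zero sin_zero)
  have pos: "0 < x" if "sin x > 0" "- pi < x" "x < pi" for x :: real
    using neg[of "- x"] that by simp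
  have yr: "- pi < y" "y < pi" "- pi < y'" "y' < pi"
    using \<theta> \<Delta> by (auto simp: y_def y'_def)
  show lt: "\<Delta> + \<theta>\<^sub>1 + \<theta>\<^sub>2 < 2 * pi"
  proof (rule ccontr)
    assume *: "\<not> \<Delta> + \<theta>\<^sub>1 + \<theta>\<^sub>2 < 2 * pi"
    have "S \<le> 0"
    proof -
      have "0 \<le> sin ((\<Delta> + \<theta>\<^sub>1 + \<theta>\<^sub>2) / 2 - pi)"
        using * \<theta> \<Delta> by (intro sin_ge_zero) (auto simp: field_simps)
      then show ?thesis by (simp add: S_def sin_diff)
    qed
    then have "sin y < 0" "sin y' < 0"
      using left1 left2 unfolding S_def[symmetric] y_def[symmetric] y'_def[symmetric]
      by (auto simp: zero_less_mult_iff)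
    then have "y < 0" "y' < 0" using neg yr by auto
    then show False using \<Delta> by (simp add: y_def y'_def field_simps)
  qed
  have S: "S > 0" unfolding S_def using lt \<theta> \<Delta> by (intro sin_gt_zero) auto
  have "sin y > 0" "sin y' > 0"
    using left1 left2 S unfolding S_def[symmetric] y_def[symmetric] y'_def[symmetric]
    by (auto simp: zero_less_mult_iff)
  then have yp: "y > 0" "y' > 0" using pos yr by auto
  then show "\<bar>\<theta>\<^sub>2 - \<theta>\<^sub>1\<bar> < \<Delta>" by (auto simp: y_def y'_def field_simps)
  show "\<Delta> + \<theta>\<^sub>2 < pi"
  proof (rule ccontr)
    assume *: "\<not> \<Delta> + \<theta>\<^sub>2 < pi"
    have "sin y < S"
      using roll S unfolding S_def[symmetric] y_def[symmetric] by (simp add: power2_eq_square)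
    moreover have "S - sin y = 2 * sin (\<theta>\<^sub>1 / 2) * cos ((\<Delta> + \<theta>\<^sub>2) / 2)"
    proof -
      have "((\<Delta> + \<theta>\<^sub>1 + \<theta>\<^sub>2) / 2 - (\<Delta> + \<theta>\<^sub>2 - \<theta>\<^sub>1) / 2) / 2 = \<theta>\<^sub>1 / 2"
        "((\<Delta> + \<theta>\<^sub>1 + \<theta>\<^sub>2) / 2 + (\<Delta> + \<theta>\<^sub>2 - \<theta>\<^sub>1) / 2) / 2 = (\<Delta> + \<theta>\<^sub>2) / 2"
        by (simp_all add: field_simps)
      then show ?thesis unfolding S_def y_def sin_diff_sin by (simp only: mult.assoc)
    qed
    moreover have "sin (\<theta>\<^sub>1 / 2) > 0" using \<theta> by (intro sin_gt_zero) auto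
    moreover have "cos ((\<Delta> + \<theta>\<^sub>2) / 2) \<le> 0"
    proof -
      have "0 \<le> cos ((\<Delta> + \<theta>\<^sub>2) / 2 - pi)"
      proof (rule cos_ge_zero)
        have "pi \<le> \<Delta> + \<theta>\<^sub>2" "\<Delta> + \<theta>\<^sub>2 < 2 * pi" using * \<theta> \<Delta> by auto
        then show "- (pi / 2) \<le> (\<Delta> + \<theta>\<^sub>2) / 2 - pi" "(\<Delta> + \<theta>\<^sub>2) / 2 - pi \<le> pi / 2"
          using pi_gt_zero by (simp_all add: field_simps)
      qed
      then show ?thesis by (simp add: cos_diff)
    qed
    ultimately show False by (smt (verit) mult_nonneg_nonpos)
  qed
qed

text \<open>As \<open>sin \<theta> \<le> sin a\<close> whenever \<open>cos a \<ge> 0\<close>, one has \<open>sin (a + \<theta>) \<le> 2 sin a\<close>.\<close>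

lemma twist_inequality:
  fixes \<theta> a \<mu> l :: real
  assumes "0 < \<theta>" "\<theta> < a" "a < pi" "\<mu> > 0" "2 * \<mu> * sin \<theta> < l"
  shows "\<mu> * sin \<theta> * sin (a + \<theta>) < l * sin a"
proof -
  have s: "sin \<theta> > 0" "sin a > 0" using assms by (auto intro!: sin_gt_zero)
  have "cos a * sin \<theta> \<le> sin a"
  proof (cases "a \<le> pi / 2")
    case True
    then have "sin \<theta> \<le> sin a" using assms by (intro sin_monotone_2pi_le) auto
    then have "cos a * sin \<theta> \<le> 1 * sin a"
      using s by (intro mult_mono) auto
    then show ?thesis by simp
  next
    case False
    then have "cos a \<le> cos (pi / 2)" using assms by (intro cos_monotone_0_pi_le) auto
    then have "cos a * sin \<theta> \<le> 0" using s by (simp add: mult_nonpos_nonneg)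
    then show ?thesis using s by simp
  qed
  moreover have "sin a * cos \<theta> \<le> sin a" using s by (simp add: mult_left_le)
  ultimately have "sin (a + \<theta>) \<le> 2 * sin a" by (simp add: sin_add)
  then have "\<mu> * sin \<theta> * sin (a + \<theta>) \<le> \<mu> * sin \<theta> * (2 * sin a)"
    using assms s by (intro mult_left_mono) auto
  also have "\<dots> < l * sin a" using assms(5) s by simp
  finally show ?thesis .
qed

lemma cis_eq_imp_eq: "cis a = cis b \<Longrightarrow> \<bar>a - b\<bar> < 2 * pi \<Longrightarrow> a = b"
  by (rule rcong_imp_eq[of _ _ "2 * pi"]) (simp_all add: cis_eq_iff)

lemma cross_cross_identity:
  "cross a v * cross t b - cross t a * cross b v = cross t v * cross a b"
  by (simp add: cross_def algebra_simps)

section \<open>Roots depending on parameters\<close>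

text \<open>A root at which the sign changes persists under perturbation; the sign pattern on the whole
  window keeps \<open>\<sigma>\<close> from jumping to another root.\<close>

lemma moving_root_isCont:
  fixes H :: "'a::t2_space \<Rightarrow> real \<Rightarrow> real"
  assumes sign: "\<forall>\<^sub>F x in nhds x\<^sub>0. a x < \<sigma> x \<and> \<sigma> x < a x + L \<and>
      (\<forall>r. a x < r \<and> r < \<sigma> x \<longrightarrow> H x r < 0) \<and> (\<forall>r. \<sigma> x < r \<and> r < a x + L \<longrightarrow> H x r > 0)"
    and a: "isCont a x\<^sub>0" and H: "\<And>r. isCont (\<lambda>x. H x r) x\<^sub>0"
  shows "isCont \<sigma> x\<^sub>0"
proof -
  have at0: "a x\<^sub>0 < \<sigma> x\<^sub>0" "\<sigma> x\<^sub>0 < a x\<^sub>0 + L"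
    "\<And>r. a x\<^sub>0 < r \<Longrightarrow> r < \<sigma> x\<^sub>0 \<Longrightarrow> H x\<^sub>0 r < 0" "\<And>r. \<sigma> x\<^sub>0 < r \<Longrightarrow> r < a x\<^sub>0 + L \<Longrightarrow> H x\<^sub>0 r > 0"
    using eventually_nhds_x_imp_x[OF sign] by auto
  have sign': "\<forall>\<^sub>F x in at x\<^sub>0. a x < \<sigma> x \<and> \<sigma> x < a x + L \<and>
      (\<forall>r. a x < r \<and> r < \<sigma> x \<longrightarrow> H x r < 0) \<and> (\<forall>r. \<sigma> x < r \<and> r < a x + L \<longrightarrow> H x r > 0)"
    using sign by (simp add: eventually_nhds_conv_at)
  note a' = a[unfolded isCont_def] and H' = H[unfolded isCont_def]
  show ?thesis
    unfolding isCont_def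
  proof (rule order_tendstoI)
    fix c assume "c < \<sigma> x\<^sub>0"
    then obtain c' where c': "max c (a x\<^sub>0) < c'" "c' < \<sigma> x\<^sub>0"
      using dense[of "max c (a x\<^sub>0)" "\<sigma> x\<^sub>0"] at0 by auto
    have "\<forall>\<^sub>F x in at x\<^sub>0. H x c' < 0"
      using order_tendstoD(2)[OF H'] at0(3)[of c'] c' by simp
    moreover have "\<forall>\<^sub>F x in at x\<^sub>0. c' - L < a x"
      by (rule order_tendstoD(1)[OF a']) (use c' at0 in auto)
    ultimately show "\<forall>\<^sub>F x in at x\<^sub>0. c < \<sigma> x"
      using sign'
    proof eventually_elim
      case (elim x)
      then show ?case using c' by (smt (verit))
    qed
  next
    fix c assume "\<sigma> x\<^sub>0 < c"
    then obtain c' where c': "\<sigma> x\<^sub>0 < c'" "c' < min c (a x\<^sub>0 + L)"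
      using dense[of "\<sigma> x\<^sub>0" "min c (a x\<^sub>0 + L)"] at0 by auto
    have "\<forall>\<^sub>F x in at x\<^sub>0. H x c' > 0"
      using order_tendstoD(1)[OF H'] at0(4)[of c'] c' by simp
    moreover have "\<forall>\<^sub>F x in at x\<^sub>0. a x < c'"
      by (rule order_tendstoD(2)[OF a']) (use c' at0 in auto)
    ultimately show "\<forall>\<^sub>F x in at x\<^sub>0. \<sigma> x < c"
      using sign'
    proof eventually_elim
      case (elim x)
      then show ?case using c' by (smt (verit))
    qed
  qed
qed

text \<open>Implicit differentiation of \<open>H (x, \<sigma> x) = 0\<close> at a simple root that is known to be continuous.\<close>

lemma implicit_root_has_derivative:
  fixes \<sigma> :: "'a::real_normed_vector \<Rightarrow> real" and H :: "'a \<times> real \<Rightarrow> real"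
  assumes H: "(H has_derivative (\<lambda>p. H' (fst p) + c * snd p)) (at (x\<^sub>0, \<sigma> x\<^sub>0))"
    and H': "bounded_linear H'" and c: "c \<noteq> 0" and cont: "isCont \<sigma> x\<^sub>0"
    and root: "\<forall>\<^sub>F x in nhds x\<^sub>0. H (x, \<sigma> x) = 0"
  shows "(\<sigma> has_derivative (\<lambda>h. - H' h / c)) (at x\<^sub>0)"
  unfolding has_derivative_at_alt
proof (intro conjI allI impI)
  show "bounded_linear (\<lambda>h. - H' h / c)"
    using bounded_linear_compose[OF bounded_linear_divide[of c] bounded_linear_minus[OF H']] by simp
  obtain K where K: "K > 0" "\<And>h. \<bar>H' h\<bar> \<le> norm h * K"
    using bounded_linear.pos_bounded[OF H'] by (metis real_norm_def)
  define M where "M = 2 * (K + \<bar>c\<bar>) / \<bar>c\<bar>"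
  have M: "M > 0" using K c by (simp add: M_def)
  fix e :: real assume e: "e > 0"
  \<comment> \<open>The first bound lets the error be absorbed to give \<open>\<bar>r\<bar> \<le> M k\<close>, the second one then makes it small.\<close>
  define \<epsilon> where "\<epsilon> = min (\<bar>c\<bar> / 2) (e * \<bar>c\<bar> / (1 + M))"
  have \<epsilon>: "\<epsilon> > 0" "\<epsilon> \<le> \<bar>c\<bar> / 2" "\<epsilon> * (1 + M) \<le> e * \<bar>c\<bar>"
  proof -
    show "\<epsilon> > 0" using c e M by (simp add: \<epsilon>_def)
    show "\<epsilon> \<le> \<bar>c\<bar> / 2" by (simp only: \<epsilon>_def min.cobounded1)
    have "\<epsilon> \<le> e * \<bar>c\<bar> / (1 + M)" by (simp add: \<epsilon>_def)
    then show "\<epsilon> * (1 + M) \<le> e * \<bar>c\<bar>" using M by (subst (asm) pos_le_divide_eq) auto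
  qed
  have H0: "H (x\<^sub>0, \<sigma> x\<^sub>0) = 0" using eventually_nhds_x_imp_x[OF root] .
  obtain d where d: "d > 0" "\<And>p. norm (p - (x\<^sub>0, \<sigma> x\<^sub>0)) < d \<Longrightarrow>
      norm (H p - H (x\<^sub>0, \<sigma> x\<^sub>0) - (H' (fst (p - (x\<^sub>0, \<sigma> x\<^sub>0))) + c * snd (p - (x\<^sub>0, \<sigma> x\<^sub>0)))) \<le> \<epsilon> * norm (p - (x\<^sub>0, \<sigma> x\<^sub>0))"
    using H[unfolded has_derivative_at_alt] \<epsilon>(1) by blast
  have "isCont (\<lambda>x. (x, \<sigma> x)) x\<^sub>0" using cont by (intro continuous_intros) auto
  then have "\<forall>\<^sub>F x in at x\<^sub>0. dist (x, \<sigma> x) (x\<^sub>0, \<sigma> x\<^sub>0) < d"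
    unfolding isCont_def by (rule tendstoD[OF _ d(1)])
  then have "\<forall>\<^sub>F x in nhds x\<^sub>0. dist (x, \<sigma> x) (x\<^sub>0, \<sigma> x\<^sub>0) < d"
    using d(1) by (simp add: eventually_nhds_conv_at)
  then have "\<forall>\<^sub>F x in nhds x\<^sub>0. dist (x, \<sigma> x) (x\<^sub>0, \<sigma> x\<^sub>0) < d \<and> H (x, \<sigma> x) = 0"
    using root by (rule eventually_conj)
  then obtain d' where d': "d' > 0" "\<And>x. dist x x\<^sub>0 < d' \<Longrightarrow> dist (x, \<sigma> x) (x\<^sub>0, \<sigma> x\<^sub>0) < d \<and> H (x, \<sigma> x) = 0"
    by (auto simp: eventually_nhds_metric)
  show "\<exists>d>0. \<forall>y. norm (y - x\<^sub>0) < d \<longrightarrow> norm (\<sigma> y - \<sigma> x\<^sub>0 - - H' (y - x\<^sub>0) / c) \<le> e * norm (y - x\<^sub>0)"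
  proof (intro exI conjI allI impI)
    show "d' > 0" by fact
    fix y assume "norm (y - x\<^sub>0) < d'"
    then have y: "norm ((y, \<sigma> y) - (x\<^sub>0, \<sigma> x\<^sub>0)) < d" "H (y, \<sigma> y) = 0"
      using d'(2)[of y] by (auto simp: dist_norm)
    define k where "k = norm (y - x\<^sub>0)"
    define r where "r = \<sigma> y - \<sigma> x\<^sub>0"
    have k: "k \<ge> 0" by (simp add: k_def)
    have "\<bar>H' (y - x\<^sub>0) + c * r\<bar> \<le> \<epsilon> * norm (y - x\<^sub>0, r)"
      using d(2)[OF y(1)] y(2) H0 by (simp add: r_def)
    also have "\<dots> \<le> \<epsilon> * (k + \<bar>r\<bar>)"
      using \<epsilon> norm_Pair_le[of "y - x\<^sub>0" r] by (intro mult_left_mono) (auto simp: k_def)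
    finally have main: "\<bar>H' (y - x\<^sub>0) + c * r\<bar> \<le> \<epsilon> * (k + \<bar>r\<bar>)" .
    have Hk: "\<bar>H' (y - x\<^sub>0)\<bar> \<le> k * K" using K by (simp add: k_def)
    have "\<epsilon> * k \<le> \<bar>c\<bar> * k" "\<epsilon> * \<bar>r\<bar> \<le> \<bar>c\<bar> / 2 * \<bar>r\<bar>"
      using mult_right_mono[OF \<epsilon>(2) k] mult_right_mono[OF \<epsilon>(2) abs_ge_zero[of r]]
        mult_nonneg_nonneg[OF abs_ge_zero[of c] k] by auto
    moreover have "\<bar>c\<bar> * \<bar>r\<bar> = \<bar>c * r\<bar>" by (simp add: abs_mult)
    ultimately have "\<bar>c\<bar> * \<bar>r\<bar> \<le> k * K + \<bar>c\<bar> * k + \<bar>c\<bar> / 2 * \<bar>r\<bar>"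
      using main Hk by (simp add: distrib_left) linarith
    then have "\<bar>r\<bar> \<le> M * k"
      using c by (simp add: M_def field_simps)
    then have "\<epsilon> * (k + \<bar>r\<bar>) \<le> \<epsilon> * ((1 + M) * k)"
      using \<epsilon> by (intro mult_left_mono) (auto simp: algebra_simps)
    also have "\<dots> \<le> e * \<bar>c\<bar> * k" using mult_right_mono[OF \<epsilon>(3) k] by (simp add: mult.assoc)
    finally have "\<bar>H' (y - x\<^sub>0) + c * r\<bar> \<le> e * k * \<bar>c\<bar>" using main by (simp add: mult_ac)
    moreover have "r - - H' (y - x\<^sub>0) / c = (H' (y - x\<^sub>0) + c * r) / c"
      using c by (simp add: field_simps)
    ultimately show "norm (\<sigma> y - \<sigma> x\<^sub>0 - - H' (y - x\<^sub>0) / c) \<le> e * norm (y - x\<^sub>0)"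
      using c by (simp add: r_def[symmetric] k_def[symmetric] abs_divide divide_le_eq)
  qed
qed

lemma has_derivative_compose_fst:
  assumes "(f has_derivative f') (at x)"
  shows "((\<lambda>p. f (fst p)) has_derivative (\<lambda>p. f' (fst p))) (at (x, y))"
proof -
  have "(fst has_derivative fst) (at (x, y))"
    by (rule has_derivative_fst[OF has_derivative_ident])
  from has_derivative_compose[OF this, of f f'] show ?thesis using assms by simp
qed

section \<open>Closed curves of curvature less than \<open>1 / \<mu>\<close>\<close>

text \<open>A table whose boundary is given by its tangent angle \<open>\<phi>\<close>, lifted to the reals, together with a Larmor
  radius \<open>\<mu>\<close>. The constant \<open>q < 1\<close> bounds \<open>\<mu> \<kappa>\<close> uniformly.\<close>

locale larmor_table =
  fixes \<Omega> :: "complex set" and \<Gamma> :: "real \<Rightarrow> complex" and L :: real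
    and \<phi> \<kappa> :: "real \<Rightarrow> real" and \<mu> q :: real
  assumes open_table: "open \<Omega>" and connected_table: "connected \<Omega>"
    and frontier_table: "range \<Gamma> = frontier \<Omega>"
    and left_of_tangents: "\<And>z s. z \<in> \<Omega> \<Longrightarrow> cross (cis (\<phi> s)) (z - \<Gamma> s) > 0"
    and L_pos: "L > 0" and \<Gamma>_periodic: "\<And>s. \<Gamma> (s + L) = \<Gamma> s"
    and \<Gamma>_deriv: "\<And>s. (\<Gamma> has_vector_derivative cis (\<phi> s)) (at s)"
    and \<phi>_deriv: "\<And>s. (\<phi> has_real_derivative \<kappa> s) (at s)"
    and \<phi>_turn: "\<And>s. \<phi> (s + L) = \<phi> s + 2 * pi"
    and \<kappa>_cont: "continuous_on UNIV \<kappa>" and \<kappa>_pos: "\<And>s. \<kappa> s > 0"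
    and \<mu>_pos: "\<mu> > 0" and \<mu>_\<kappa>: "\<And>s. \<mu> * \<kappa> s \<le> q" and q_less: "q < 1"
begin

lemma \<phi>_less: "s < t \<Longrightarrow> \<phi> s < \<phi> t"
  by (rule DERIV_pos_imp_increasing) (use \<phi>_deriv \<kappa>_pos in blast)+

lemma \<phi>_isCont [continuous_intros]: "isCont \<phi> s"
  using \<phi>_deriv by (rule DERIV_isCont)

lemma \<Gamma>_isCont: "isCont \<Gamma> s"
  using \<Gamma>_deriv has_vector_derivative_continuous by blast

lemma \<phi>_between:
  assumes "a < b" "\<phi> a < c" "c < \<phi> b"
  obtains t where "a < t" "t < b" "\<phi> t = c"
proof -
  obtain t where t: "a \<le> t" "t \<le> b" "\<phi> t = c"
    using IVT[of \<phi> a c b] assms \<phi>_isCont by force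
  then show ?thesis using that assms by (metis less_le order_less_irrefl)
qed

text \<open>Reparametrizing the boundary by positive weights, keeping the tangent directions, leaves it convex: the
  height of \<open>X\<close> above its tangent at \<open>s\<close> increases for the first half turn, decreases for the second one,
  and is zero at both ends. It applies to \<open>\<Gamma>\<close> itself and to its inner parallel curve.\<close>

lemma weighted_curve_left_of_tangent:
  assumes X: "\<And>t. (X has_vector_derivative (of_real (w t) * cis (\<phi> t))) (at t)"
    and w: "\<And>t. w t > 0" and per: "\<And>t. X (t + L) = X t"
    and st: "s < t" "t < s + L"
  shows "cross (cis (\<phi> s)) (X t - X s) > 0"
proof -
  define y where "y t = cross (cis (\<phi> s)) (X t - X s)" for t
  have y: "(y has_real_derivative w t * sin (\<phi> t - \<phi> s)) (at t)" for t
  proof -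
    have "cross (cis (\<phi> s)) (of_real (w t) * cis (\<phi> t)) = w t * sin (\<phi> t - \<phi> s)"
      using cross.scaleR_right[of "cis (\<phi> s)" "w t" "cis (\<phi> t)"] by (simp add: cross_cis scaleR_conv_of_real)
    then show ?thesis
      unfolding y_def using cross_has_real_derivative[OF X, of "cis (\<phi> s)" "X s" t] by simp
  qed
  have y0: "y s = 0" "y (s + L) = 0" using per by (simp_all add: y_def cross.zero_right)
  obtain p where p: "s < p" "p < s + L" "\<phi> p = \<phi> s + pi"
    by (rule \<phi>_between[of s "s + L" "\<phi> s + pi"]) (use L_pos \<phi>_turn[of s] in auto)
  have cont: "continuous_on A y" for A
    using y by (meson DERIV_isCont continuous_at_imp_continuous_on)
  show ?thesis
  proof (cases "t \<le> p")
    case True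
    have "y s < y t"
    proof (rule DERIV_pos_imp_increasing_open[OF st(1)])
      fix r assume r: "s < r" "r < t"
      then have "0 < \<phi> r - \<phi> s" "\<phi> r - \<phi> s < pi"
        using \<phi>_less[of s r] \<phi>_less[of r p] True p by auto
      then show "\<exists>d. (y has_real_derivative d) (at r) \<and> 0 < d"
        using y[of r] w[of r] sin_gt_zero by (metis mult_pos_pos)
    qed (rule cont)
    then show ?thesis using y0 by (simp add: y_def)
  next
    case False
    have "y t > y (s + L)"
    proof (rule DERIV_neg_imp_decreasing_open[OF st(2)])
      fix r assume r: "t < r" "r < s + L"
      then have "pi < \<phi> r - \<phi> s" "\<phi> r - \<phi> s < 2 * pi"
        using \<phi>_less[of p r] \<phi>_less[of r "s + L"] False p \<phi>_turn[of s] by auto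
      then have "sin (\<phi> r - \<phi> s) < 0" by (rule sin_lt_zero)
      then show "\<exists>d. (y has_real_derivative d) (at r) \<and> d < 0"
        using y[of r] w[of r] by (metis mult_pos_neg)
    qed (rule cont)
    then show ?thesis using y0 by (simp add: y_def)
  qed
qed

lemma \<Gamma>_left_of_tangent:
  assumes "s < t" "t < s + L"
  shows "cross (cis (\<phi> s)) (\<Gamma> t - \<Gamma> s) > 0"
  by (rule weighted_curve_left_of_tangent[of \<Gamma> "\<lambda>_. 1", OF _ _ _ assms])
     (use \<Gamma>_deriv \<Gamma>_periodic in auto)

lemma \<Gamma>_neq: "s < t \<Longrightarrow> t < s + L \<Longrightarrow> \<Gamma> s \<noteq> \<Gamma> t"
  using \<Gamma>_left_of_tangent[of s t] by (auto simp: cross.zero_right)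

lemma \<Gamma>_period_int: "\<Gamma> (s + of_int n * L) = \<Gamma> s"
proof (induction n rule: int_induct[of _ 0])
  case base then show ?case by simp
next
  case (step1 i) then show ?case using \<Gamma>_periodic[of "s + of_int i * L"] by (simp add: algebra_simps)
next
  case (step2 i) then show ?case using \<Gamma>_periodic[of "s + of_int (i - 1) * L"] by (simp add: algebra_simps)
qed

lemma \<phi>_turn_int: "\<phi> (s + of_int n * L) = \<phi> s + 2 * pi * of_int n"
proof (induction n rule: int_induct[of _ 0])
  case base then show ?case by simp
next
  case (step1 i) then show ?case using \<phi>_turn[of "s + of_int i * L"] by (simp add: algebra_simps)
next
  case (step2 i) then show ?case using \<phi>_turn[of "s + of_int (i - 1) * L"] by (simp add: algebra_simps)
qed

lemma shift_into_period:
  obtains n :: int where "a < t + of_int n * L" "t + of_int n * L \<le> a + L"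
proof
  define n where "n = \<lfloor>(a + L - t) / L\<rfloor>"
  have "of_int n \<le> (a + L - t) / L" "(a + L - t) / L < of_int n + 1"
    unfolding n_def by linarith+
  then show "a < t + of_int n * L" "t + of_int n * L \<le> a + L"
    using L_pos by (simp_all add: field_simps)
qed

lemma tangent_deriv: "((\<lambda>r. cis (\<phi> r)) has_vector_derivative \<kappa> r *\<^sub>R (\<i> * cis (\<phi> r))) (at r)"
  using has_derivative_cis[OF \<phi>_deriv[of r, unfolded has_field_derivative_def]]
  by (simp add: has_vector_derivative_def mult.commute)

text \<open>The boundary lies outside the disc of radius \<open>\<mu>\<close> that touches it from inside at \<open>\<Gamma> s\<close> (Blaschke's
  rolling theorem): the inner parallel curve \<open>E\<close>, which consists of the centers of these discs, is convex,
  so the center \<open>E s\<close> has distance more than \<open>\<mu>\<close> from the tangent at every other boundary point.\<close>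

lemma rolling_disc:
  assumes "\<Gamma> t \<noteq> \<Gamma> s"
  shows "2 * \<mu> * cross (cis (\<phi> s)) (\<Gamma> t - \<Gamma> s) < (norm (\<Gamma> t - \<Gamma> s))\<^sup>2"
proof -
  define E where "E r = \<Gamma> r + of_real \<mu> * (\<i> * cis (\<phi> r))" for r
  have E: "(E has_vector_derivative (of_real (1 - \<mu> * \<kappa> r) * cis (\<phi> r))) (at r)" for r
  proof -
    have "(E has_vector_derivative (cis (\<phi> r) + of_real \<mu> * (\<i> * (\<kappa> r *\<^sub>R (\<i> * cis (\<phi> r)))))) (at r)"
      unfolding E_def by (intro has_vector_derivative_add \<Gamma>_deriv has_vector_derivative_mult_right tangent_deriv)
    then show ?thesis
      by (simp add: scaleR_conv_of_real algebra_simps)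
  qed
  obtain n where n: "s < t + of_int n * L" "t + of_int n * L \<le> s + L"
    by (rule shift_into_period)
  define t' where "t' = t + of_int n * L"
  have \<Gamma>t: "\<Gamma> t' = \<Gamma> t" by (simp add: t'_def \<Gamma>_period_int)
  have t': "s < t'" "t' < s + L"
    using n assms \<Gamma>_periodic[of s] \<Gamma>t by (auto simp: t'_def less_le)
  have Eper: "E (r + L) = E r" for r
  proof -
    have "cis (\<phi> r + 2 * pi) = cis (\<phi> r)" by (simp add: cis.code)
    then show ?thesis by (simp add: E_def \<Gamma>_periodic \<phi>_turn)
  qed
  have "cross (cis (\<phi> t')) (E (s + L) - E t') > 0"
    by (rule weighted_curve_left_of_tangent[OF E _ Eper])
       (use t' \<mu>_\<kappa> q_less in \<open>auto intro: le_less_trans\<close>)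
  then have "cross (cis (\<phi> t')) (E s - \<Gamma> t - of_real \<mu> * (\<i> * cis (\<phi> t'))) > 0"
    unfolding Eper by (simp add: E_def[of t'] \<Gamma>t diff_diff_eq)
  moreover have "cross (cis (\<phi> t')) (of_real \<mu> * (\<i> * cis (\<phi> t'))) = \<mu>"
    using cross.scaleR_right[of "cis (\<phi> t')" \<mu> "\<i> * cis (\<phi> t')"]
    by (simp add: cross_ii_right inner_cis scaleR_conv_of_real)
  ultimately have "\<mu> < cross (cis (\<phi> t')) (E s - \<Gamma> t)"
    by (simp add: cross.diff_right)
  also have "\<dots> \<le> norm (E s - \<Gamma> t)"
    using abs_cross_le[of "cis (\<phi> t')" "E s - \<Gamma> t"] by simp
  finally have "\<mu>\<^sup>2 < (norm (E s - \<Gamma> t))\<^sup>2"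
    using \<mu>_pos by (intro power_strict_mono) auto
  moreover have "(norm (E s - \<Gamma> t))\<^sup>2 = (norm (\<Gamma> t - \<Gamma> s))\<^sup>2 - 2 * \<mu> * cross (cis (\<phi> s)) (\<Gamma> t - \<Gamma> s) + \<mu>\<^sup>2"
  proof -
    have "norm (E s - \<Gamma> t) = norm (\<Gamma> t - \<Gamma> s + (- \<mu>) *\<^sub>R (\<i> * cis (\<phi> s)))"
      by (subst norm_minus_commute) (simp add: E_def scaleR_conv_of_real algebra_simps)
    then show ?thesis
      unfolding norm_sq_add_normal[symmetric] by (simp only: norm_sq_add_normal) simp
  qed
  ultimately show ?thesis by simp
qed

section \<open>One chord and one Larmor arc\<close>

text \<open>The height of \<open>\<Gamma> r\<close> above the line through \<open>\<Gamma> s\<close> in direction \<open>\<alpha>\<close> has derivative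
  \<open>sin (\<phi> r - \<alpha>)\<close>. In one period it falls from zero, then rises, then falls back to zero, hence it changes
  sign exactly once, while rising.\<close>

lemma chord_exit:
  assumes \<alpha>: "\<phi> s < \<alpha>" "\<alpha> < \<phi> s + pi"
  shows "\<exists>t. s < t \<and> t < s + L \<and> \<alpha> < \<phi> t \<and> \<phi> t < \<alpha> + pi \<and> cross (cis \<alpha>) (\<Gamma> t - \<Gamma> s) = 0 \<and>
    (\<forall>r. s < r \<and> r < t \<longrightarrow> cross (cis \<alpha>) (\<Gamma> r - \<Gamma> s) < 0) \<and>
    (\<forall>r. t < r \<and> r < s + L \<longrightarrow> cross (cis \<alpha>) (\<Gamma> r - \<Gamma> s) > 0)"
proof -
  define y where "y t = cross (cis \<alpha>) (\<Gamma> t - \<Gamma> s)" for t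
  have y: "(y has_real_derivative sin (\<phi> t - \<alpha>)) (at t)" for t
    unfolding y_def using cross_has_real_derivative[OF \<Gamma>_deriv, of "cis \<alpha>" "\<Gamma> s" t] by (simp add: cross_cis)
  have cont: "continuous_on A y" for A
    using y by (meson DERIV_isCont continuous_at_imp_continuous_on)
  have y0: "y s = 0" "y (s + L) = 0" using \<Gamma>_periodic by (simp_all add: y_def cross.zero_right)
  obtain p where p: "s < p" "p < s + L" "\<phi> p = \<alpha>"
    by (rule \<phi>_between[of s "s + L" \<alpha>]) (use L_pos \<alpha> \<phi>_turn[of s] in auto)
  obtain p' where p': "p < p'" "p' < s + L" "\<phi> p' = \<alpha> + pi"
    by (rule \<phi>_between[of p "s + L" "\<alpha> + pi"]) (use p \<alpha> \<phi>_turn[of s] in auto)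
  have dec: "y b < y a" if "s \<le> a" "a < b" "b \<le> p" for a b
  proof (rule DERIV_neg_imp_decreasing_open[OF that(2)])
    fix r assume r: "a < r" "r < b"
    then have "\<phi> s < \<phi> r" "\<phi> r < \<alpha>" using \<phi>_less[of s r] \<phi>_less[of r p] that p by auto
    then have "sin (\<alpha> - \<phi> r) > 0" using \<alpha> by (intro sin_gt_zero) auto
    then have "sin (\<phi> r - \<alpha>) < 0" using sin_minus[of "\<alpha> - \<phi> r"] by simp
    then show "\<exists>d. (y has_real_derivative d) (at r) \<and> d < 0" using y by blast
  qed (rule cont)
  have inc: "y a < y b" if "p \<le> a" "a < b" "b \<le> p'" for a b
  proof (rule DERIV_pos_imp_increasing_open[OF that(2)])
    fix r assume r: "a < r" "r < b"
    then have "\<alpha> < \<phi> r" "\<phi> r < \<alpha> + pi" using \<phi>_less[of p r] \<phi>_less[of r p'] that p p' by auto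
    then have "sin (\<phi> r - \<alpha>) > 0" by (intro sin_gt_zero) auto
    then show "\<exists>d. (y has_real_derivative d) (at r) \<and> 0 < d" using y by blast
  qed (rule cont)
  have dec': "y b < y a" if "p' \<le> a" "a < b" "b \<le> s + L" for a b
  proof (rule DERIV_neg_imp_decreasing_open[OF that(2)])
    fix r assume r: "a < r" "r < b"
    then have "\<alpha> + pi < \<phi> r" "\<phi> r < \<phi> s + 2 * pi"
      using \<phi>_less[of p' r] \<phi>_less[of r "s + L"] that p' \<phi>_turn[of s] by auto
    then have "sin (\<phi> r - \<alpha>) < 0" using \<alpha> by (intro sin_lt_zero) auto
    then show "\<exists>d. (y has_real_derivative d) (at r) \<and> d < 0" using y by blast
  qed (rule cont)
  have "y p < 0" using dec[of s p] p y0 by simp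
  moreover have "y p' > 0" using dec'[of p' "s + L"] p' y0 by simp
  ultimately obtain t where t: "p \<le> t" "t \<le> p'" "y t = 0"
    using IVT[of y p 0 p'] p' y DERIV_isCont by (metis less_eq_real_def)
  have tp: "p < t" "t < p'" using t \<open>y p < 0\<close> \<open>y p' > 0\<close> by (auto simp: less_le)
  have neg: "y r < 0" if "s < r" "r < t" for r
  proof (cases "r \<le> p")
    case True then show ?thesis using dec[of s r] that y0 by simp
  next
    case False then show ?thesis using inc[of r t] that t by simp
  qed
  have pos: "y r > 0" if "t < r" "r < s + L" for r
  proof (cases "r \<le> p'")
    case True then show ?thesis using inc[of t r] that t by simp
  next
    case False then show ?thesis using dec'[of r "s + L"] that y0 by simp
  qed
  show ?thesis
    using tp p p' neg pos t \<phi>_less[of p t] \<phi>_less[of t p']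
    unfolding y_def by (intro exI[of _ t]) auto
qed

text \<open>If \<open>z\<close> lies on the normal at \<open>\<Gamma> m\<close> at distance at most \<open>\<mu>\<close>, then the disc about \<open>z\<close> through \<open>\<Gamma> m\<close>
  is contained in the rolling disc at \<open>\<Gamma> m\<close>, or lies beyond the tangent; either way it
  meets the boundary only at \<open>\<Gamma> m\<close>.\<close>

lemma nearest_boundary_point_unique:
  assumes crit: "cis (\<phi> m) \<bullet> (\<Gamma> m - z) = 0" and near: "norm (\<Gamma> m - z) \<le> \<mu>" and ne: "\<Gamma> t \<noteq> \<Gamma> m"
  shows "norm (\<Gamma> m - z) < norm (\<Gamma> t - z)"
proof -
  define c where "c = cross (cis (\<phi> m)) (\<Gamma> m - z)"
  define w where "w = \<Gamma> t - \<Gamma> m"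
  have m: "\<Gamma> m - z = c *\<^sub>R (\<i> * cis (\<phi> m))"
    using cis_decomp[of "\<Gamma> m - z" "\<phi> m"] crit by (simp add: c_def scaleR_conv_of_real)
  have c: "\<bar>c\<bar> \<le> \<mu>" using near m by (simp add: norm_mult)
  obtain n where n: "m < t + of_int n * L" "t + of_int n * L \<le> m + L"
    by (rule shift_into_period)
  have "\<Gamma> (t + of_int n * L) \<noteq> \<Gamma> (m + L)" using ne by (simp add: \<Gamma>_period_int \<Gamma>_periodic)
  then have "t + of_int n * L < m + L" using n by (auto simp: less_le)
  from \<Gamma>_left_of_tangent[OF n(1) this] have y: "cross (cis (\<phi> m)) w > 0"
    by (simp add: w_def \<Gamma>_period_int)
  have "2 * (- c) * cross (cis (\<phi> m)) w \<le> 2 * \<mu> * cross (cis (\<phi> m)) w"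
    using c y by (intro mult_right_mono) auto
  also have "\<dots> < (norm w)\<^sup>2" unfolding w_def by (rule rolling_disc[OF ne])
  finally have "0 < (norm w)\<^sup>2 + 2 * c * cross (cis (\<phi> m)) w" by simp
  moreover have "(norm (\<Gamma> t - z))\<^sup>2 = (norm (\<Gamma> m - z))\<^sup>2 + ((norm w)\<^sup>2 + 2 * c * cross (cis (\<phi> m)) w)"
  proof -
    have "\<Gamma> t - z = w + (\<Gamma> m - z)" by (simp add: w_def)
    then have "(norm (\<Gamma> t - z))\<^sup>2 = (norm w)\<^sup>2 + 2 * c * cross (cis (\<phi> m)) w + c\<^sup>2"
      unfolding m by (simp only: norm_sq_add_normal)
    then show ?thesis unfolding m by (simp add: norm_mult)
  qed
  ultimately have "(norm (\<Gamma> m - z))\<^sup>2 < (norm (\<Gamma> t - z))\<^sup>2" by simp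
  then show ?thesis by (rule power_less_imp_less_base) simp
qed

definition sqdist :: "complex \<Rightarrow> real \<Rightarrow> real" where
  "sqdist z r = (norm (\<Gamma> r - z))\<^sup>2"

text \<open>Half the derivative of \<open>sqdist\<close>. A boundary point where it vanishes has \<open>z\<close> on its normal.\<close>

definition tdist :: "complex \<Rightarrow> real \<Rightarrow> real" where
  "tdist z r = cis (\<phi> r) \<bullet> (\<Gamma> r - z)"

lemma sqdist_deriv: "(sqdist z has_real_derivative 2 * tdist z r) (at r)"
proof -
  have "((\<lambda>r. \<Gamma> r - z) has_vector_derivative cis (\<phi> r)) (at r)"
    using \<Gamma>_deriv by (auto intro!: derivative_eq_intros)
  then have "((\<lambda>r. \<Gamma> r - z) has_derivative (\<lambda>h. h *\<^sub>R cis (\<phi> r))) (at r)"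
    by (simp add: has_vector_derivative_def)
  from has_derivative_inner[OF this this] show ?thesis
    unfolding sqdist_def[abs_def] tdist_def power2_norm_eq_inner has_field_derivative_def
    by (rule has_derivative_eq_rhs) (auto simp: inner_commute algebra_simps)
qed

lemma tdist_deriv: "(tdist z has_real_derivative 1 + \<kappa> r * cross (cis (\<phi> r)) (\<Gamma> r - z)) (at r)"
proof -
  have 1: "((\<lambda>r. \<Gamma> r - z) has_derivative (\<lambda>h. h *\<^sub>R cis (\<phi> r))) (at r)"
    using \<Gamma>_deriv[of r] by (auto intro!: derivative_eq_intros simp: has_vector_derivative_def)
  have 2: "((\<lambda>r. cis (\<phi> r)) has_derivative (\<lambda>h. h *\<^sub>R (\<kappa> r *\<^sub>R (\<i> * cis (\<phi> r))))) (at r)"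
    using tangent_deriv by (simp add: has_vector_derivative_def)
  from has_derivative_inner[OF 2 1] show ?thesis
    unfolding tdist_def[abs_def] has_field_derivative_def
    by (rule has_derivative_eq_rhs) (auto simp: fun_eq_iff inner_cis inner_ii_left cross.diff_right algebra_simps)
qed

text \<open>The squared distance to \<open>z\<close> is strictly convex along the parts of the boundary inside the disc of
  radius \<open>\<mu>\<close> about \<open>z\<close>.\<close>

lemma tdist_deriv_ge:
  assumes "norm (\<Gamma> r - z) \<le> \<mu>"
  shows "1 - q \<le> 1 + \<kappa> r * cross (cis (\<phi> r)) (\<Gamma> r - z)"
proof -
  have "\<bar>cross (cis (\<phi> r)) (\<Gamma> r - z)\<bar> \<le> \<mu>"
    using abs_cross_le[of "cis (\<phi> r)" "\<Gamma> r - z"] assms by simp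
  then have "\<kappa> r * (- cross (cis (\<phi> r)) (\<Gamma> r - z)) \<le> \<kappa> r * \<mu>"
    using \<kappa>_pos[of r] by (intro mult_left_mono) auto
  then show ?thesis using \<mu>_\<kappa>[of r] by (simp add: mult.commute)
qed

lemma sqdist_less_iff: "sqdist z r < \<mu>\<^sup>2 \<longleftrightarrow> norm (\<Gamma> r - z) < \<mu>"
  and sqdist_le_iff: "sqdist z r \<le> \<mu>\<^sup>2 \<longleftrightarrow> norm (\<Gamma> r - z) \<le> \<mu>"
  and sqdist_eq_iff: "sqdist z r = \<mu>\<^sup>2 \<longleftrightarrow> norm (\<Gamma> r - z) = \<mu>"
  unfolding sqdist_def using \<mu>_pos
  by (auto simp: power_mono_iff power_eq_iff_eq_base simp flip: not_le)

text \<open>Along the boundary, starting from the exit point \<open>\<Gamma> s\<close>, the distance to the Larmor center first falls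
  below \<open>\<mu>\<close>. Let \<open>\<Gamma> t\<close> be the next point on the Larmor circle. By convexity of the squared distance, it is
  crossed with positive speed, and \<open>t - s\<close> is controlled by the initial speed. If the boundary came back to the
  disc before \<open>s + L\<close>, then the distance would have a second critical point of value at most \<open>\<mu>\<close>.\<close>

lemma larmor_entry:
  assumes \<alpha>: "\<phi> s - pi < \<alpha>" "\<alpha> < \<phi> s"
  defines "z \<equiv> \<Gamma> s + of_real \<mu> * (\<i> * cis \<alpha>)"
  shows "\<exists>t. s < t \<and> t < s + L \<and> \<phi> t < \<phi> s + pi \<and> sqdist z t = \<mu>\<^sup>2 \<and> tdist z t > 0 \<and>
    (\<forall>r. s < r \<and> r < t \<longrightarrow> sqdist z r < \<mu>\<^sup>2) \<and>
    (\<forall>r. t < r \<and> r < s + L \<longrightarrow> sqdist z r > \<mu>\<^sup>2) \<and>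
    (1 - q) * (t - s) \<le> 2 * \<mu> * sin (\<phi> s - \<alpha>)"
proof -
  have z: "\<Gamma> s - z = - (\<mu> *\<^sub>R (\<i> * cis \<alpha>))" by (simp add: z_def scaleR_conv_of_real)
  have H0: "sqdist z s = \<mu>\<^sup>2" "sqdist z (s + L) = \<mu>\<^sup>2"
    using \<mu>_pos by (simp_all add: sqdist_eq_iff \<Gamma>_periodic z norm_mult)
  have g0: "tdist z s = - \<mu> * sin (\<phi> s - \<alpha>)"
  proof -
    have "tdist z s = \<mu> * sin (\<alpha> - \<phi> s)"
      unfolding tdist_def z by (simp add: inner_ii_right cross_cis)
    then show ?thesis using sin_minus[of "\<phi> s - \<alpha>"] by simp
  qed
  have sin_pos: "sin (\<phi> s - \<alpha>) > 0" using \<alpha> by (intro sin_gt_zero) auto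
  have g_neg: "tdist z s < 0" using g0 sin_pos \<mu>_pos by simp
  have gL: "tdist z (s + L) = tdist z s"
  proof -
    have "cis (\<phi> s + 2 * pi) = cis (\<phi> s)" by (simp add: cis.code)
    then show ?thesis by (simp add: tdist_def \<Gamma>_periodic \<phi>_turn)
  qed
  have Hcont: "continuous_on A (sqdist z)" for A
    using sqdist_deriv by (meson DERIV_isCont continuous_at_imp_continuous_on)
  have gcont: "continuous_on A (tdist z)" for A
    using tdist_deriv by (meson DERIV_isCont continuous_at_imp_continuous_on)
  obtain d1 where d1: "d1 > 0" "\<And>h. 0 < h \<Longrightarrow> h < d1 \<Longrightarrow> sqdist z (s + h) < \<mu>\<^sup>2"
    using DERIV_neg_dec_right[OF sqdist_deriv[of z s]] g_neg H0 by auto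
  obtain d2 where d2: "d2 > 0" "\<And>h. 0 < h \<Longrightarrow> h < d2 \<Longrightarrow> sqdist z (s + L - h) > \<mu>\<^sup>2"
    using DERIV_neg_dec_left[OF sqdist_deriv[of z "s + L"]] g_neg H0 gL by auto
  \<comment> \<open>Divided by 3 so that \<open>a = s + e\<close> still comes before \<open>b = s + L - e\<close>.\<close>
  define e where "e = min (min d1 d2) L / 3"
  have e: "0 < e" "e < d1" "e < d2" "s + e < s + L - e"
    using d1(1) d2(1) L_pos by (auto simp: e_def min_def)
  define a b where "a = s + e" and "b = s + L - e"
  have ab: "s < a" "a < b" "b < s + L" "sqdist z a < \<mu>\<^sup>2" "sqdist z b > \<mu>\<^sup>2"
    using e d1 d2 by (auto simp: a_def b_def)
  define Z where "Z = {r \<in> {a..b}. sqdist z r = \<mu>\<^sup>2}"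
  have "closed Z"
    unfolding Z_def by (rule continuous_closed_preimage_constant[OF Hcont]) simp
  have "Z \<noteq> {}"
    using IVT'[of "sqdist z" a "\<mu>\<^sup>2" b] ab Hcont by (force simp: Z_def)
  have bddZ: "bdd_below Z" by (rule bdd_belowI[of _ a]) (auto simp: Z_def)
  define t where "t = Inf Z"
  have tZ: "t \<in> Z" unfolding t_def using closed_contains_Inf \<open>closed Z\<close> \<open>Z \<noteq> {}\<close> bddZ by blast
  then have t: "a < t" "t < b" "sqdist z t = \<mu>\<^sup>2" using ab by (auto simp: Z_def less_le)
  have inside: "sqdist z r < \<mu>\<^sup>2" if "s < r" "r < t" for r
  proof (cases "r \<le> a")
    case True
    then show ?thesis using d1(2)[of "r - s"] that e by (simp add: a_def)
  next
    case False
    show ?thesis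
    proof (rule ccontr)
      assume "\<not> sqdist z r < \<mu>\<^sup>2"
      then obtain x where x: "a \<le> x" "x \<le> r" "sqdist z x = \<mu>\<^sup>2"
        using IVT'[of "sqdist z" a "\<mu>\<^sup>2" r] ab Hcont False by force
      then have "x \<in> Z" using that t by (auto simp: Z_def)
      then have "t \<le> x" unfolding t_def by (rule cInf_lower[OF _ bddZ])
      then show False using x that by simp
    qed
  qed
  have st: "s < t" "t < s + L" using t ab by auto
  have inside': "norm (\<Gamma> r - z) \<le> \<mu>" if "s \<le> r" "r \<le> t" for r
    using inside[of r] that H0 t by (metis less_eq_real_def sqdist_le_iff)
  have g_lower: "tdist z r \<ge> (1 - q) * (r - s) - \<mu> * sin (\<phi> s - \<alpha>)" if r: "s \<le> r" "r \<le> t" for r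
  proof -
    have "tdist z s - (1 - q) * (s - s) \<le> tdist z r - (1 - q) * (r - s)"
    proof (rule DERIV_nonneg_imp_nondecreasing[OF r(1), where f = "\<lambda>r. tdist z r - (1 - q) * (r - s)"])
      fix x assume "s \<le> x" "x \<le> r"
      then have "1 - q \<le> 1 + \<kappa> x * cross (cis (\<phi> x)) (\<Gamma> x - z)"
        using r by (intro tdist_deriv_ge inside') auto
      moreover have "((\<lambda>r. tdist z r - (1 - q) * (r - s)) has_real_derivative
          (1 + \<kappa> x * cross (cis (\<phi> x)) (\<Gamma> x - z)) - (1 - q)) (at x)"
        by (auto intro!: derivative_eq_intros tdist_deriv)
      ultimately show "\<exists>y. ((\<lambda>r. tdist z r - (1 - q) * (r - s)) has_real_derivative y) (at x) \<and> 0 \<le> y"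
        by (intro exI conjI) auto
    qed
    then show ?thesis using g0 by simp
  qed
  have bound: "(1 - q) * (t - s) \<le> 2 * \<mu> * sin (\<phi> s - \<alpha>)"
  proof -
    \<comment> \<open>The difference from the parabola obtained by integrating the lower bound for the derivative.\<close>
    define K where "K r = sqdist z r - ((1 - q) * (r - s)\<^sup>2 - 2 * \<mu> * sin (\<phi> s - \<alpha>) * (r - s))" for r
    have "K s \<le> K t"
    proof (rule DERIV_nonneg_imp_nondecreasing[where f = K])
      fix x assume x: "s \<le> x" "x \<le> t"
      have "(K has_real_derivative 2 * tdist z x - (2 * (1 - q) * (x - s) - 2 * \<mu> * sin (\<phi> s - \<alpha>))) (at x)"
        unfolding K_def by (auto intro!: derivative_eq_intros sqdist_deriv simp: algebra_simps)
      then show "\<exists>y. (K has_real_derivative y) (at x) \<and> 0 \<le> y"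
        using g_lower[OF x] by (intro exI conjI) (auto simp: algebra_simps)
    qed (use st in auto)
    then have "(t - s) * ((1 - q) * (t - s)) \<le> (t - s) * (2 * \<mu> * sin (\<phi> s - \<alpha>))"
      using t H0 by (simp add: K_def power2_eq_square algebra_simps)
    then show ?thesis using st by (simp add: mult_le_cancel_left)
  qed
  have g_inc: "tdist z x < tdist z y" if "s \<le> x" "x < y" "y \<le> t" for x y
  proof (rule DERIV_pos_imp_increasing[OF that(2)])
    fix r assume "x \<le> r" "r \<le> y"
    then show "\<exists>d. (tdist z has_real_derivative d) (at r) \<and> 0 < d"
      using tdist_deriv[of z r] tdist_deriv_ge[OF inside'[of r]] that q_less
      by (intro exI[of _ "1 + \<kappa> r * cross (cis (\<phi> r)) (\<Gamma> r - z)"]) auto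
  qed
  have gt: "tdist z t > 0"
  proof (rule ccontr)
    assume "\<not> tdist z t > 0"
    have "sqdist z t < sqdist z s"
    proof (rule DERIV_neg_imp_decreasing_open[OF st(1)])
      fix r assume "s < r" "r < t"
      then have "tdist z r < 0" using g_inc[of r t] \<open>\<not> tdist z t > 0\<close> by simp
      then show "\<exists>d. (sqdist z has_real_derivative d) (at r) \<and> d < 0"
        using sqdist_deriv[of z r] by (intro exI[of _ "2 * tdist z r"]) auto
    qed (rule Hcont)
    then show False using t H0 by simp
  qed
  \<comment> \<open>The nearest boundary point on the arc inside the Larmor disc.\<close>
  obtain m where m: "s < m" "m < t" "tdist z m = 0"
  proof -
    obtain m where "s \<le> m" "m \<le> t" "tdist z m = 0"
      using IVT'[of "tdist z" s 0 t] gcont st gt g_neg by force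
    then show ?thesis using that g_neg gt by (metis less_eq_real_def order_less_irrefl)
  qed
  have outside: "sqdist z r > \<mu>\<^sup>2" if r: "t < r" "r < s + L" for r
  proof (rule ccontr)
    assume "\<not> sqdist z r > \<mu>\<^sup>2"
    then have Hr: "sqdist z r \<le> \<mu>\<^sup>2" by simp
    obtain x where x: "t \<le> x" "x \<le> s + L" "\<And>y. t \<le> y \<Longrightarrow> y \<le> s + L \<Longrightarrow> sqdist z x \<le> sqdist z y"
      using continuous_attains_inf[of "{t..s + L}" "sqdist z"] st Hcont by auto
    obtain m' where m': "t < m'" "m' < s + L" "sqdist z m' \<le> \<mu>\<^sup>2"
      "\<And>y. t \<le> y \<Longrightarrow> y \<le> s + L \<Longrightarrow> sqdist z m' \<le> sqdist z y"
    proof (cases "sqdist z x < \<mu>\<^sup>2")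
      case True
      then have "t < x" "x < s + L" using x t H0 by (auto simp: less_le)
      then show ?thesis using that[of x] x True by simp
    next
      case False
      then show ?thesis using that[of r] x r Hr by (meson dual_order.trans linorder_not_less)
    qed
    have "2 * tdist z m' = 0"
    proof (rule DERIV_local_min[OF sqdist_deriv])
      show "0 < min (m' - t) (s + L - m')" using m' by simp
      show "\<forall>y. \<bar>m' - y\<bar> < min (m' - t) (s + L - m') \<longrightarrow> sqdist z m' \<le> sqdist z y"
        using m' by auto
    qed
    then have crit': "cis (\<phi> m') \<bullet> (\<Gamma> m' - z) = 0" by (simp add: tdist_def)
    have crit: "cis (\<phi> m) \<bullet> (\<Gamma> m - z) = 0" using m by (simp add: tdist_def)
    have ne: "\<Gamma> m \<noteq> \<Gamma> m'" by (rule \<Gamma>_neq) (use m m' in auto)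
    have "norm (\<Gamma> m - z) < norm (\<Gamma> m' - z)"
      by (rule nearest_boundary_point_unique[OF crit inside' ne[symmetric]]) (use m in auto)
    moreover have "norm (\<Gamma> m' - z) < norm (\<Gamma> m - z)"
      by (rule nearest_boundary_point_unique[OF crit' _ ne]) (use m' sqdist_le_iff in auto)
    ultimately show False by simp
  qed
  have turn: "\<phi> t < \<phi> s + pi"
  proof (rule ccontr)
    assume "\<not> \<phi> t < \<phi> s + pi"
    then obtain p where p: "s < p" "p \<le> t" "\<phi> p = \<phi> s + pi"
      using \<phi>_between[of s t "\<phi> s + pi"] st by (metis less_add_same_cancel1 linorder_neqE_linordered_idom order_less_imp_le order_refl pi_gt_zero)
    \<comment> \<open>The height of the inner parallel curve above \<open>z\<close>, in the direction of the normal at \<open>s\<close>. It increases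
      during the first half turn, but would have to be negative or zero after it.\<close>
    define W where "W r = cross (cis (\<phi> s)) (\<Gamma> r - z) + \<mu> * cos (\<phi> r - \<phi> s)" for r
    have W: "(W has_real_derivative (1 - \<mu> * \<kappa> r) * sin (\<phi> r - \<phi> s)) (at r)" for r
    proof -
      have "((\<lambda>r. cross (cis (\<phi> s)) (\<Gamma> r - z)) has_real_derivative sin (\<phi> r - \<phi> s)) (at r)"
        using cross_has_real_derivative[OF \<Gamma>_deriv, of "cis (\<phi> s)" z r] by (simp add: cross_cis)
      then show ?thesis
        unfolding W_def by (auto intro!: derivative_eq_intros \<phi>_deriv simp: algebra_simps)
    qed
    have "W s < W p"
    proof (rule DERIV_pos_imp_increasing_open[OF p(1)])
      fix r assume r: "s < r" "r < p"
      then have "0 < \<phi> r - \<phi> s" "\<phi> r - \<phi> s < pi"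
        using \<phi>_less[of s r] \<phi>_less[of r p] p by auto
      moreover have "1 - \<mu> * \<kappa> r > 0" using \<mu>_\<kappa>[of r] q_less by simp
      ultimately show "\<exists>d. (W has_real_derivative d) (at r) \<and> 0 < d"
        using W[of r] sin_gt_zero by (metis mult_pos_pos)
    next
      show "continuous_on {s..p} W" using W by (meson DERIV_isCont continuous_at_imp_continuous_on)
    qed
    moreover have "W s > 0"
    proof -
      have "cross (cis (\<phi> s)) (\<Gamma> s - z) = - \<mu> * cos (\<phi> s - \<alpha>)"
        unfolding z by (simp add: cross.minus_right cross.scaleR_right cross_ii_right inner_cis cos_diff mult.commute)
      moreover have "cos (\<phi> s - \<alpha>) < 1"
      proof -
        have "cos (\<phi> s - \<alpha>) < cos 0" using \<alpha> by (intro cos_monotone_0_pi) auto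
        then show ?thesis by simp
      qed
      ultimately show ?thesis using \<mu>_pos by (simp add: W_def)
    qed
    moreover have "W p \<le> 0"
    proof -
      have "\<bar>cross (cis (\<phi> s)) (\<Gamma> p - z)\<bar> \<le> \<mu>"
        using abs_cross_le[of "cis (\<phi> s)" "\<Gamma> p - z"] inside'[of p] p by simp
      then show ?thesis using p by (simp add: W_def)
    qed
    ultimately show False by simp
  qed
  show ?thesis
    using st t turn gt inside outside bound by (intro exI[of _ t]) auto
qed

section \<open>Trajectories as functions of the initial state\<close>

text \<open>In the following functions \<open>x = (s, u)\<close> is the initial state. The directions \<open>launch x\<close> and \<open>arrive x\<close>
  of the velocity before and after the Larmor arc and the parameters \<open>exit x\<close> and \<open>entry x\<close> of the exit and
  return points take values in the reals rather than modulo a full turn or period. The sign patterns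
  determine \<open>exit x\<close> and \<open>entry x\<close> uniquely; the other clauses record what is known about them.\<close>

definition launch :: "real \<times> real \<Rightarrow> real" where
  "launch x = \<phi> (fst x) + arccos (- snd x)"

definition exit :: "real \<times> real \<Rightarrow> real" where
  "exit x = (SOME t. fst x < t \<and> t < fst x + L \<and> launch x < \<phi> t \<and> \<phi> t < launch x + pi \<and>
     cross (cis (launch x)) (\<Gamma> t - \<Gamma> (fst x)) = 0 \<and>
     (\<forall>r. fst x < r \<and> r < t \<longrightarrow> cross (cis (launch x)) (\<Gamma> r - \<Gamma> (fst x)) < 0) \<and>
     (\<forall>r. t < r \<and> r < fst x + L \<longrightarrow> cross (cis (launch x)) (\<Gamma> r - \<Gamma> (fst x)) > 0))"

definition chord :: "real \<times> real \<Rightarrow> real" where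
  "chord x = cis (launch x) \<bullet> (\<Gamma> (exit x) - \<Gamma> (fst x))"

definition center :: "real \<times> real \<Rightarrow> complex" where
  "center x = \<Gamma> (exit x) + of_real \<mu> * (\<i> * cis (launch x))"

definition entry :: "real \<times> real \<Rightarrow> real" where
  "entry x = (SOME t. exit x < t \<and> t < exit x + L \<and> \<phi> t < \<phi> (exit x) + pi \<and>
     sqdist (center x) t = \<mu>\<^sup>2 \<and> tdist (center x) t > 0 \<and>
     (\<forall>r. exit x < r \<and> r < t \<longrightarrow> sqdist (center x) r < \<mu>\<^sup>2) \<and>
     (\<forall>r. t < r \<and> r < exit x + L \<longrightarrow> sqdist (center x) r > \<mu>\<^sup>2) \<and>
     (1 - q) * (t - exit x) \<le> 2 * \<mu> * sin (\<phi> (exit x) - launch x))"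

text \<open>The velocity on re-entry; counterclockwise motion along a circle is directed at a right angle to the left
  of the radius vector.\<close>

definition vel :: "real \<times> real \<Rightarrow> complex" where
  "vel x = (1 / \<mu>) *\<^sub>R (\<i> * (\<Gamma> (entry x) - center x))"

definition land :: "real \<times> real \<Rightarrow> real" where
  "land x = - (cis (\<phi> (entry x)) \<bullet> vel x)"

definition arrive :: "real \<times> real \<Rightarrow> real" where
  "arrive x = \<phi> (entry x) + arccos (- land x)"

abbreviation launch_angle :: "real \<times> real \<Rightarrow> real" where
  "launch_angle x \<equiv> launch x - \<phi> (fst x)"

abbreviation exit_angle :: "real \<times> real \<Rightarrow> real" where
  "exit_angle x \<equiv> \<phi> (exit x) - launch x"

abbreviation entry_angle :: "real \<times> real \<Rightarrow> real" where
  "entry_angle x \<equiv> arrive x - \<phi> (entry x)"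

lemma launch_range:
  assumes "x \<in> open_strip"
  shows "\<phi> (fst x) < launch x" "launch x < \<phi> (fst x) + pi"
  using assms arccos_lt_bounded[of "- snd x"] by (auto simp: launch_def open_strip_def)

lemma cos_launch: "x \<in> open_strip \<Longrightarrow> cos (launch_angle x) = - snd x"
  by (auto simp: launch_def open_strip_def)

lemma sin_launch_pos: "x \<in> open_strip \<Longrightarrow> 0 < sin (launch_angle x)"
  using launch_range[of x] by (intro sin_gt_zero) auto

lemma exit_spec:
  assumes "x \<in> open_strip"
  shows exit_gt: "fst x < exit x" and exit_less: "exit x < fst x + L"
    and launch_less_exit: "launch x < \<phi> (exit x)" and exit_less_launch: "\<phi> (exit x) < launch x + pi"
    and exit_root: "cross (cis (launch x)) (\<Gamma> (exit x) - \<Gamma> (fst x)) = 0"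
    and before_exit: "\<And>r. fst x < r \<Longrightarrow> r < exit x \<Longrightarrow> cross (cis (launch x)) (\<Gamma> r - \<Gamma> (fst x)) < 0"
    and after_exit: "\<And>r. exit x < r \<Longrightarrow> r < fst x + L \<Longrightarrow> cross (cis (launch x)) (\<Gamma> r - \<Gamma> (fst x)) > 0"
proof -
  note * = someI_ex[OF chord_exit[OF launch_range[OF assms]], folded exit_def]
  show "fst x < exit x" "exit x < fst x + L" "launch x < \<phi> (exit x)" "\<phi> (exit x) < launch x + pi"
    "cross (cis (launch x)) (\<Gamma> (exit x) - \<Gamma> (fst x)) = 0"
    "\<And>r. fst x < r \<Longrightarrow> r < exit x \<Longrightarrow> cross (cis (launch x)) (\<Gamma> r - \<Gamma> (fst x)) < 0"
    "\<And>r. exit x < r \<Longrightarrow> r < fst x + L \<Longrightarrow> cross (cis (launch x)) (\<Gamma> r - \<Gamma> (fst x)) > 0"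
    using * by blast+
qed

lemma sin_exit_pos: "x \<in> open_strip \<Longrightarrow> 0 < sin (exit_angle x)"
  using exit_spec[of x] by (intro sin_gt_zero) auto

lemma entry_spec:
  assumes "x \<in> open_strip"
  shows entry_gt: "exit x < entry x" and entry_less: "entry x < exit x + L"
    and entry_turn: "\<phi> (entry x) < \<phi> (exit x) + pi"
    and entry_root: "sqdist (center x) (entry x) = \<mu>\<^sup>2" and entry_inward: "tdist (center x) (entry x) > 0"
    and before_entry: "\<And>r. exit x < r \<Longrightarrow> r < entry x \<Longrightarrow> sqdist (center x) r < \<mu>\<^sup>2"
    and after_entry: "\<And>r. entry x < r \<Longrightarrow> r < exit x + L \<Longrightarrow> sqdist (center x) r > \<mu>\<^sup>2"
    and entry_near: "(1 - q) * (entry x - exit x) \<le> 2 * \<mu> * sin (exit_angle x)"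
proof -
  have "\<phi> (exit x) - pi < launch x" "launch x < \<phi> (exit x)"
    using exit_spec[OF assms] by auto
  note * = someI_ex[OF larmor_entry[OF this], folded center_def, folded entry_def]
  show "exit x < entry x" "entry x < exit x + L" "\<phi> (entry x) < \<phi> (exit x) + pi"
    "sqdist (center x) (entry x) = \<mu>\<^sup>2" "tdist (center x) (entry x) > 0"
    "\<And>r. exit x < r \<Longrightarrow> r < entry x \<Longrightarrow> sqdist (center x) r < \<mu>\<^sup>2"
    "\<And>r. entry x < r \<Longrightarrow> r < exit x + L \<Longrightarrow> sqdist (center x) r > \<mu>\<^sup>2"
    "(1 - q) * (entry x - exit x) \<le> 2 * \<mu> * sin (exit_angle x)"
    using * by blast+
qed

lemma chord_vector:
  assumes "x \<in> open_strip"
  shows "\<Gamma> (exit x) - \<Gamma> (fst x) = chord x *\<^sub>R cis (launch x)" and chord_pos: "0 < chord x"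
proof -
  show v: "\<Gamma> (exit x) - \<Gamma> (fst x) = chord x *\<^sub>R cis (launch x)"
    using cis_decomp[of "\<Gamma> (exit x) - \<Gamma> (fst x)" "launch x"] exit_root[OF assms]
    by (simp add: chord_def scaleR_conv_of_real)
  have "0 < cross (cis (\<phi> (fst x))) (\<Gamma> (exit x) - \<Gamma> (fst x))"
    by (rule \<Gamma>_left_of_tangent) (use exit_spec[OF assms] in auto)
  then have "0 < chord x * sin (launch_angle x)"
    unfolding v by (simp add: cross.scaleR_right cross_cis)
  then show "0 < chord x"
    using sin_launch_pos[OF assms] by (simp add: zero_less_mult_iff)
qed

text \<open>The starting point lies outside the rolling disc at the exit point, so the chord is longer than the part
  of its line inside this disc.\<close>

lemma chord_gt:
  assumes "x \<in> open_strip"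
  shows "2 * \<mu> * sin (exit_angle x) < chord x"
proof -
  have bw: "\<Gamma> (fst x) - \<Gamma> (exit x) = - (chord x *\<^sub>R cis (launch x))"
    using chord_vector[OF assms] by (simp add: algebra_simps)
  have "2 * \<mu> * cross (cis (\<phi> (exit x))) (\<Gamma> (fst x) - \<Gamma> (exit x)) < (norm (\<Gamma> (fst x) - \<Gamma> (exit x)))\<^sup>2"
    by (rule rolling_disc, rule \<Gamma>_neq) (use exit_spec[OF assms] in auto)
  moreover have "cross (cis (\<phi> (exit x))) (\<Gamma> (fst x) - \<Gamma> (exit x)) = chord x * sin (exit_angle x)"
    unfolding bw using sin_minus[of "exit_angle x"]
    by (simp add: cross.minus_right cross.scaleR_right cross_cis)
  moreover have "(norm (\<Gamma> (fst x) - \<Gamma> (exit x)))\<^sup>2 = chord x * chord x"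
    unfolding bw by (simp add: power2_eq_square)
  ultimately have "chord x * (2 * \<mu> * sin (exit_angle x)) < chord x * chord x"
    by (simp add: mult_ac)
  then show ?thesis using chord_pos[OF assms] by simp
qed

lemma vel_arrive:
  assumes "x \<in> open_strip"
  shows "vel x = cis (arrive x)" and arrive_gt: "\<phi> (entry x) < arrive x"
    and arrive_less: "arrive x < \<phi> (entry x) + pi"
    and center_entry: "center x = \<Gamma> (entry x) + of_real \<mu> * (\<i> * cis (arrive x))"
    and land_eq: "land x = - cos (entry_angle x)" and land_range: "land x \<in> {-1<..<1}"
proof -
  have 1: "norm (vel x) = 1"
    using entry_root[OF assms] \<mu>_pos by (simp add: vel_def norm_mult sqdist_eq_iff)
  have "cross (cis (\<phi> (entry x))) (vel x) = tdist (center x) (entry x) / \<mu>"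
    by (simp add: vel_def tdist_def cross.scaleR_right cross_ii_right)
  then have 2: "cross (cis (\<phi> (entry x))) (vel x) > 0"
    using entry_inward[OF assms] \<mu>_pos by simp
  have ar: "arrive x = \<phi> (entry x) + arccos (cis (\<phi> (entry x)) \<bullet> vel x)"
    by (simp add: arrive_def land_def)
  show v: "vel x = cis (arrive x)" and r: "\<phi> (entry x) < arrive x" "arrive x < \<phi> (entry x) + pi"
    using unit_vector_angle[OF 1 2] by (simp_all add: ar)
  show "center x = \<Gamma> (entry x) + of_real \<mu> * (\<i> * cis (arrive x))"
    unfolding v[symmetric] vel_def using \<mu>_pos by (simp add: scaleR_conv_of_real)
  show l: "land x = - cos (entry_angle x)"
    by (simp add: land_def v inner_cis)
  have "cos (entry_angle x) < cos 0" "cos pi < cos (entry_angle x)"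
    using r by (intro cos_monotone_0_pi; simp)+
  then show "land x \<in> {-1<..<1}" by (simp add: l)
qed

lemma sin_arrive_pos: "x \<in> open_strip \<Longrightarrow> 0 < sin (entry_angle x)"
  using vel_arrive[of x] by (intro sin_gt_zero) auto

text \<open>The secant of the Larmor circle through the exit and entry points has length
  \<open>2 \<mu> \<bar>S\<bar>\<close> and direction \<open>(launch x + arrive x) / 2\<close>, up to sign. Comparing it with the tangents at both
  ends and with the rolling disc yields the three hypotheses of \<open>larmor_angle_bounds\<close>.\<close>

lemma angle_bounds:
  assumes "x \<in> open_strip"
  shows arrive_less_launch: "arrive x < launch x + 2 * pi"
    and angle_close: "\<bar>(entry_angle x) - (exit_angle x)\<bar> < \<phi> (entry x) - \<phi> (exit x)"
    and arrive_less_exit: "arrive x < \<phi> (exit x) + pi"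
proof -
  define \<theta>\<^sub>1 where "\<theta>\<^sub>1 = exit_angle x"
  define \<theta>\<^sub>2 where "\<theta>\<^sub>2 = entry_angle x"
  define \<Delta> where "\<Delta> = \<phi> (entry x) - \<phi> (exit x)"
  define S where "S = sin ((\<Delta> + \<theta>\<^sub>1 + \<theta>\<^sub>2) / 2)"
  note ex = exit_spec[OF assms] and en = entry_spec[OF assms] and va = vel_arrive[OF assms]
  have \<theta>: "0 < \<theta>\<^sub>1" "\<theta>\<^sub>1 < pi" "0 < \<theta>\<^sub>2" "\<theta>\<^sub>2 < pi" and \<Delta>: "0 < \<Delta>" "\<Delta> < pi"
    using ex en va \<phi>_less[OF en(1)] by (auto simp: \<theta>\<^sub>1_def \<theta>\<^sub>2_def \<Delta>_def)
  have diff: "\<Gamma> (entry x) - \<Gamma> (exit x) = \<mu> *\<^sub>R (\<i> * cis (launch x)) - \<mu> *\<^sub>R (\<i> * cis (arrive x))"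
    using va(4) by (simp add: center_def scaleR_conv_of_real algebra_simps)
  have half: "\<mu> * (cos a - cos b) = 2 * \<mu> * sin ((a + b) / 2) * sin ((b - a) / 2)" for a b
    by (simp add: cos_diff_cos)
  have c1: "cross (cis (\<phi> (exit x))) (\<Gamma> (entry x) - \<Gamma> (exit x)) = 2 * \<mu> * (S * sin ((\<Delta> + \<theta>\<^sub>2 - \<theta>\<^sub>1) / 2))"
    using half[of "launch x - \<phi> (exit x)" "arrive x - \<phi> (exit x)"]
    by (simp add: diff cross.diff_right cross.scaleR_right cross_ii_right inner_cis S_def
        \<theta>\<^sub>1_def \<theta>\<^sub>2_def \<Delta>_def algebra_simps)
  have c2: "cross (cis (\<phi> (entry x))) (\<Gamma> (exit x) - \<Gamma> (entry x)) = 2 * \<mu> * (S * sin ((\<Delta> - \<theta>\<^sub>2 + \<theta>\<^sub>1) / 2))"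
  proof -
    have "\<Gamma> (exit x) - \<Gamma> (entry x) = \<mu> *\<^sub>R (\<i> * cis (arrive x)) - \<mu> *\<^sub>R (\<i> * cis (launch x))"
      using diff by (simp add: algebra_simps)
    then have "cross (cis (\<phi> (entry x))) (\<Gamma> (exit x) - \<Gamma> (entry x)) =
        \<mu> * (cos (entry_angle x) - cos (launch x - \<phi> (entry x)))"
      by (simp only: cross.diff_right cross.scaleR_right cross_ii_right inner_cis right_diff_distrib real_scaleR_def)
    moreover have "sin ((launch x - arrive x) / 2) = - S"
      unfolding S_def using sin_minus[of "(arrive x - launch x) / 2"]
      by (simp add: \<theta>\<^sub>1_def \<theta>\<^sub>2_def \<Delta>_def minus_divide_left)
    moreover have "sin ((arrive x + launch x - 2 * \<phi> (entry x)) / 2) = - sin ((\<Delta> - \<theta>\<^sub>2 + \<theta>\<^sub>1) / 2)"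
    proof -
      have "(arrive x + launch x - 2 * \<phi> (entry x)) / 2 = - ((\<Delta> - \<theta>\<^sub>2 + \<theta>\<^sub>1) / 2)"
        by (simp add: \<theta>\<^sub>1_def \<theta>\<^sub>2_def \<Delta>_def field_simps)
      then show ?thesis by (simp only: sin_minus)
    qed
    ultimately show ?thesis
      using half[of "entry_angle x" "launch x - \<phi> (entry x)"] by simp
  qed
  have ne: "\<Gamma> (entry x) \<noteq> \<Gamma> (exit x)" using \<Gamma>_neq[OF en(1,2)] by simp
  have nrm: "(norm (\<Gamma> (entry x) - \<Gamma> (exit x)))\<^sup>2 = 4 * \<mu>\<^sup>2 * S\<^sup>2"
  proof -
    have "(norm (\<Gamma> (entry x) - \<Gamma> (exit x)))\<^sup>2 = \<mu>\<^sup>2 * (norm (cis (launch x) - cis (arrive x)))\<^sup>2"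
    proof -
      have "\<Gamma> (entry x) - \<Gamma> (exit x) = (\<mu> * \<i>) * (cis (launch x) - cis (arrive x))"
        unfolding diff by (simp add: scaleR_conv_of_real algebra_simps)
      then show ?thesis by (simp add: norm_mult power_mult_distrib)
    qed
    also have "(norm (cis (launch x) - cis (arrive x)))\<^sup>2 = 2 - 2 * cos (arrive x - launch x)"
    proof -
      have "cos (launch x - arrive x) = cos (arrive x - launch x)"
        by (metis cos_minus minus_diff_eq)
      then show ?thesis
        by (simp add: power2_norm_eq_inner inner_diff_left inner_diff_right inner_cis)
    qed
    also have "\<dots> = 4 * S\<^sup>2"
    proof -
      have "arrive x - launch x = 2 * ((\<Delta> + \<theta>\<^sub>1 + \<theta>\<^sub>2) / 2)"
        by (simp add: \<theta>\<^sub>1_def \<theta>\<^sub>2_def \<Delta>_def)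
      then have "cos (arrive x - launch x) = cos (2 * ((\<Delta> + \<theta>\<^sub>1 + \<theta>\<^sub>2) / 2))"
        by (simp only:)
      then show ?thesis unfolding cos_double_sin S_def by simp
    qed
    finally show ?thesis by simp
  qed
  have "0 < cross (cis (\<phi> (exit x))) (\<Gamma> (entry x) - \<Gamma> (exit x))"
    by (rule \<Gamma>_left_of_tangent[OF en(1,2)])
  then have l1: "0 < S * sin ((\<Delta> + \<theta>\<^sub>2 - \<theta>\<^sub>1) / 2)"
    unfolding c1 using \<mu>_pos by (simp add: zero_less_mult_iff)
  have "0 < cross (cis (\<phi> (entry x))) (\<Gamma> (exit x + L) - \<Gamma> (entry x))"
    by (rule \<Gamma>_left_of_tangent) (use en in auto)
  then have l2: "0 < S * sin ((\<Delta> - \<theta>\<^sub>2 + \<theta>\<^sub>1) / 2)"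
    unfolding \<Gamma>_periodic c2 using \<mu>_pos by (simp add: zero_less_mult_iff)
  have "4 * \<mu>\<^sup>2 * (S * sin ((\<Delta> + \<theta>\<^sub>2 - \<theta>\<^sub>1) / 2)) < 4 * \<mu>\<^sup>2 * S\<^sup>2"
    using rolling_disc[OF ne] unfolding c1 nrm by (simp add: power2_eq_square mult_ac)
  then have r: "S * sin ((\<Delta> + \<theta>\<^sub>2 - \<theta>\<^sub>1) / 2) < S\<^sup>2"
    using \<mu>_pos by simp
  note b = larmor_angle_bounds[OF \<theta> \<Delta> l1[unfolded S_def] l2[unfolded S_def] r[unfolded S_def]]
  show "arrive x < launch x + 2 * pi"
    "\<bar>(entry_angle x) - (exit_angle x)\<bar> < \<phi> (entry x) - \<phi> (exit x)"
    "arrive x < \<phi> (exit x) + pi"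
    using b by (auto simp: \<theta>\<^sub>1_def \<theta>\<^sub>2_def \<Delta>_def)
qed

lemma launch_less_arrive: "x \<in> open_strip \<Longrightarrow> launch x < arrive x"
  using exit_spec(3)[of x] vel_arrive(2)[of x] \<phi>_less[OF entry_gt[of x]] by auto

section \<open>Derivatives of the trajectory\<close>

lemma has_derivative_\<Gamma>:
  assumes "(f has_derivative f') (at x within S)"
  shows "((\<lambda>x. \<Gamma> (f x)) has_derivative (\<lambda>h. f' h *\<^sub>R cis (\<phi> (f x)))) (at x within S)"
  using has_derivative_compose[OF assms, of \<Gamma> "\<lambda>h. h *\<^sub>R cis (\<phi> (f x))"] \<Gamma>_deriv[of "f x"]
  by (simp add: has_vector_derivative_def)

lemma has_derivative_\<phi>:
  assumes "(f has_derivative f') (at x within S)"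
  shows "((\<lambda>x. \<phi> (f x)) has_derivative (\<lambda>h. \<kappa> (f x) * f' h)) (at x within S)"
  using has_derivative_compose[OF assms, of \<phi> "\<lambda>h. \<kappa> (f x) * h"] \<phi>_deriv[of "f x"]
  by (simp add: has_field_derivative_def)

lemma open_open_strip: "open open_strip"
  unfolding open_strip_def by (intro open_Times) auto

lemma eventually_open_strip: "x \<in> open_strip \<Longrightarrow> \<forall>\<^sub>F y in nhds x. y \<in> open_strip"
  by (rule eventually_nhds_in_open[OF open_open_strip])

text \<open>The functions \<open>dlaunch\<close>, \<open>dexit\<close>, \<open>dcenter\<close>, \<open>dentry\<close>, \<open>dland\<close> and \<open>darrive\<close> give the derivatives
  of the corresponding functions at \<open>x\<close> in direction \<open>h\<close>.\<close>

definition dlaunch :: "real \<times> real \<Rightarrow> real \<times> real \<Rightarrow> real" where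
  "dlaunch x h = \<kappa> (fst x) * fst h + snd h / sin (launch_angle x)"

definition dexit :: "real \<times> real \<Rightarrow> real \<times> real \<Rightarrow> real" where
  "dexit x h = (chord x * dlaunch x h - sin (launch_angle x) * fst h) / sin (exit_angle x)"

definition dcenter :: "real \<times> real \<Rightarrow> real \<times> real \<Rightarrow> complex" where
  "dcenter x h = dexit x h *\<^sub>R cis (\<phi> (exit x)) - (\<mu> * dlaunch x h) *\<^sub>R cis (launch x)"

definition dentry :: "real \<times> real \<Rightarrow> real \<times> real \<Rightarrow> real" where
  "dentry x h = cross (dcenter x h) (cis (arrive x)) / sin (entry_angle x)"

definition dland :: "real \<times> real \<Rightarrow> real \<times> real \<Rightarrow> real" where
  "dland x h = - \<kappa> (entry x) * sin (entry_angle x) * dentry x h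
     - cross (cis (\<phi> (entry x))) (dcenter x h) / \<mu>"

lemma has_derivative_arccos_minus:
  assumes "(f has_derivative f') (at x)" "f x \<in> {-1<..<1}"
  shows "((\<lambda>x. arccos (- f x)) has_derivative (\<lambda>h. f' h / sin (arccos (- f x)))) (at x)"
proof -
  have "sin (arccos (- f x)) = sqrt (1 - (f x)\<^sup>2)" using assms(2) by (simp add: sin_arccos)
  moreover have "(arccos has_derivative (\<lambda>h. h * inverse (- sqrt (1 - (- f x)\<^sup>2)))) (at (- f x))"
    by (rule has_derivative_eq_rhs[OF DERIV_arccos[of "- f x", unfolded has_field_derivative_def]])
       (use assms(2) in auto)
  ultimately show ?thesis
    using has_derivative_compose[OF has_derivative_minus[OF assms(1)]] by (fastforce simp: field_simps)
qed

lemma launch_has_derivative: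
  assumes "x \<in> open_strip"
  shows "(launch has_derivative dlaunch x) (at x)"
proof -
  have "((\<lambda>x. arccos (- snd x)) has_derivative (\<lambda>h. snd h / sin (arccos (- snd x)))) (at x)"
    by (rule has_derivative_arccos_minus[OF has_derivative_snd[OF has_derivative_ident]])
       (use assms in \<open>auto simp: open_strip_def\<close>)
  from has_derivative_add[OF has_derivative_\<phi>[OF has_derivative_fst[OF has_derivative_ident]] this]
  show ?thesis
    by (simp add: launch_def[abs_def] dlaunch_def[abs_def])
qed

lemma exit_isCont:
  assumes "x \<in> open_strip"
  shows "isCont exit x"
proof (rule moving_root_isCont[where a = fst and L = L and H = "\<lambda>x r. cross (cis (launch x)) (\<Gamma> r - \<Gamma> (fst x))"])
  show "\<forall>\<^sub>F x in nhds x. fst x < exit x \<and> exit x < fst x + L \<and>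
      (\<forall>r. fst x < r \<and> r < exit x \<longrightarrow> cross (cis (launch x)) (\<Gamma> r - \<Gamma> (fst x)) < 0) \<and>
      (\<forall>r. exit x < r \<and> r < fst x + L \<longrightarrow> cross (cis (launch x)) (\<Gamma> r - \<Gamma> (fst x)) > 0)"
    using eventually_open_strip[OF assms] by eventually_elim (use exit_spec in auto)
  show "isCont fst x" by (intro continuous_intros)
  show "isCont (\<lambda>x. cross (cis (launch x)) (\<Gamma> r - \<Gamma> (fst x))) x" for r
    by (rule has_derivative_continuous[OF cross.FDERIV[OF
          has_derivative_cis[OF launch_has_derivative[OF assms]]
          has_derivative_diff[OF has_derivative_const has_derivative_\<Gamma>[OF has_derivative_fst[OF has_derivative_ident]]]]])
qed

lemma exit_has_derivative:
  assumes "x \<in> open_strip"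
  shows "(exit has_derivative dexit x) (at x)"
proof -
  define H' where "H' h = sin (launch_angle x) * fst h - chord x * dlaunch x h" for h
  have lin: "bounded_linear (dlaunch x)"
    using launch_has_derivative[OF assms] by (rule has_derivative_bounded_linear)
  have "(exit has_derivative (\<lambda>h. - H' h / sin (exit_angle x))) (at x)"
  proof (rule implicit_root_has_derivative[where H = "\<lambda>p. cross (cis (launch (fst p))) (\<Gamma> (snd p) - \<Gamma> (fst (fst p)))"])
    have "((\<lambda>p. cis (launch (fst p))) has_derivative (\<lambda>p. dlaunch x (fst p) *\<^sub>R (\<i> * cis (launch x)))) (at (x, exit x))"
      using has_derivative_cis[OF has_derivative_compose_fst[OF launch_has_derivative[OF assms], of "exit x"]]
      by simp
    moreover have "((\<lambda>p. \<Gamma> (snd p) - \<Gamma> (fst (fst p))) has_derivative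
        (\<lambda>p. snd p *\<^sub>R cis (\<phi> (exit x)) - fst (fst p) *\<^sub>R cis (\<phi> (fst x)))) (at (x, exit x))"
      by (rule has_derivative_eq_rhs[OF has_derivative_diff[OF has_derivative_\<Gamma>[OF has_derivative_snd[OF has_derivative_ident]]
        has_derivative_\<Gamma>[OF has_derivative_fst[OF has_derivative_fst[OF has_derivative_ident]]]]]) simp
    ultimately show "((\<lambda>p. cross (cis (launch (fst p))) (\<Gamma> (snd p) - \<Gamma> (fst (fst p)))) has_derivative
        (\<lambda>p. H' (fst p) + sin (exit_angle x) * snd p)) (at (x, exit x))"
    proof (rule has_derivative_eq_rhs[OF cross.FDERIV], intro ext)
      fix p :: "(real \<times> real) \<times> real"
      have "sin (\<phi> (fst x) - launch x) = - sin (launch_angle x)"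
        using sin_minus[of "launch_angle x"] by simp
      then show "cross (cis (launch (fst (x, exit x)))) (snd p *\<^sub>R cis (\<phi> (exit x)) - fst (fst p) *\<^sub>R cis (\<phi> (fst x))) +
          cross (dlaunch x (fst p) *\<^sub>R (\<i> * cis (launch x))) (\<Gamma> (snd (x, exit x)) - \<Gamma> (fst (fst (x, exit x)))) =
          H' (fst p) + sin (exit_angle x) * snd p"
        using chord_vector[OF assms]
        by (simp add: cross.diff_right cross.scaleR_right cross.scaleR_left cross_cis cross_ii_left inner_cis H'_def)
    qed
    show "bounded_linear H'"
      unfolding H'_def by (intro bounded_linear_sub bounded_linear_const_mult bounded_linear_fst lin)
    show "sin (exit_angle x) \<noteq> 0" using sin_exit_pos[OF assms] by simp
    show "isCont exit x" by (rule exit_isCont[OF assms])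
    show "\<forall>\<^sub>F y in nhds x. cross (cis (launch (fst (y, exit y)))) (\<Gamma> (snd (y, exit y)) - \<Gamma> (fst (fst (y, exit y)))) = 0"
      using eventually_open_strip[OF assms] by eventually_elim (simp add: exit_root)
  qed
  then show ?thesis
    by (simp add: dexit_def[abs_def] H'_def)
qed

lemma center_has_derivative:
  assumes "x \<in> open_strip"
  shows "(center has_derivative dcenter x) (at x)"
proof -
  have "((\<lambda>x. \<mu> *\<^sub>R (\<i> * cis (launch x))) has_derivative (\<lambda>h. \<mu> *\<^sub>R (\<i> * (dlaunch x h *\<^sub>R (\<i> * cis (launch x)))))) (at x)"
    by (intro has_derivative_scaleR_right has_derivative_mult_right has_derivative_cis launch_has_derivative assms)
  from has_derivative_add[OF has_derivative_\<Gamma>[OF exit_has_derivative[OF assms]] this]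
  show ?thesis
    by (simp add: center_def[abs_def] dcenter_def[abs_def] scaleR_conv_of_real algebra_simps)
qed

lemma entry_isCont:
  assumes "x \<in> open_strip"
  shows "isCont entry x"
proof (rule moving_root_isCont[where a = exit and L = L and H = "\<lambda>x r. (norm (\<Gamma> r - center x))\<^sup>2 - \<mu>\<^sup>2"])
  show "\<forall>\<^sub>F x in nhds x. exit x < entry x \<and> entry x < exit x + L \<and>
      (\<forall>r. exit x < r \<and> r < entry x \<longrightarrow> (norm (\<Gamma> r - center x))\<^sup>2 - \<mu>\<^sup>2 < 0) \<and>
      (\<forall>r. entry x < r \<and> r < exit x + L \<longrightarrow> (norm (\<Gamma> r - center x))\<^sup>2 - \<mu>\<^sup>2 > 0)"
    using eventually_open_strip[OF assms]
    by eventually_elim (use entry_spec in \<open>auto simp: sqdist_def\<close>)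
  show "isCont exit x" by (rule exit_isCont[OF assms])
  show "isCont (\<lambda>x. (norm (\<Gamma> r - center x))\<^sup>2 - \<mu>\<^sup>2) x" for r
    using has_derivative_continuous[OF center_has_derivative[OF assms]] by (intro continuous_intros)
qed

lemma entry_has_derivative:
  assumes "x \<in> open_strip"
  shows "(entry has_derivative dentry x) (at x)"
proof -
  define H' where "H' h = - (2 * \<mu> * cross (dcenter x h) (cis (arrive x)))" for h
  define c where "c = 2 * \<mu> * sin (entry_angle x)"
  note va = vel_arrive[OF assms]
  have lin: "bounded_linear (dcenter x)"
    using center_has_derivative[OF assms] by (rule has_derivative_bounded_linear)
  have "(entry has_derivative (\<lambda>h. - H' h / c)) (at x)"
  proof (rule implicit_root_has_derivative[where H = "\<lambda>p. (norm (\<Gamma> (snd p) - center (fst p)))\<^sup>2 - \<mu>\<^sup>2"])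
    have d: "((\<lambda>p. \<Gamma> (snd p) - center (fst p)) has_derivative
        (\<lambda>p. snd p *\<^sub>R cis (\<phi> (entry x)) - dcenter x (fst p))) (at (x, entry x))"
    proof -
      note has_derivative_diff[OF has_derivative_\<Gamma>[OF has_derivative_snd[OF has_derivative_ident]]
          has_derivative_compose_fst[OF center_has_derivative[OF assms]], of "entry x"]
      then
      show ?thesis by simp
    qed
    have "((\<lambda>p. (\<Gamma> (snd p) - center (fst p)) \<bullet> (\<Gamma> (snd p) - center (fst p)) - \<mu>\<^sup>2) has_derivative
        (\<lambda>p. H' (fst p) + c * snd p)) (at (x, entry x))"
    proof (rule has_derivative_eq_rhs[OF has_derivative_diff[OF has_derivative_inner[OF d d] has_derivative_const]], intro ext)
      fix p :: "(real \<times> real) \<times> real"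
      define W where "W = snd p *\<^sub>R cis (\<phi> (entry x)) - dcenter x (fst p)"
      have "\<Gamma> (entry x) - center x = (- \<mu>) *\<^sub>R (\<i> * cis (arrive x))"
        using va(4) by (simp add: scaleR_conv_of_real)
      then have normal: "(\<Gamma> (entry x) - center x) \<bullet> W = - \<mu> * cross (cis (arrive x)) W"
        by (simp only: inner_scaleR_left inner_ii_left)
      have "cross (cis (arrive x)) (cis (\<phi> (entry x))) = - sin (entry_angle x)"
        using sin_minus[of "entry_angle x"] by (simp add: cross_cis)
      then have cW: "cross (cis (arrive x)) W =
          - snd p * sin (entry_angle x) + cross (dcenter x (fst p)) (cis (arrive x))"
        using cross_commute[of "cis (arrive x)" "dcenter x (fst p)"]
        by (simp add: W_def cross.diff_right cross.scaleR_right)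
      then show "(\<Gamma> (snd (x, entry x)) - center (fst (x, entry x))) \<bullet> (snd p *\<^sub>R cis (\<phi> (entry x)) - dcenter x (fst p)) +
          (snd p *\<^sub>R cis (\<phi> (entry x)) - dcenter x (fst p)) \<bullet> (\<Gamma> (snd (x, entry x)) - center (fst (x, entry x))) - 0 =
          H' (fst p) + c * snd p"
        unfolding W_def[symmetric] fst_conv snd_conv inner_commute[of W "\<Gamma> (entry x) - center x"] normal cW
        by (simp add: H'_def c_def algebra_simps)
    qed
    then show "((\<lambda>p. (norm (\<Gamma> (snd p) - center (fst p)))\<^sup>2 - \<mu>\<^sup>2) has_derivative
        (\<lambda>p. H' (fst p) + c * snd p)) (at (x, entry x))"
      by (simp only: power2_norm_eq_inner)
    show "bounded_linear H'"
      unfolding H'_def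
      by (intro bounded_linear_minus bounded_linear_const_mult bounded_linear_compose[OF cross.bounded_linear_left lin])
    show "c \<noteq> 0" using sin_arrive_pos[OF assms] \<mu>_pos by (simp add: c_def)
    show "isCont entry x" by (rule entry_isCont[OF assms])
    show "\<forall>\<^sub>F y in nhds x. (norm (\<Gamma> (snd (y, entry y)) - center (fst (y, entry y))))\<^sup>2 - \<mu>\<^sup>2 = 0"
      using eventually_open_strip[OF assms]
      by eventually_elim (use entry_root in \<open>simp add: sqdist_def\<close>)
  qed
  then show ?thesis
    using \<mu>_pos by (simp add: dentry_def[abs_def] H'_def c_def)
qed

lemma land_has_derivative:
  assumes "x \<in> open_strip"
  shows "(land has_derivative dland x) (at x)"
proof -
  note va = vel_arrive[OF assms]
  have d1: "((\<lambda>x. cis (\<phi> (entry x))) has_derivative (\<lambda>h. (\<kappa> (entry x) * dentry x h) *\<^sub>R (\<i> * cis (\<phi> (entry x))))) (at x)"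
    by (intro has_derivative_cis has_derivative_\<phi> entry_has_derivative assms)
  have d2: "(vel has_derivative (\<lambda>h. (1 / \<mu>) *\<^sub>R (\<i> * (dentry x h *\<^sub>R cis (\<phi> (entry x)) - dcenter x h)))) (at x)"
    unfolding vel_def[abs_def]
    by (intro has_derivative_scaleR_right has_derivative_mult_right has_derivative_diff has_derivative_\<Gamma>
        entry_has_derivative center_has_derivative assms)
  show ?thesis
    unfolding land_def[abs_def]
  proof (rule has_derivative_eq_rhs[OF has_derivative_minus[OF has_derivative_inner[OF d1 d2]]], intro ext)
    fix h
    show "- (cis (\<phi> (entry x)) \<bullet> ((1 / \<mu>) *\<^sub>R (\<i> * (dentry x h *\<^sub>R cis (\<phi> (entry x)) - dcenter x h))) +
        ((\<kappa> (entry x) * dentry x h) *\<^sub>R (\<i> * cis (\<phi> (entry x)))) \<bullet> vel x) = dland x h"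
      unfolding va(1) dland_def
      by (simp add: inner_ii_right inner_ii_left cross_cis cross.diff_right cross.scaleR_right algebra_simps)
  qed
qed

definition darrive :: "real \<times> real \<Rightarrow> real \<times> real \<Rightarrow> real" where
  "darrive x h = \<kappa> (entry x) * dentry x h + dland x h / sin (entry_angle x)"

lemma arrive_has_derivative:
  assumes "x \<in> open_strip"
  shows "(arrive has_derivative darrive x) (at x)"
proof -
  have "((\<lambda>x. arccos (- land x)) has_derivative (\<lambda>h. dland x h / sin (arccos (- land x)))) (at x)"
    by (intro has_derivative_arccos_minus land_has_derivative vel_arrive assms)
  from has_derivative_add[OF has_derivative_\<phi>[OF entry_has_derivative[OF assms]] this]
  show ?thesis
    by (simp add: arrive_def[abs_def] darrive_def[abs_def])
qed

lemma darrive_eq: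
  assumes "x \<in> open_strip"
  shows "darrive x h = - cross (cis (\<phi> (entry x))) (dcenter x h) / (\<mu> * sin (entry_angle x))"
  using sin_arrive_pos[OF assms] \<mu>_pos by (simp add: darrive_def dland_def field_simps)

lemma chord_has_derivative:
  assumes "x \<in> open_strip"
  shows "(chord has_derivative
    (\<lambda>h. dexit x h * cos (exit_angle x) - fst h * cos (launch_angle x))) (at x)"
proof -
  have d1: "((\<lambda>x. cis (launch x)) has_derivative (\<lambda>h. dlaunch x h *\<^sub>R (\<i> * cis (launch x)))) (at x)"
    by (intro has_derivative_cis launch_has_derivative assms)
  have d2: "((\<lambda>x. \<Gamma> (exit x) - \<Gamma> (fst x)) has_derivative
      (\<lambda>h. dexit x h *\<^sub>R cis (\<phi> (exit x)) - fst h *\<^sub>R cis (\<phi> (fst x)))) (at x)"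
    by (intro has_derivative_diff has_derivative_\<Gamma> exit_has_derivative assms has_derivative_fst has_derivative_ident)
  show ?thesis
    unfolding chord_def[abs_def]
  proof (rule has_derivative_eq_rhs[OF has_derivative_inner[OF d1 d2]], intro ext)
    fix h
    have "cos (\<phi> (fst x) - launch x) = cos (launch_angle x)"
      by (metis cos_minus minus_diff_eq)
    then show "cis (launch x) \<bullet> (dexit x h *\<^sub>R cis (\<phi> (exit x)) - fst h *\<^sub>R cis (\<phi> (fst x))) +
        (dlaunch x h *\<^sub>R (\<i> * cis (launch x))) \<bullet> (\<Gamma> (exit x) - \<Gamma> (fst x)) =
        dexit x h * cos (exit_angle x) - fst h * cos (launch_angle x)"
      unfolding chord_vector[OF assms]
      by (simp add: inner_diff_right inner_cis inner_ii_left cross.scaleR_right)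
  qed
qed

text \<open>Rotating the initial velocity moves the Larmor center, and the entry point advances because of
  \<open>twist_inequality\<close>.\<close>

lemma twist_positive:
  assumes "x \<in> open_strip"
  shows "0 < dentry x (0, 1)"
proof -
  \<comment> \<open>The derivative of the launch direction with respect to \<open>u\<close>.\<close>
  define d where "d = 1 / sin (launch_angle x)"
  define \<theta> where "\<theta> = exit_angle x"
  have d: "d > 0" using sin_launch_pos[OF assms] by (simp add: d_def)
  have s: "sin \<theta> > 0" using sin_exit_pos[OF assms] by (simp add: \<theta>_def)
  have "\<mu> * sin \<theta> * sin ((arrive x - \<phi> (exit x)) + \<theta>) < chord x * sin (arrive x - \<phi> (exit x))"
  proof (rule twist_inequality)
    show "0 < \<theta>" using exit_spec[OF assms] by (simp add: \<theta>_def)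
    show "\<theta> < arrive x - \<phi> (exit x)" using angle_close[OF assms] by (auto simp: \<theta>_def)
    show "arrive x - \<phi> (exit x) < pi" using arrive_less_exit[OF assms] by simp
    show "2 * \<mu> * sin \<theta> < chord x" using chord_gt[OF assms] by (simp add: \<theta>_def)
  qed (rule \<mu>_pos)
  then have "\<mu> * sin (arrive x - launch x) < chord x / sin \<theta> * sin (arrive x - \<phi> (exit x))"
    using s by (simp add: \<theta>_def field_simps)
  moreover have "cross (dcenter x (0, 1)) (cis (arrive x)) =
      d * (chord x / sin \<theta> * sin (arrive x - \<phi> (exit x)) - \<mu> * sin (arrive x - launch x))"
    by (simp add: dcenter_def dexit_def dlaunch_def d_def \<theta>_def cross.diff_left cross.scaleR_left cross_cis algebra_simps)
  ultimately show ?thesis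
    using d sin_arrive_pos[OF assms] by (simp add: dentry_def)
qed

text \<open>Both sides are \<open>- 1 / \<mu>\<close> times the area spanned by the two displacements of the Larmor center.\<close>

lemma area_preserving:
  assumes "x \<in> open_strip"
  shows "dentry x v * dland x w - dland x v * dentry x w = fst v * snd w - snd v * fst w"
proof -
  define S where "S = sin (entry_angle x)"
  define t where "t = cis (\<phi> (entry x))"
  define v2 where "v2 = cis (arrive x)"
  have S: "S > 0" using sin_arrive_pos[OF assms] by (simp add: S_def)
  have S0: "sin (launch_angle x) > 0" and S1: "sin (exit_angle x) > 0"
    using sin_launch_pos[OF assms] sin_exit_pos[OF assms] .
  have tv: "cross t v2 = S" by (simp add: t_def v2_def S_def cross_cis)
  have "dentry x v * dland x w - dland x v * dentry x w =
      - (cross (dcenter x v) v2 * cross t (dcenter x w) - cross t (dcenter x v) * cross (dcenter x w) v2) / (\<mu> * S)"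
    using S \<mu>_pos by (simp add: dentry_def dland_def S_def[symmetric] t_def v2_def field_simps)
  also have "\<dots> = - cross (dcenter x v) (dcenter x w) / \<mu>"
    unfolding cross_cross_identity tv using S by simp
  also have "\<dots> = fst v * snd w - snd v * fst w"
  proof -
    have "cross (dcenter x v) (dcenter x w) = \<mu> * (sin (exit_angle x) * dexit x v * dlaunch x w
        - dlaunch x v * (sin (exit_angle x) * dexit x w))"
      using sin_minus[of "exit_angle x"]
      by (simp add: dcenter_def cross.diff_left cross.diff_right cross.scaleR_left cross.scaleR_right cross_cis algebra_simps)
    moreover have "sin (exit_angle x) * dexit x h =
        chord x * dlaunch x h - sin (launch_angle x) * fst h" for h
      using S1 by (simp add: dexit_def)
    ultimately have "cross (dcenter x v) (dcenter x w) =
        \<mu> * ((chord x * dlaunch x v - sin (launch_angle x) * fst v) * dlaunch x w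
          - dlaunch x v * (chord x * dlaunch x w - sin (launch_angle x) * fst w))"
      by (simp only:)
    then have area: "- cross (dcenter x v) (dcenter x w) / \<mu> =
        sin (launch_angle x) * (fst v * dlaunch x w - dlaunch x v * fst w)"
      using \<mu>_pos by (simp add: field_simps)
    show ?thesis
      unfolding area using S0 by (simp add: dlaunch_def field_simps)
  qed
  finally show ?thesis .
qed

section \<open>The area outside the table\<close>

text \<open>The zeros of \<open>sqdist z - \<mu>\<^sup>2\<close> are isolated: at a zero that is not simple the second derivative is
  positive by \<open>tdist_deriv_ge\<close>.\<close>

lemma finite_circle_boundary: "finite (sphere z \<mu> \<inter> frontier \<Omega>)"
proof -
  define B where "B = {r. sqdist z r = \<mu>\<^sup>2}"
  have no_limit: "\<not> t islimpt B" for t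
  proof (cases "sqdist z t = \<mu>\<^sup>2")
    case False
    have "closed B"
      unfolding B_def
      using continuous_closed_preimage_constant[of UNIV "sqdist z" "\<mu>\<^sup>2"] sqdist_deriv
      by (auto intro: DERIV_isCont continuous_at_imp_continuous_on)
    then show ?thesis using False by (auto simp: closed_limpt B_def)
  next
    case True
    have "\<exists>d>0. \<forall>h. 0 < h \<and> h < d \<longrightarrow> sqdist z (t + h) \<noteq> sqdist z t \<and> sqdist z (t - h) \<noteq> sqdist z t"
    proof (cases "tdist z t" "0 :: real" rule: linorder_cases)
      case less
      then obtain d d' where "d > 0" "\<And>h. 0 < h \<Longrightarrow> h < d \<Longrightarrow> sqdist z (t + h) < sqdist z t"
        "d' > 0" "\<And>h. 0 < h \<Longrightarrow> h < d' \<Longrightarrow> sqdist z t < sqdist z (t - h)"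
        using DERIV_neg_dec_right[OF sqdist_deriv[of z t]] DERIV_neg_dec_left[OF sqdist_deriv[of z t]] by auto
      then show ?thesis by (intro exI[of _ "min d d'"]) fastforce
    next
      case greater
      then obtain d d' where "d > 0" "\<And>h. 0 < h \<Longrightarrow> h < d \<Longrightarrow> sqdist z t < sqdist z (t + h)"
        "d' > 0" "\<And>h. 0 < h \<Longrightarrow> h < d' \<Longrightarrow> sqdist z (t - h) < sqdist z t"
        using DERIV_pos_inc_right[OF sqdist_deriv[of z t]] DERIV_pos_inc_left[OF sqdist_deriv[of z t]] by auto
      then show ?thesis by (intro exI[of _ "min d d'"]) fastforce
    next
      case equal
      have "norm (\<Gamma> t - z) \<le> \<mu>" using True sqdist_le_iff[of z t] by simp
      then have "0 < 1 + \<kappa> t * cross (cis (\<phi> t)) (\<Gamma> t - z)"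
        using tdist_deriv_ge[of t z] q_less by linarith
      then obtain d d' where d: "d > 0" "\<And>h. 0 < h \<Longrightarrow> h < d \<Longrightarrow> 0 < tdist z (t + h)"
        "d' > 0" "\<And>h. 0 < h \<Longrightarrow> h < d' \<Longrightarrow> tdist z (t - h) < 0"
        using DERIV_pos_inc_right[OF tdist_deriv[of z t]] DERIV_pos_inc_left[OF tdist_deriv[of z t]] equal by auto
      have cont: "continuous_on A (sqdist z)" for A
        using sqdist_deriv by (meson DERIV_isCont continuous_at_imp_continuous_on)
      show ?thesis
      proof (intro exI[of _ "min d d'"] conjI allI impI)
        fix h assume h: "0 < h \<and> h < min d d'"
        have "sqdist z t < sqdist z (t + h)"
        proof (rule DERIV_pos_imp_increasing_open[where f = "sqdist z"])
          fix r assume "t < r" "r < t + h"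
          then have "0 < tdist z r" using d(2)[of "r - t"] h by simp
          then show "\<exists>y. (sqdist z has_real_derivative y) (at r) \<and> 0 < y"
            using sqdist_deriv[of z r] by (intro exI[of _ "2 * tdist z r"]) auto
        qed (use h cont in auto)
        then show "sqdist z (t + h) \<noteq> sqdist z t" by simp
        have "sqdist z t < sqdist z (t - h)"
        proof (rule DERIV_neg_imp_decreasing_open[where f = "sqdist z"])
          fix r assume "t - h < r" "r < t"
          then have "tdist z r < 0" using d(4)[of "t - r"] h by simp
          then show "\<exists>y. (sqdist z has_real_derivative y) (at r) \<and> y < 0"
            using sqdist_deriv[of z r] by (intro exI[of _ "2 * tdist z r"]) auto
        qed (use h cont in auto)
        then show "sqdist z (t - h) \<noteq> sqdist z t" by simp
      qed (use d in auto)
    qed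
    then obtain d where d: "d > 0"
      "\<And>h. 0 < h \<Longrightarrow> h < d \<Longrightarrow> sqdist z (t + h) \<noteq> \<mu>\<^sup>2 \<and> sqdist z (t - h) \<noteq> \<mu>\<^sup>2"
      using True by auto
    show ?thesis
    proof
      assume "t islimpt B"
      then obtain y where y: "y \<in> B" "y \<noteq> t" "dist y t < d"
        using d(1) by (auto simp: islimpt_approachable)
      then show False
        using d(2)[of "y - t"] d(2)[of "t - y"] by (cases "y < t") (auto simp: B_def dist_real_def)
    qed
  qed
  have "finite ({0..L} \<inter> B)"
    by (rule finite_not_islimpt_in_compact) (use no_limit in auto)
  then have "finite (\<Gamma> ` ({0..L} \<inter> B))" by (rule finite_imageI)
  moreover have "sphere z \<mu> \<inter> frontier \<Omega> \<subseteq> \<Gamma> ` ({0..L} \<inter> B)"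
  proof
    fix p assume p: "p \<in> sphere z \<mu> \<inter> frontier \<Omega>"
    then obtain r where r: "p = \<Gamma> r" using frontier_table by auto
    obtain n where n: "0 < r + of_int n * L" "r + of_int n * L \<le> 0 + L"
      by (rule shift_into_period)
    have "norm (\<Gamma> r - z) = \<mu>" using p r by (simp add: dist_norm norm_minus_commute)
    then have "r + of_int n * L \<in> {0..L} \<inter> B"
      using n by (simp add: B_def sqdist_eq_iff \<Gamma>_period_int)
    then show "p \<in> \<Gamma> ` ({0..L} \<inter> B)"
      using r \<Gamma>_period_int[of r n] by (metis image_eqI)
  qed
  ultimately show ?thesis by (rule finite_subset[rotated])
qed

text \<open>The point of the Larmor circle where the velocity has direction \<open>\<psi>\<close>.\<close>

definition larmor_point :: "real \<times> real \<Rightarrow> real \<Rightarrow> complex" where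
  "larmor_point x \<psi> = center x - of_real \<mu> * (\<i> * cis \<psi>)"

lemma larmor_point_launch: "larmor_point x (launch x) = \<Gamma> (exit x)"
  by (simp add: larmor_point_def center_def)

lemma larmor_point_arrive: "x \<in> open_strip \<Longrightarrow> larmor_point x (arrive x) = \<Gamma> (entry x)"
  using vel_arrive(4)[of x] by (simp add: larmor_point_def)

lemma larmor_point_eq_iff: "larmor_point x a = larmor_point x b \<longleftrightarrow> cis a = cis b"
  using \<mu>_pos by (simp add: larmor_point_def)

lemma larmor_point_not_frontier:
  assumes x: "x \<in> open_strip" and \<psi>: "launch x < \<psi>" "\<psi> < launch x + 2 * pi" "\<psi> \<noteq> arrive x"
  shows "larmor_point x \<psi> \<notin> frontier \<Omega>"
proof
  assume "larmor_point x \<psi> \<in> frontier \<Omega>"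
  then obtain r' where r': "larmor_point x \<psi> = \<Gamma> r'" using frontier_table by auto
  obtain n where n: "exit x < r' + of_int n * L" "r' + of_int n * L \<le> exit x + L"
    by (rule shift_into_period)
  define r where "r = r' + of_int n * L"
  have r: "larmor_point x \<psi> = \<Gamma> r" by (simp add: r_def r' \<Gamma>_period_int)
  have "norm (\<Gamma> r - center x) = \<mu>"
    using \<mu>_pos by (simp add: r[symmetric] larmor_point_def norm_mult)
  then have sq: "sqdist (center x) r = \<mu>\<^sup>2" by (simp add: sqdist_eq_iff)
  have "r = entry x \<or> r = exit x + L"
    using before_entry[OF x, of r] after_entry[OF x, of r] sq n unfolding r_def[symmetric]
    by (metis less_irrefl linorder_neqE_linordered_idom order_le_less)
  then show False
  proof
    assume "r = entry x"
    then have "cis \<psi> = cis (arrive x)"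
      using r larmor_point_arrive[OF x] larmor_point_eq_iff by metis
    then have "\<psi> = arrive x"
      by (rule cis_eq_imp_eq)
         (use \<psi> arrive_less_launch[OF x] launch_less_arrive[OF x] in \<open>auto simp: abs_if\<close>)
    then show False using \<psi> by simp
  next
    assume "r = exit x + L"
    then have "cis \<psi> = cis (launch x)"
      using r larmor_point_launch[of x] \<Gamma>_periodic larmor_point_eq_iff by metis
    then have "\<psi> = launch x"
      by (rule cis_eq_imp_eq) (use \<psi> in auto)
    then show False using \<psi> by simp
  qed
qed

lemma continuous_on_larmor_point: "continuous_on A (larmor_point x)"
  unfolding larmor_point_def[abs_def] by (intro continuous_intros)

lemma larmor_arc_side:
  assumes "{a<..<b} \<subseteq> {launch x<..<launch x + 2 * pi} - {arrive x}" "x \<in> open_strip"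
    and "c \<in> {a<..<b}" "d \<in> {a<..<b}"
  shows "larmor_point x c \<in> \<Omega> \<longleftrightarrow> larmor_point x d \<in> \<Omega>"
proof -
  have "connected (larmor_point x ` {a<..<b})"
    by (intro connected_continuous_image continuous_on_larmor_point) auto
  moreover have "larmor_point x ` {a<..<b} \<inter> frontier \<Omega> = {}"
    using larmor_point_not_frontier[OF assms(2)] assms(1) by fastforce
  ultimately have "larmor_point x ` {a<..<b} \<inter> \<Omega> = {} \<or> larmor_point x ` {a<..<b} - \<Omega> = {}"
    using connected_Int_frontier by blast
  then show ?thesis using assms(3,4) by blast
qed

text \<open>The open arc avoids the boundary, so it suffices to look at one of its points: where the velocity is
  parallel to the tangent at the exit point, the particle is to the right of that tangent.\<close>

lemma larmor_arc_outside:
  assumes x: "x \<in> open_strip" and \<psi>: "launch x < \<psi>" "\<psi> < arrive x"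
  shows "larmor_point x \<psi> \<notin> \<Omega>"
proof -
  have mid: "launch x < \<phi> (exit x)" "\<phi> (exit x) < arrive x"
    using exit_spec(3)[OF x] vel_arrive(2)[OF x] \<phi>_less[OF entry_gt[OF x]] by auto
  have "larmor_point x (\<phi> (exit x)) \<notin> \<Omega>"
  proof
    assume "larmor_point x (\<phi> (exit x)) \<in> \<Omega>"
    then have "0 < cross (cis (\<phi> (exit x))) (larmor_point x (\<phi> (exit x)) - \<Gamma> (exit x))"
      by (rule left_of_tangents)
    also have "larmor_point x (\<phi> (exit x)) - \<Gamma> (exit x) =
        \<mu> *\<^sub>R (\<i> * cis (launch x)) - \<mu> *\<^sub>R (\<i> * cis (\<phi> (exit x)))"
      by (simp add: larmor_point_def center_def scaleR_conv_of_real)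
    also have "cross (cis (\<phi> (exit x))) \<dots> = \<mu> * (cos (exit_angle x) - 1)"
      using cos_minus[of "exit_angle x"]
      by (simp add: cross.diff_right cross.scaleR_right cross_ii_right inner_cis right_diff_distrib)
    finally have "cos (exit_angle x) > 1" using \<mu>_pos by (simp add: zero_less_mult_iff)
    then show False using cos_le_one[of "exit_angle x"] by simp
  qed
  moreover have "{launch x<..<arrive x} \<subseteq> {launch x<..<launch x + 2 * pi} - {arrive x}"
    by (rule subsetI) (use arrive_less_launch[OF x] in auto)
  ultimately show ?thesis
    using larmor_arc_side[OF _ x, of "launch x" "arrive x" \<psi> "\<phi> (exit x)"] \<psi> mid by simp
qed

text \<open>Otherwise the whole Larmor circle would avoid \<open>\<Omega>\<close>. As \<open>\<Omega>\<close> is connected and comes close to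
  boundary points inside the Larmor disc, it would be contained in this disc, which contradicts
  \<open>after_entry\<close>.\<close>

lemma larmor_arc_inside:
  assumes x: "x \<in> open_strip" and \<psi>: "arrive x < \<psi>" "\<psi> < launch x + 2 * pi"
  shows "larmor_point x \<psi> \<in> \<Omega>"
proof (rule ccontr)
  assume out: "larmor_point x \<psi> \<notin> \<Omega>"
  have arc: "larmor_point x c \<notin> \<Omega>" if "arrive x < c" "c < launch x + 2 * pi" for c
  proof -
    have "{arrive x<..<launch x + 2 * pi} \<subseteq> {launch x<..<launch x + 2 * pi} - {arrive x}"
      by (rule subsetI) (use launch_less_arrive[OF x] in auto)
    then show ?thesis
      using larmor_arc_side[OF _ x, of "arrive x" "launch x + 2 * pi" c \<psi>] \<psi> that out by simp
  qed
  have fr: "\<Gamma> r \<notin> \<Omega>" for r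
    using frontier_table open_table frontier_def interior_open by (metis Diff_iff rangeI)
  have circle: "larmor_point x c \<notin> \<Omega>" if "launch x \<le> c" "c < launch x + 2 * pi" for c
    using arc[of c] larmor_arc_outside[OF x, of c] that larmor_point_launch[of x] larmor_point_arrive[OF x] fr
    by (metis less_eq_real_def linorder_neqE_linordered_idom)
  have "sphere (center x) \<mu> \<inter> \<Omega> = {}"
  proof -
    have "p \<notin> \<Omega>" if "p \<in> sphere (center x) \<mu>" for p
    proof -
      define w where "w = (center x - p) / (of_real \<mu> * \<i>)"
      have "norm w = 1" using that \<mu>_pos by (simp add: w_def norm_divide norm_mult dist_norm)
      then obtain t where t: "w = cis t" by (metis complex_norm_eq_1_exp cis_conv_exp)
      define n where "n = \<lfloor>(t - launch x) / (2 * pi)\<rfloor>"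
      define c where "c = t - of_int n * (2 * pi)"
      have "of_int n \<le> (t - launch x) / (2 * pi)" "(t - launch x) / (2 * pi) < of_int n + 1"
        unfolding n_def by linarith+
      then have c: "launch x \<le> c" "c < launch x + 2 * pi" by (simp_all add: c_def field_simps)
      have "cis c = cis t" by (simp add: cis_eq_iff c_def rcong_altdef)
      then have "larmor_point x c = p"
        using t \<mu>_pos by (simp add: larmor_point_def w_def field_simps)
      then show ?thesis using circle[OF c] by simp
    qed
    then show ?thesis by blast
  qed
  then have "\<Omega> \<inter> frontier (ball (center x) \<mu>) = {}"
    using \<mu>_pos by auto
  then have dich: "\<Omega> \<inter> ball (center x) \<mu> = {} \<or> \<Omega> - ball (center x) \<mu> = {}"
    using connected_Int_frontier[OF connected_table] by blast
  have cl: "\<Gamma> r \<in> closure \<Omega>" for r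
    using frontier_table frontier_def by (metis Diff_iff rangeI)
  obtain r where r: "exit x < r" "r < entry x" using dense[OF entry_gt[OF x]] by auto
  have "\<Gamma> r \<in> ball (center x) \<mu>"
    using before_entry[OF x r] by (simp add: sqdist_less_iff dist_norm norm_minus_commute)
  then have "\<Omega> \<inter> ball (center x) \<mu> \<noteq> {}"
    using cl[of r] by (metis open_Int_closure_eq_empty open_ball disjoint_iff inf_commute)
  then have "\<Omega> \<subseteq> cball (center x) \<mu>" using dich by auto
  then have "closure \<Omega> \<subseteq> cball (center x) \<mu>" by (intro closure_minimal) auto
  moreover obtain r' where r': "entry x < r'" "r' < exit x + L" using dense[OF entry_less[OF x]] by auto
  ultimately have "norm (\<Gamma> r' - center x) \<le> \<mu>"
    using cl[of r'] by (auto simp: dist_norm norm_minus_commute)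
  then show False
    using after_entry[OF x r'] sqdist_le_iff[of "center x" r'] by simp
qed

lemma outside_area_has_derivative:
  assumes x: "x \<in> open_strip"
  shows "(outside_area \<Omega> \<mu> has_derivative (\<lambda>h. \<mu> * ((cis (launch x) - cis (arrive x)) \<bullet> h))) (at (center x))"
proof -
  have pt: "center x + of_real \<mu> * cis t = larmor_point x (t + pi / 2)" for t
    by (simp add: larmor_point_def complex_eq_iff sin_add cos_add)
  have "(outside_area \<Omega> \<mu> has_derivative
    (\<lambda>h. Re h * (\<mu> * (sin (arrive x - pi / 2) - sin (launch x - pi / 2))) +
         Im h * (\<mu> * (cos (launch x - pi / 2) - cos (arrive x - pi / 2))))) (at (center x))"
  proof (rule has_derivative_outside_area[OF open_table \<mu>_pos finite_circle_boundary], unfold pt)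
    show "larmor_point x (t + pi / 2) \<notin> \<Omega>" if "launch x - pi / 2 < t" "t < arrive x - pi / 2" for t
      by (rule larmor_arc_outside[OF x]) (use that in auto)
    show "larmor_point x (t + pi / 2) \<in> \<Omega>" if "arrive x - pi / 2 < t" "t < launch x - pi / 2 + 2 * pi" for t
      by (rule larmor_arc_inside[OF x]) (use that in auto)
  qed (use launch_less_arrive[OF x] arrive_less_launch[OF x] in auto)
  then show ?thesis
    by (rule has_derivative_eq_rhs)
       (auto simp: fun_eq_iff inner_complex_def sin_diff cos_diff algebra_simps)
qed

section \<open>The action\<close>

text \<open>The value of the generating function along the trajectory of \<open>x\<close>.\<close>

definition action :: "real \<times> real \<Rightarrow> real" where
  "action x = - chord x - \<mu> * (arrive x - launch x) + (1 / \<mu>) * outside_area \<Omega> \<mu> (center x)"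

text \<open>The center is displaced by \<open>dcenter x h\<close>, whose components along the two directions of the velocity
  (\<open>i1\<close>, \<open>i2\<close>) turn the flux formula into derivatives at the exit and at the entry point. The terms at the
  exit point cancel against those of the chord, and the angular terms against the length of the arc.\<close>

lemma action_has_derivative:
  assumes x: "x \<in> open_strip"
  shows "(action has_derivative (\<lambda>h. land x * dentry x h - snd x * fst h)) (at x)"
proof -
  have area: "((\<lambda>x. outside_area \<Omega> \<mu> (center x)) has_derivative
      (\<lambda>h. \<mu> * ((cis (launch x) - cis (arrive x)) \<bullet> dcenter x h))) (at x)"
    using has_derivative_compose[OF center_has_derivative[OF x]] outside_area_has_derivative[OF x] by fastforce
  show ?thesis
    unfolding action_def[abs_def]
  proof (rule has_derivative_eq_rhs[OF has_derivative_add[OF has_derivative_diff[OF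
          has_derivative_minus[OF chord_has_derivative[OF x]]
          has_derivative_mult_right[OF has_derivative_diff[OF arrive_has_derivative[OF x] launch_has_derivative[OF x]]]]
          has_derivative_mult_right[OF area]]], intro ext)
    fix h
    define S where "S = sin (entry_angle x)"
    define c where "c = cos (entry_angle x)"
    have S: "S > 0" using sin_arrive_pos[OF x] by (simp add: S_def)
    have i1: "cis (launch x) \<bullet> dcenter x h = dexit x h * cos (exit_angle x) - \<mu> * dlaunch x h"
      by (simp add: dcenter_def inner_diff_right inner_cis)
    have "cross (cis (\<phi> (entry x))) w = S * (cis (arrive x) \<bullet> w) + c * cross (cis (arrive x)) w" for w
    proof -
      have "cross (cis (arrive x - (entry_angle x))) w =
          sin (entry_angle x) * (cis (arrive x) \<bullet> w) + cos (entry_angle x) * cross (cis (arrive x)) w"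
        unfolding cross_def inner_complex_def cis.simps complex.sel cnj.sel times_complex.sel
          cos_diff[of "arrive x" "arrive x - _"] sin_diff[of "arrive x" "arrive x - _"]
        by (simp add: algebra_simps)
      then show ?thesis by (simp add: S_def c_def)
    qed
    then have "S * (cis (arrive x) \<bullet> dcenter x h) = cross (cis (\<phi> (entry x))) (dcenter x h) + c * (S * dentry x h)"
      using cross_commute[of "cis (arrive x)" "dcenter x h"] S by (simp add: dentry_def S_def[symmetric])
    also have "cross (cis (\<phi> (entry x))) (dcenter x h) = - \<mu> * S * darrive x h"
      using darrive_eq[OF x, of h] S \<mu>_pos by (simp add: S_def[symmetric])
    finally have "S * (cis (arrive x) \<bullet> dcenter x h) = S * (c * dentry x h - \<mu> * darrive x h)"
      by (simp add: algebra_simps)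
    then have i2: "cis (arrive x) \<bullet> dcenter x h = c * dentry x h - \<mu> * darrive x h"
      using S by simp
    have "land x = - c" "snd x = - cos (launch_angle x)"
      using vel_arrive(5)[OF x] cos_launch[OF x] by (simp_all add: c_def)
    then show "- (dexit x h * cos (exit_angle x) - fst h * cos (launch_angle x)) -
        \<mu> * (darrive x h - dlaunch x h) +
        1 / \<mu> * (\<mu> * ((cis (launch x) - cis (arrive x)) \<bullet> dcenter x h)) =
        land x * dentry x h - snd x * fst h"
      using \<mu>_pos by (simp add: inner_diff_left i1 i2 algebra_simps)
  qed
qed

section \<open>Trajectories as hitting times\<close>

lemma tangent_eq: "tangent \<Gamma> s = cis (\<phi> s)"
  unfolding tangent_def by (rule vector_derivative_at[OF \<Gamma>_deriv])

lemma inward_velocity_eq: "inward_velocity \<Gamma> s u = cis (launch (s, u))"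
  by (simp add: inward_velocity_def tangent_eq launch_def cis_mult add.commute)

lemma chord_length_eq:
  assumes x: "(s, u) \<in> open_strip"
  shows "chord_length \<Omega> \<Gamma> s u = chord (s, u)"
proof -
  have "{t. 0 < t \<and> \<Gamma> s + of_real t * cis (launch (s, u)) \<in> frontier \<Omega>} = {chord (s, u)}"
  proof (intro equalityI subsetI)
    fix t assume "t \<in> {chord (s, u)}"
    then have "\<Gamma> s + of_real t * cis (launch (s, u)) = \<Gamma> (exit (s, u))"
      using chord_vector[OF x] by (simp add: scaleR_conv_of_real algebra_simps)
    then show "t \<in> {t. 0 < t \<and> \<Gamma> s + of_real t * cis (launch (s, u)) \<in> frontier \<Omega>}"
      using \<open>t \<in> _\<close> chord_pos[OF x] frontier_table by auto
  next
    fix t assume "t \<in> {t. 0 < t \<and> \<Gamma> s + of_real t * cis (launch (s, u)) \<in> frontier \<Omega>}"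
    then obtain r' where t: "0 < t" and r': "\<Gamma> s + of_real t * cis (launch (s, u)) = \<Gamma> r'"
      using frontier_table by auto
    obtain n where n: "s < r' + of_int n * L" "r' + of_int n * L \<le> s + L"
      by (rule shift_into_period)
    define r where "r = r' + of_int n * L"
    have r: "\<Gamma> r - \<Gamma> s = t *\<^sub>R cis (launch (s, u))"
      unfolding r_def \<Gamma>_period_int r'[symmetric] by (simp add: scaleR_conv_of_real)
    then have zero: "cross (cis (launch (s, u))) (\<Gamma> r - \<Gamma> s) = 0"
      by (simp add: cross.scaleR_right)
    have "r \<noteq> s + L" using r t by (auto simp: \<Gamma>_periodic)
    then have "s < r" "r < s + L" using n by (auto simp: r_def)
    then have "r = exit (s, u)"
      using before_exit[OF x, of r] after_exit[OF x, of r] zero by (metis fst_conv less_irrefl linorder_neqE_linordered_idom)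
    then have "t *\<^sub>R cis (launch (s, u)) = chord (s, u) *\<^sub>R cis (launch (s, u))"
      using r chord_vector[OF x] by simp
    then show "t \<in> {chord (s, u)}" by simp
  qed
  then show ?thesis
    by (simp add: chord_length_def hitting_time_def inward_velocity_eq)
qed

lemma exit_point_eq:
  assumes x: "(s, u) \<in> open_strip"
  shows "exit_point \<Omega> \<Gamma> s u = \<Gamma> (exit (s, u))"
  using chord_vector[OF x]
  by (simp add: exit_point_def chord_length_eq[OF x] inward_velocity_eq scaleR_conv_of_real algebra_simps)

lemma larmor_center_eq: "(s, u) \<in> open_strip \<Longrightarrow> larmor_center \<Omega> \<Gamma> \<mu> s u = center (s, u)"
  by (simp add: larmor_center_def exit_point_eq inward_velocity_eq center_def mult.assoc)

lemma larmor_path_eq: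
  assumes x: "(s, u) \<in> open_strip"
  shows "larmor_path \<Omega> \<Gamma> \<mu> s u t = larmor_point (s, u) (launch (s, u) + t / \<mu>)"
proof -
  have "\<Gamma> (exit (s, u)) - center (s, u) = - (of_real \<mu> * (\<i> * cis (launch (s, u))))"
    by (simp add: center_def)
  then show ?thesis
    by (simp add: larmor_path_def larmor_center_eq[OF x] exit_point_eq[OF x] larmor_point_def
        mult.assoc cis_mult)
qed

lemma arc_length_eq:
  assumes x: "(s, u) \<in> open_strip"
  shows "arc_length \<Omega> \<Gamma> \<mu> s u = \<mu> * (arrive (s, u) - launch (s, u))"
  unfolding arc_length_def hitting_time_def larmor_path_eq[OF x]
proof (rule cInf_eq_minimum)
  show "\<mu> * (arrive (s, u) - launch (s, u)) \<in>
      {t. 0 < t \<and> larmor_point (s, u) (launch (s, u) + t / \<mu>) \<in> frontier \<Omega>}"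
    using launch_less_arrive[OF x] larmor_point_arrive[OF x] \<mu>_pos frontier_table by auto
  fix t assume "t \<in> {t. 0 < t \<and> larmor_point (s, u) (launch (s, u) + t / \<mu>) \<in> frontier \<Omega>}"
  then have t: "0 < t" "larmor_point (s, u) (launch (s, u) + t / \<mu>) \<in> frontier \<Omega>" by auto
  show "\<mu> * (arrive (s, u) - launch (s, u)) \<le> t"
  proof (rule ccontr)
    assume "\<not> \<mu> * (arrive (s, u) - launch (s, u)) \<le> t"
    then have "t / \<mu> < arrive (s, u) - launch (s, u)" using \<mu>_pos by (simp add: field_simps)
    moreover have "0 < t / \<mu>" using t \<mu>_pos by simp
    ultimately show False
      using larmor_point_not_frontier[OF x, of "launch (s, u) + t / \<mu>"] t arrive_less_launch[OF x] by auto
  qed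
qed

lemma return_point_eq:
  assumes x: "(s, u) \<in> open_strip"
  shows "return_point \<Omega> \<Gamma> \<mu> s u = \<Gamma> (entry (s, u))"
proof -
  have "launch (s, u) + \<mu> * (arrive (s, u) - launch (s, u)) / \<mu> = arrive (s, u)"
    using \<mu>_pos by simp
  then show ?thesis
    by (simp only: return_point_def larmor_path_eq[OF x] arc_length_eq[OF x] larmor_point_arrive[OF x])
qed

lemma return_velocity_eq:
  assumes x: "(s, u) \<in> open_strip"
  shows "return_velocity \<Omega> \<Gamma> \<mu> s u = cis (arrive (s, u))"
  unfolding return_velocity_def
proof (rule vector_derivative_at)
  define a where "a = arc_length \<Omega> \<Gamma> \<mu> s u"
  have "((\<lambda>t. cis (launch (s, u) + t / \<mu>)) has_derivative
      (\<lambda>h. (h / \<mu>) *\<^sub>R (\<i> * cis (launch (s, u) + a / \<mu>)))) (at a)"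
    using has_derivative_cis[OF has_derivative_add[OF has_derivative_const
        bounded_linear.has_derivative[OF bounded_linear_divide has_derivative_ident]]] by simp
  then have "((\<lambda>t. center (s, u) - of_real \<mu> * (\<i> * cis (launch (s, u) + t / \<mu>))) has_derivative
      (\<lambda>h. 0 - of_real \<mu> * (\<i> * ((h / \<mu>) *\<^sub>R (\<i> * cis (launch (s, u) + a / \<mu>)))))) (at a)"
    by (intro has_derivative_diff has_derivative_const has_derivative_mult_right)
  moreover have "launch (s, u) + a / \<mu> = arrive (s, u)"
    using \<mu>_pos by (simp add: a_def arc_length_eq[OF x])
  moreover have "larmor_path \<Omega> \<Gamma> \<mu> s u = (\<lambda>t. center (s, u) - of_real \<mu> * (\<i> * cis (launch (s, u) + t / \<mu>)))"
    using larmor_path_eq[OF x] by (auto simp: larmor_point_def)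
  moreover have "(\<lambda>h. 0 - of_real \<mu> * (\<i> * ((h / \<mu>) *\<^sub>R (\<i> * cis (arrive (s, u)))))) =
      (\<lambda>h. h *\<^sub>R cis (arrive (s, u)))"
    using \<mu>_pos by (auto simp: fun_eq_iff complex_eq_iff)
  ultimately show "(larmor_path \<Omega> \<Gamma> \<mu> s u has_vector_derivative cis (arrive (s, u))) (at (arc_length \<Omega> \<Gamma> \<mu> s u))"
    unfolding has_vector_derivative_def a_def[symmetric] by simp
qed

lemma outer_area_eq:
  assumes x: "(s, u) \<in> open_strip"
  shows "outer_area \<Omega> \<Gamma> \<mu> s u = outside_area \<Omega> \<mu> (center (s, u))"
  using open_table by (simp add: outer_area_def outside_area_def larmor_center_eq[OF x] measure_completion)

lemma action_eq:
  assumes x: "(s, u) \<in> open_strip"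
  shows "action (s, u) = - chord_length \<Omega> \<Gamma> s u - arc_length \<Omega> \<Gamma> \<mu> s u + (1 / \<mu>) * outer_area \<Omega> \<Gamma> \<mu> s u"
  by (simp add: action_def chord_length_eq[OF x] arc_length_eq[OF x] outer_area_eq[OF x])

lemma rmod_eq_shift: "\<exists>n::int. s rmod L = s + of_int n * L"
  using L_pos by (intro exI[of _ "- \<lfloor>s / L\<rfloor>"]) (simp add: rmod_def)

lemma \<Gamma>_rmod [simp]: "\<Gamma> (s rmod L) = \<Gamma> s"
  using rmod_eq_shift[of s] \<Gamma>_period_int by metis

lemma tangent_rmod [simp]: "cis (\<phi> (s rmod L)) = cis (\<phi> s)"
proof -
  obtain n where "s rmod L = s + of_int n * L" using rmod_eq_shift by blast
  then show ?thesis
    by (simp add: \<phi>_turn_int complex_eq_iff sin_add cos_add)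
qed

lemma boundary_param_eq: "boundary_param L \<Gamma> (\<Gamma> s) = s rmod L"
  unfolding boundary_param_def
proof (rule the_equality)
  show "s rmod L \<in> {0..<L} \<and> \<Gamma> (s rmod L) = \<Gamma> s"
    using L_pos by (simp add: rmod_nonneg rmod_less)
  fix t assume t: "t \<in> {0..<L} \<and> \<Gamma> t = \<Gamma> s"
  have "s rmod L \<in> {0..<L}" using L_pos by (simp add: rmod_nonneg rmod_less)
  then show "t = s rmod L"
    using \<Gamma>_neq[of t "s rmod L"] \<Gamma>_neq[of "s rmod L" t] t
    by (cases t "s rmod L" rule: linorder_cases) auto
qed

lemma return_map_rmod:
  "return_map \<Omega> L \<Gamma> \<mu> (s rmod L, u) = (if \<bar>u\<bar> = 1 then (s rmod L, u) else return_map \<Omega> L \<Gamma> \<mu> (s, u))"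
proof -
  have iv: "inward_velocity \<Gamma> (s rmod L) u = inward_velocity \<Gamma> s u"
    by (simp add: inward_velocity_def tangent_eq)
  have cl: "chord_length \<Omega> \<Gamma> (s rmod L) u = chord_length \<Omega> \<Gamma> s u"
    by (simp add: chord_length_def iv)
  have ep: "exit_point \<Omega> \<Gamma> (s rmod L) u = exit_point \<Omega> \<Gamma> s u"
    by (simp add: exit_point_def iv cl)
  have lp: "larmor_path \<Omega> \<Gamma> \<mu> (s rmod L) u = larmor_path \<Omega> \<Gamma> \<mu> s u"
    by (simp add: larmor_path_def larmor_center_def ep iv fun_eq_iff)
  show ?thesis
    by (simp add: return_map_def return_point_def return_velocity_def arc_length_def lp)
qed

lemma return_map_eq:
  assumes x: "(s, u) \<in> open_strip"
  shows "return_map \<Omega> L \<Gamma> \<mu> (s, u) = (entry (s, u) rmod L, land (s, u))"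
proof -
  have "\<bar>u\<bar> \<noteq> 1" using x by (auto simp: open_strip_def)
  moreover have "- (cis (arrive (s, u)) \<bullet> cis (\<phi> (entry (s, u)))) = land (s, u)"
    using vel_arrive(1)[OF x] by (simp add: land_def inner_commute)
  ultimately show ?thesis
    by (simp add: return_map_def return_point_eq[OF x] return_velocity_eq[OF x] boundary_param_eq tangent_eq Let_def)
qed

section \<open>The lift of the return map\<close>

lemma shift_open_strip: "(s + L, u) \<in> open_strip \<longleftrightarrow> (s, u) \<in> open_strip"
  by (simp add: open_strip_def)

text \<open>The parameters of exit and entry are determined by a sign pattern, which is invariant under shifting
  the initial parameter by a period.\<close>

lemma sign_change_unique:
  fixes \<sigma> \<tau> :: real
  assumes "a < \<sigma>" "\<sigma> < b" "\<And>r. a < r \<Longrightarrow> r < \<sigma> \<Longrightarrow> H r < 0" "\<And>r. \<sigma> < r \<Longrightarrow> r < b \<Longrightarrow> H r > (0::real)"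
    and "a < \<tau>" "\<tau> < b" "\<And>r. a < r \<Longrightarrow> r < \<tau> \<Longrightarrow> H r < 0" "\<And>r. \<tau> < r \<Longrightarrow> r < b \<Longrightarrow> H r > 0"
  shows "\<sigma> = \<tau>"
proof (rule ccontr)
  assume "\<sigma> \<noteq> \<tau>"
  then obtain r where "\<sigma> < r \<and> r < \<tau> \<or> \<tau> < r \<and> r < \<sigma>"
    using dense[of \<sigma> \<tau>] dense[of \<tau> \<sigma>] by (metis linorder_neqE_linordered_idom)
  then show False using assms by (smt (verit))
qed

lemma launch_shift: "launch (s + L, u) = launch (s, u) + 2 * pi"
  by (simp add: launch_def \<phi>_turn)

lemma cis_shift: "cis (a + 2 * pi) = cis a"
  by (simp add: cis.code)

lemma \<Gamma>_minus_L: "\<Gamma> (r - L) = \<Gamma> r"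
  using \<Gamma>_periodic[of "r - L"] by simp

lemma exit_shift:
  assumes x: "(s, u) \<in> open_strip"
  shows "exit (s + L, u) = exit (s, u) + L"
proof (rule sign_change_unique[where H = "\<lambda>r. cross (cis (launch (s, u))) (\<Gamma> r - \<Gamma> s)" and a = "s + L" and b = "s + L + L"])
  have x': "(s + L, u) \<in> open_strip" using x by (simp only: shift_open_strip)
  show "s + L < exit (s + L, u)" "exit (s + L, u) < s + L + L" using exit_spec[OF x'] by auto
  show "cross (cis (launch (s, u))) (\<Gamma> r - \<Gamma> s) < 0" if "s + L < r" "r < exit (s + L, u)" for r
    using before_exit[OF x', of r] that by (simp add: launch_shift cis_shift \<Gamma>_periodic)
  show "cross (cis (launch (s, u))) (\<Gamma> r - \<Gamma> s) > 0" if "exit (s + L, u) < r" "r < s + L + L" for r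
    using after_exit[OF x', of r] that by (simp add: launch_shift cis_shift \<Gamma>_periodic)
  show "s + L < exit (s, u) + L" "exit (s, u) + L < s + L + L" using exit_spec[OF x] by auto
  show "cross (cis (launch (s, u))) (\<Gamma> r - \<Gamma> s) < 0" if "s + L < r" "r < exit (s, u) + L" for r
    using before_exit[OF x, of "r - L"] that by (simp add: \<Gamma>_minus_L)
  show "cross (cis (launch (s, u))) (\<Gamma> r - \<Gamma> s) > 0" if "exit (s, u) + L < r" "r < s + L + L" for r
    using after_exit[OF x, of "r - L"] that by (simp add: \<Gamma>_minus_L)
qed

lemma center_shift: "(s, u) \<in> open_strip \<Longrightarrow> center (s + L, u) = center (s, u)"
  by (simp add: center_def exit_shift launch_shift cis_shift \<Gamma>_periodic)

lemma sqdist_minus_L: "sqdist z (r - L) = sqdist z r"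
  by (simp add: sqdist_def \<Gamma>_minus_L)

lemma entry_shift:
  assumes x: "(s, u) \<in> open_strip"
  shows "entry (s + L, u) = entry (s, u) + L"
proof (rule sign_change_unique[where H = "\<lambda>r. sqdist (center (s, u)) r - \<mu>\<^sup>2" and a = "exit (s, u) + L" and b = "exit (s, u) + L + L"])
  have x': "(s + L, u) \<in> open_strip" using x by (simp only: shift_open_strip)
  show "exit (s, u) + L < entry (s + L, u)" "entry (s + L, u) < exit (s, u) + L + L"
    using entry_spec[OF x'] exit_shift[OF x] by auto
  show "sqdist (center (s, u)) r - \<mu>\<^sup>2 < 0" if "exit (s, u) + L < r" "r < entry (s + L, u)" for r
    using before_entry[OF x', of r] that by (simp add: exit_shift[OF x] center_shift[OF x])
  show "sqdist (center (s, u)) r - \<mu>\<^sup>2 > 0" if "entry (s + L, u) < r" "r < exit (s, u) + L + L" for r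
    using after_entry[OF x', of r] that by (simp add: exit_shift[OF x] center_shift[OF x])
  show "exit (s, u) + L < entry (s, u) + L" "entry (s, u) + L < exit (s, u) + L + L"
    using entry_spec[OF x] by auto
  show "sqdist (center (s, u)) r - \<mu>\<^sup>2 < 0" if "exit (s, u) + L < r" "r < entry (s, u) + L" for r
    using before_entry[OF x, of "r - L"] that by (simp add: sqdist_minus_L)
  show "sqdist (center (s, u)) r - \<mu>\<^sup>2 > 0" if "entry (s, u) + L < r" "r < exit (s, u) + L + L" for r
    using after_entry[OF x, of "r - L"] that by (simp add: sqdist_minus_L)
qed

lemma land_shift: "(s, u) \<in> open_strip \<Longrightarrow> land (s + L, u) = land (s, u)"
  by (simp add: land_def vel_def entry_shift center_shift \<phi>_turn cis_shift \<Gamma>_periodic)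

lemma action_shift:
  assumes x: "(s, u) \<in> open_strip"
  shows "action (s + L, u) = action (s, u)"
  using x by (simp add: action_def chord_def arrive_def land_shift entry_shift exit_shift launch_shift
      center_shift \<phi>_turn cis_shift \<Gamma>_periodic)

text \<open>Grazing trajectories with \<open>u = 1\<close> are the limit of chords that return to their starting point after a full
  period, hence the shift by \<open>L\<close>.\<close>

definition lift :: "real \<times> real \<Rightarrow> real \<times> real" where
  "lift x = (if snd x \<le> - 1 then x else if 1 \<le> snd x then (fst x + L, snd x) else (entry x, land x))"

lemma lift_open_strip: "x \<in> open_strip \<Longrightarrow> lift x = (entry x, land x)"
  by (auto simp: lift_def open_strip_def)

lemma launch_isCont_strip: "x \<in> strip \<Longrightarrow> (launch \<longlongrightarrow> launch x) (at x within strip)"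
proof -
  assume x: "x \<in> strip"
  have "continuous_on strip (\<lambda>x. \<phi> (fst x) + arccos (- snd x))"
    by (intro continuous_intros continuous_on_compose2[of UNIV \<phi> _ fst] continuous_on_compose2[OF continuous_on_arccos'])
       (auto simp: strip_def \<phi>_isCont intro!: continuous_at_imp_continuous_on continuous_intros)
  then show ?thesis
    using x by (simp add: launch_def[abs_def] continuous_on_def)
qed

text \<open>By \<open>entry_near\<close> the boundary arc between exit and entry shrinks as the exit angle tends to \<open>0\<close> or \<open>\<pi>\<close>, and by
  \<open>angle_close\<close> the entry angle then has the same limit as the exit angle.\<close>

lemma boundary_limit:
  assumes s0: "x\<^sub>0 \<in> strip" and exit_lim: "(exit \<longlongrightarrow> e) (at x\<^sub>0 within open_strip)"
    and sin0: "sin (\<phi> e - launch x\<^sub>0) = 0" and cos0: "- cos (\<phi> e - launch x\<^sub>0) = u"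
  shows "((\<lambda>x. (entry x, land x)) \<longlongrightarrow> (e, u)) (at x\<^sub>0 within open_strip)"
proof -
  have ev: "\<forall>\<^sub>F x in at x\<^sub>0 within open_strip. x \<in> open_strip"
    by (simp add: eventually_at_filter)
  have "open_strip \<subseteq> strip" by (auto simp: open_strip_def strip_def)
  then have launch_lim: "(launch \<longlongrightarrow> launch x\<^sub>0) (at x\<^sub>0 within open_strip)"
    using launch_isCont_strip[OF s0] by (rule tendsto_within_subset[rotated])
  have \<phi>_lim: "((\<lambda>x. \<phi> (f x)) \<longlongrightarrow> \<phi> e) (at x\<^sub>0 within open_strip)" if "(f \<longlongrightarrow> e) (at x\<^sub>0 within open_strip)" for f
    using isCont_tendsto_compose[OF \<phi>_isCont that] .
  have \<theta>1: "((\<lambda>x. exit_angle x) \<longlongrightarrow> \<phi> e - launch x\<^sub>0) (at x\<^sub>0 within open_strip)"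
    by (intro tendsto_diff \<phi>_lim exit_lim launch_lim)
  have "((\<lambda>x. 2 * \<mu> * sin (exit_angle x) / (1 - q)) \<longlongrightarrow> 2 * \<mu> * sin (\<phi> e - launch x\<^sub>0) / (1 - q)) (at x\<^sub>0 within open_strip)"
    using q_less by (intro tendsto_intros \<theta>1) auto
  then have bound_lim: "((\<lambda>x. 2 * \<mu> * sin (exit_angle x) / (1 - q)) \<longlongrightarrow> 0) (at x\<^sub>0 within open_strip)"
    unfolding sin0 by simp
  have "((\<lambda>x. entry x - exit x) \<longlongrightarrow> 0) (at x\<^sub>0 within open_strip)"
  proof (rule tendsto_sandwich[OF _ _ tendsto_const bound_lim])
    show "\<forall>\<^sub>F x in at x\<^sub>0 within open_strip. 0 \<le> entry x - exit x"
      using ev by eventually_elim (use entry_gt in \<open>auto simp: less_imp_le\<close>)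
    show "\<forall>\<^sub>F x in at x\<^sub>0 within open_strip. entry x - exit x \<le> 2 * \<mu> * sin (exit_angle x) / (1 - q)"
      using ev
    proof eventually_elim
      case (elim x)
      then show ?case using entry_near[OF elim] q_less by (simp add: field_simps)
    qed
  qed
  from tendsto_add[OF exit_lim this] have entry_lim: "(entry \<longlongrightarrow> e) (at x\<^sub>0 within open_strip)" by simp
  have \<Delta>: "((\<lambda>x. \<phi> (entry x) - \<phi> (exit x)) \<longlongrightarrow> 0) (at x\<^sub>0 within open_strip)"
    using tendsto_diff[OF \<phi>_lim[OF entry_lim] \<phi>_lim[OF exit_lim]] by simp
  have "((\<lambda>x. (entry_angle x) - (exit_angle x)) \<longlongrightarrow> 0) (at x\<^sub>0 within open_strip)"
    by (rule Lim_null_comparison[OF _ \<Delta>])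
       (use ev angle_close in \<open>auto elim!: eventually_mono simp: less_imp_le\<close>)
  from tendsto_add[OF this \<theta>1]
  have "((\<lambda>x. entry_angle x) \<longlongrightarrow> \<phi> e - launch x\<^sub>0) (at x\<^sub>0 within open_strip)" by simp
  then have "((\<lambda>x. - cos (entry_angle x)) \<longlongrightarrow> - cos (\<phi> e - launch x\<^sub>0)) (at x\<^sub>0 within open_strip)"
    by (rule tendsto_minus[OF tendsto_cos])
  then have "(land \<longlongrightarrow> u) (at x\<^sub>0 within open_strip)"
    unfolding cos0 by (rule Lim_transform_eventually) (use ev vel_arrive(5) in \<open>auto elim!: eventually_mono\<close>)
  then show ?thesis by (intro tendsto_Pair entry_lim)
qed

lemma chord_sign_tendsto:
  assumes "x\<^sub>0 \<in> strip"
  shows "((\<lambda>x. cross (cis (launch x)) (\<Gamma> r - \<Gamma> (fst x))) \<longlongrightarrow>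
    cross (cis (launch x\<^sub>0)) (\<Gamma> r - \<Gamma> (fst x\<^sub>0))) (at x\<^sub>0 within open_strip)"
proof -
  have "open_strip \<subseteq> strip" by (auto simp: open_strip_def strip_def)
  then have l: "(launch \<longlongrightarrow> launch x\<^sub>0) (at x\<^sub>0 within open_strip)"
    using launch_isCont_strip[OF assms] by (rule tendsto_within_subset[rotated])
  have "((\<lambda>x. cis (launch x)) \<longlongrightarrow> cis (launch x\<^sub>0)) (at x\<^sub>0 within open_strip)"
    by (rule isCont_tendsto_compose[OF has_derivative_continuous[OF has_derivative_cis[OF has_derivative_ident]] l])
  moreover have "((\<lambda>x. \<Gamma> (fst x)) \<longlongrightarrow> \<Gamma> (fst x\<^sub>0)) (at x\<^sub>0 within open_strip)"
    by (rule isCont_tendsto_compose[OF \<Gamma>_isCont]) (intro tendsto_intros)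
  ultimately show ?thesis
    by (intro cross.tendsto tendsto_diff tendsto_const)
qed

text \<open>For small positive \<open>u + 1\<close>, a fixed boundary point after \<open>\<Gamma> s\<close> lies to the left of the chord's line, so
  it comes after the exit point.\<close>

lemma exit_lower_limit: "(exit \<longlongrightarrow> s) (at (s, -1) within open_strip)"
proof (rule order_tendstoI)
  have ev: "\<forall>\<^sub>F x in at (s, -1) within open_strip. x \<in> open_strip"
    by (simp add: eventually_at_filter)
  have fst: "(fst \<longlongrightarrow> s) (at (s, -1) within open_strip)"
    using tendsto_fst[OF tendsto_ident_at[of "(s, -1)" open_strip]] by simp
  fix c assume c: "c < s"
  show "\<forall>\<^sub>F x in at (s, -1) within open_strip. c < exit x"
    using order_tendstoD(1)[OF fst c] ev by eventually_elim (use exit_gt in force)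
next
  have ev: "\<forall>\<^sub>F x in at (s, -1) within open_strip. x \<in> open_strip"
    by (simp add: eventually_at_filter)
  have fst: "(fst \<longlongrightarrow> s) (at (s, -1) within open_strip)"
    using tendsto_fst[OF tendsto_ident_at[of "(s, -1)" open_strip]] by simp
  fix c assume "s < c"
  then obtain r where r: "s < r" "r < min c (s + L)" using dense[of s "min c (s + L)"] L_pos by auto
  have "0 < cross (cis (launch (s, -1))) (\<Gamma> r - \<Gamma> (fst (s, -1)))"
    using \<Gamma>_left_of_tangent[of s r] r by (simp add: launch_def)
  then have "\<forall>\<^sub>F x in at (s, -1) within open_strip. 0 < cross (cis (launch x)) (\<Gamma> r - \<Gamma> (fst x))"
    by (rule order_tendstoD(1)[OF chord_sign_tendsto, rotated]) (simp add: strip_def)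
  moreover have "\<forall>\<^sub>F x in at (s, -1) within open_strip. fst x < r"
    by (rule order_tendstoD(2)[OF fst r(1)])
  ultimately show "\<forall>\<^sub>F x in at (s, -1) within open_strip. exit x < c"
    using ev
  proof eventually_elim
    case (elim x)
    then show ?case using before_exit[of x r] exit_root[of x] r
      by (metis less_irrefl linorder_neqE_linordered_idom min_less_iff_conj order_less_trans)
  qed
qed

lemma exit_upper_limit: "(exit \<longlongrightarrow> s + L) (at (s, 1) within open_strip)"
proof (rule order_tendstoI)
  have ev: "\<forall>\<^sub>F x in at (s, 1) within open_strip. x \<in> open_strip"
    by (simp add: eventually_at_filter)
  have fst: "((\<lambda>x. fst x + L) \<longlongrightarrow> s + L) (at (s, 1) within open_strip)"
    using tendsto_fst[OF tendsto_ident_at[of "(s, 1)" open_strip]] by (intro tendsto_intros) simp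
  fix c assume c: "s + L < c"
  show "\<forall>\<^sub>F x in at (s, 1) within open_strip. exit x < c"
    using order_tendstoD(2)[OF fst c] ev by eventually_elim (use exit_less in force)
next
  have ev: "\<forall>\<^sub>F x in at (s, 1) within open_strip. x \<in> open_strip"
    by (simp add: eventually_at_filter)
  have fst: "((\<lambda>x. fst x + L) \<longlongrightarrow> s + L) (at (s, 1) within open_strip)"
    using tendsto_fst[OF tendsto_ident_at[of "(s, 1)" open_strip]] by (intro tendsto_intros) simp
  fix c assume "c < s + L"
  then obtain r where r: "max c s < r" "r < s + L" using dense[of "max c s" "s + L"] L_pos by auto
  have "cis (\<phi> s + pi) = - cis (\<phi> s)" by (simp add: complex_eq_iff)
  then have "cross (cis (launch (s, 1))) (\<Gamma> r - \<Gamma> (fst (s, 1))) < 0"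
    using \<Gamma>_left_of_tangent[of s r] r by (simp add: launch_def cross.minus_left)
  then have "\<forall>\<^sub>F x in at (s, 1) within open_strip. cross (cis (launch x)) (\<Gamma> r - \<Gamma> (fst x)) < 0"
    by (rule order_tendstoD(2)[OF chord_sign_tendsto, rotated]) (simp add: strip_def)
  moreover have "\<forall>\<^sub>F x in at (s, 1) within open_strip. r < fst x + L"
    by (rule order_tendstoD(1)[OF fst r(2)])
  ultimately show "\<forall>\<^sub>F x in at (s, 1) within open_strip. c < exit x"
    using ev
  proof eventually_elim
    case (elim x)
    then show ?case using after_exit[of x r] exit_root[of x] r
      by (metis less_irrefl linorder_neqE_linordered_idom max_less_iff_conj order_less_trans)
  qed
qed

lemma lift_has_derivative:
  assumes x: "x \<in> open_strip"
  shows "(lift has_derivative (\<lambda>h. (dentry x h, dland x h))) (at x)"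
  by (rule has_derivative_transform_within_open[OF has_derivative_Pair[OF entry_has_derivative[OF x]
        land_has_derivative[OF x]] open_open_strip x])
     (simp add: lift_open_strip)

lemma strip_decomp: "strip = open_strip \<union> (UNIV \<times> {-1} \<union> UNIV \<times> {1})"
  by (auto simp: strip_def open_strip_def)

lemma lift_tendsto_strip:
  assumes x: "x\<^sub>0 \<in> strip"
  shows "(lift \<longlongrightarrow> lift x\<^sub>0) (at x\<^sub>0 within strip)"
proof -
  obtain s u where su: "x\<^sub>0 = (s, u)" by (cases x\<^sub>0)
  have far: "at (s, v) within (UNIV \<times> {w}) = bot" if "v \<noteq> w" for v w :: real
  proof -
    have "closed (UNIV \<times> {w} :: (real \<times> real) set)" by (intro closed_Times) auto
    then show ?thesis
      using that unfolding trivial_limit_def[symmetric] trivial_limit_within closed_limpt by auto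
  qed
  have edge: "(lift \<longlongrightarrow> lift (s, w)) (at (s, w) within (UNIV \<times> {w}))" if w: "w = -1 \<or> w = 1" for w
  proof -
    define c where "c = (if w = 1 then L else 0)"
    have lim: "((\<lambda>x. (fst x + c, snd x)) \<longlongrightarrow> (fst (s, w) + c, snd (s, w))) (at (s, w) within (UNIV \<times> {w}))"
      by (intro tendsto_intros)
    have ev: "\<forall>\<^sub>F x in at (s, w) within (UNIV \<times> {w}). (fst x + c, snd x) = lift x"
      unfolding eventually_at_filter using w by (intro always_eventually) (auto simp: lift_def c_def)
    have val: "(fst (s, w) + c, snd (s, w)) = lift (s, w)" using w by (auto simp: lift_def c_def)
    show ?thesis using Lim_transform_eventually[OF lim ev] unfolding val .
  qed
  have inner: "(lift \<longlongrightarrow> lift x\<^sub>0) (at x\<^sub>0 within open_strip)"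
  proof (cases "x\<^sub>0 \<in> open_strip")
    case True
    then show ?thesis
      using has_derivative_continuous[OF lift_has_derivative] continuous_at_imp_continuous_at_within continuous_within by blast
  next
    case False
    then consider "u = -1" | "u = 1" using x by (auto simp: su strip_def open_strip_def)
    then have "((\<lambda>x. (entry x, land x)) \<longlongrightarrow> lift x\<^sub>0) (at x\<^sub>0 within open_strip)"
    proof cases
      case 1
      then show ?thesis
        unfolding su lift_def by (auto intro!: boundary_limit[OF _ exit_lower_limit] simp: strip_def launch_def)
    next
      case 2
      then show ?thesis
        unfolding su lift_def by (auto intro!: boundary_limit[OF _ exit_upper_limit] simp: strip_def launch_def \<phi>_turn)
    qed
    then show ?thesis
      by (rule Lim_transform_eventually) (auto simp: eventually_at_filter lift_open_strip)
  qed
  show ?thesis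
    unfolding strip_decomp Lim_within_Un
  proof (intro conjI inner)
    show "(lift \<longlongrightarrow> lift x\<^sub>0) (at x\<^sub>0 within (UNIV \<times> {-1}))"
      using edge[of "-1"] far[of u "-1"] unfolding su by (cases "u = -1") auto
    show "(lift \<longlongrightarrow> lift x\<^sub>0) (at x\<^sub>0 within (UNIV \<times> {1}))"
      using edge[of 1] far[of u 1] unfolding su by (cases "u = 1") auto
  qed
qed

lemma lift_in_strip: "x \<in> strip \<Longrightarrow> lift x \<in> strip"
  using vel_arrive(6)[of x] by (auto simp: strip_def open_strip_def lift_def mem_Times_iff)

lemma is_lift_lift: "is_lift L (return_map \<Omega> L \<Gamma> \<mu>) lift"
  unfolding is_lift_def
proof (intro conjI ballI)
  show "continuous_on strip lift" unfolding continuous_on_def using lift_tendsto_strip by blast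
  show "lift \<in> strip \<rightarrow> strip" using lift_in_strip by blast
  fix x assume x: "x \<in> strip"
  obtain s u where su: "x = (s, u)" by (cases x)
  have L: "(s + L) rmod L = s rmod L"
    using rmod_add[of s L L] by simp
  show "cover_proj L (lift x) = return_map \<Omega> L \<Gamma> \<mu> (cover_proj L x)"
  proof (cases "x \<in> open_strip")
    case True
    then have "\<bar>u\<bar> \<noteq> 1" by (auto simp: su open_strip_def)
    then show ?thesis
      using True by (simp add: su cover_proj_def lift_open_strip return_map_rmod return_map_eq)
  next
    case False
    then have "u = -1 \<or> u = 1" using x by (auto simp: su strip_def open_strip_def)
    then show ?thesis
      using L by (auto simp: su cover_proj_def lift_def return_map_rmod)
  qed
qed

lemma lift_shift: "(s, u) \<in> strip \<Longrightarrow> lift (s + L, u) = lift (s, u) + (L, 0)"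
  by (cases "(s, u) \<in> open_strip")
     (auto simp: lift_open_strip shift_open_strip entry_shift land_shift lift_def strip_def open_strip_def)

lemma return_map_annulus: "return_map \<Omega> L \<Gamma> \<mu> \<in> annulus L \<rightarrow> annulus L"
proof
  fix x assume x: "x \<in> annulus L"
  obtain s u where su: "x = (s, u)" by (cases x)
  show "return_map \<Omega> L \<Gamma> \<mu> x \<in> annulus L"
  proof (cases "(s, u) \<in> open_strip")
    case True
    then show ?thesis
      using vel_arrive(6)[OF True] L_pos
      by (auto simp: su return_map_eq annulus_def rmod_nonneg rmod_less)
  next
    case False
    then have "\<bar>u\<bar> = 1" using x by (auto simp: su annulus_def open_strip_def)
    then show ?thesis using x by (simp add: su return_map_def)
  qed
qed

lemma continuous_on_open_stripI:
  "(\<And>x. x \<in> open_strip \<Longrightarrow> (f has_derivative f' x) (at x)) \<Longrightarrow> continuous_on open_strip f"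
  using has_derivative_continuous continuous_at_imp_continuous_on by blast

lemma symplectic_lift: "symplectic lift"
  unfolding symplectic_def
proof (intro exI[of _ "\<lambda>x h. (dentry x h, dland x h)"] conjI ballI allI)
  fix x assume x: "x \<in> open_strip"
  show "(lift has_derivative (\<lambda>h. (dentry x h, dland x h))) (at x)" by (rule lift_has_derivative[OF x])
  fix v w
  show "area_form (dentry x v, dland x v) (dentry x w, dland x w) = area_form v w"
    using area_preserving[OF x] by (simp add: area_form_def)
next
  fix v :: "real \<times> real"
  note c = continuous_on_open_stripI
  have launch: "continuous_on open_strip launch" by (rule c[OF launch_has_derivative])
  have exit: "continuous_on open_strip exit" by (rule c[OF exit_has_derivative])
  have entry: "continuous_on open_strip entry" by (rule c[OF entry_has_derivative])
  have arrive: "continuous_on open_strip arrive" by (rule c[OF arrive_has_derivative])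
  have chord: "continuous_on open_strip chord" by (rule c[OF chord_has_derivative])
  have \<phi>: "continuous_on UNIV \<phi>" using \<phi>_isCont by (simp add: continuous_at_imp_continuous_on)
  have comp: "continuous_on open_strip (\<lambda>x. g (f x))" if "continuous_on UNIV g" "continuous_on open_strip f"
    for f g :: "_ \<Rightarrow> real"
    using that continuous_on_compose2 by blast
  have cis: "continuous_on open_strip (\<lambda>x. cis (f x))" if "continuous_on open_strip f" for f
    using that by (intro continuous_intros)
  have dlaunch: "continuous_on open_strip (\<lambda>x. dlaunch x v)"
    unfolding dlaunch_def using sin_launch_pos
    by (intro continuous_intros comp[OF \<kappa>_cont] comp[OF \<phi>] launch) (auto simp: less_imp_neq[THEN not_sym])
  have dexit: "continuous_on open_strip (\<lambda>x. dexit x v)"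
    unfolding dexit_def using sin_exit_pos
    by (intro continuous_intros comp[OF \<phi>] launch exit chord dlaunch) (auto simp: less_imp_neq[THEN not_sym])
  have dcenter: "continuous_on open_strip (\<lambda>x. dcenter x v)"
    unfolding dcenter_def by (intro continuous_intros dexit dlaunch cis comp[OF \<phi>] exit launch)
  have dentry: "continuous_on open_strip (\<lambda>x. dentry x v)"
    unfolding dentry_def using sin_arrive_pos
    by (intro continuous_intros cross.continuous_on dcenter cis comp[OF \<phi>] arrive entry)
       (auto simp: less_imp_neq[THEN not_sym])
  have dland: "continuous_on open_strip (\<lambda>x. dland x v)"
    unfolding dland_def using \<mu>_pos
    by (intro continuous_intros cross.continuous_on dcenter dentry cis comp[OF \<phi>] comp[OF \<kappa>_cont] arrive entry) auto
  show "continuous_on open_strip (\<lambda>x. (dentry x v, dland x v))"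
    by (intro continuous_on_Pair dentry dland)
qed

section \<open>The generating function\<close>

lemma entry_twist:
  assumes x: "(s, u) \<in> open_strip"
  shows "((\<lambda>u. entry (s, u)) has_real_derivative dentry (s, u) (0, 1)) (at u)"
proof -
  have "((\<lambda>u. (s, u)) has_derivative (\<lambda>h. (0, h))) (at u)"
    by (auto intro!: derivative_eq_intros)
  from has_derivative_compose[OF this entry_has_derivative[OF x]]
  have deriv: "((\<lambda>u. entry (s, u)) has_derivative (\<lambda>h. dentry (s, u) (0, h))) (at u)" .
  have "linear (dentry (s, u))"
    using has_derivative_linear[OF entry_has_derivative[OF x]] .
  then have "dentry (s, u) (h *\<^sub>R (0, 1)) = h *\<^sub>R dentry (s, u) (0, 1)" for h
    by (rule linear_scale)
  then have "dentry (s, u) (0, h) = dentry (s, u) (0, 1) * h" for h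
    by (metis mult.commute mult_1_right real_scaleR_def scaleR_Pair scaleR_zero_right)
  then have "(\<lambda>h. dentry (s, u) (0, h)) = (*) (dentry (s, u) (0, 1))"
    by (rule ext)
  then show ?thesis
    using deriv unfolding has_field_derivative_def by (simp only:)
qed

lemma lift_twist:
  assumes x: "(s, u) \<in> open_strip"
  shows "((\<lambda>u. fst (lift (s, u))) has_real_derivative dentry (s, u) (0, 1)) (at u)"
proof (rule DERIV_cong_ev[OF refl _ refl, THEN iffD1, OF _ entry_twist[OF x]])
  have "\<forall>\<^sub>F v in nhds u. v \<in> {-1<..<1}"
    by (rule eventually_nhds_in_open) (use x in \<open>auto simp: open_strip_def\<close>)
  then show "\<forall>\<^sub>F v in nhds u. entry (s, v) = fst (lift (s, v))"
    by eventually_elim (simp add: lift_open_strip open_strip_def)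
qed

definition endpoints :: "real \<times> real \<Rightarrow> real \<times> real" where
  "endpoints x = (fst x, entry x)"

lemma inj_on_endpoints: "inj_on endpoints open_strip"
proof (rule inj_onI)
  fix x y assume xy: "x \<in> open_strip" "y \<in> open_strip" "endpoints x = endpoints y"
  obtain s u v where su: "x = (s, u)" "y = (s, v)"
    using xy(3) by (cases x, cases y) (auto simp: endpoints_def)
  have mono: "entry (s, a) < entry (s, b)" if "-1 < a" "a < b" "b < 1" for a b
  proof (rule DERIV_pos_imp_increasing[OF that(2), where f = "\<lambda>u. entry (s, u)"])
    fix c assume "a \<le> c" "c \<le> b"
    then have "(s, c) \<in> open_strip" using that by (auto simp: open_strip_def)
    then show "\<exists>d. ((\<lambda>u. entry (s, u)) has_real_derivative d) (at c) \<and> 0 < d"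
      using entry_twist twist_positive by blast
  qed
  have "entry (s, u) = entry (s, v)" using xy(3) by (simp add: endpoints_def su)
  then have "u = v"
    using mono[of u v] mono[of v u] xy(1,2) by (cases u v rule: linorder_cases) (auto simp: su open_strip_def)
  then show "x = y" by (simp add: su)
qed

definition generating :: "real \<times> real \<Rightarrow> real" where
  "generating p = action (inv_into open_strip endpoints p)"

lemma generating_endpoints: "x \<in> open_strip \<Longrightarrow> generating (endpoints x) = action x"
  by (simp add: generating_def inv_into_f_f[OF inj_on_endpoints])

lemma generating_has_derivative:
  assumes x: "x \<in> open_strip"
  shows "(generating has_derivative (\<lambda>k. land x * snd k - snd x * fst k)) (at (endpoints x))"
proof -
  define d1 where "d1 = dentry x (1, 0)"
  define d2 where "d2 = dentry x (0, 1)"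
  have d2: "d2 > 0" using twist_positive[OF x] by (simp add: d2_def)
  have lin: "linear (dentry x)" using has_derivative_linear[OF entry_has_derivative[OF x]] .
  have dentry: "dentry x h = fst h * d1 + snd h * d2" for h
  proof -
    have "h = fst h *\<^sub>R (1, 0) + snd h *\<^sub>R (0, 1)" by (cases h) simp
    then have "dentry x h = dentry x (fst h *\<^sub>R (1, 0) + snd h *\<^sub>R (0, 1))" by simp
    also have "\<dots> = fst h * d1 + snd h * d2"
      unfolding linear_add[OF lin] linear_scale[OF lin] by (simp add: d1_def d2_def)
    finally show ?thesis .
  qed
  \<comment> \<open>The inverse of the derivative of \<open>endpoints\<close>; the twist condition is what allows the division.\<close>
  define g' where "g' k = (fst k, (snd k - fst k * d1) / d2)" for k :: "real \<times> real"
  have deriv: "(endpoints has_derivative (\<lambda>h. (fst h, dentry x h))) (at x)" if "x \<in> open_strip" for x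
    unfolding endpoints_def[abs_def]
    by (intro has_derivative_Pair has_derivative_fst has_derivative_ident entry_has_derivative that)
  have "(inv_into open_strip endpoints has_derivative g') (at (endpoints x))"
  proof (rule has_derivative_inverse_strong[OF open_open_strip x])
    show "continuous_on open_strip endpoints" by (rule continuous_on_open_stripI[OF deriv])
    show "inv_into open_strip endpoints (endpoints y) = y" if "y \<in> open_strip" for y
      using inv_into_f_f[OF inj_on_endpoints that] .
    show "(endpoints has_derivative (\<lambda>h. (fst h, dentry x h))) (at x)" by (rule deriv[OF x])
    show "(\<lambda>h. (fst h, dentry x h)) \<circ> g' = id"
      using d2 by (auto simp: fun_eq_iff g'_def dentry)
  qed
  moreover have "(action has_derivative (\<lambda>h. land x * dentry x h - snd x * fst h))
      (at (inv_into open_strip endpoints (endpoints x)))"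
    using action_has_derivative[OF x] by (simp add: inv_into_f_f[OF inj_on_endpoints x])
  ultimately have "((\<lambda>p. action (inv_into open_strip endpoints p)) has_derivative
      (\<lambda>k. land x * dentry x (g' k) - snd x * fst (g' k))) (at (endpoints x))"
    by (rule has_derivative_compose)
  then show ?thesis
    unfolding generating_def[abs_def]
    by (rule has_derivative_eq_rhs) (use d2 in \<open>auto simp: fun_eq_iff g'_def dentry\<close>)
qed

text \<open>The difference of two lifts takes values in the multiples of \<open>L\<close>, so it is constant on the strip.\<close>

lemma lift_unique:
  assumes F: "is_lift L (return_map \<Omega> L \<Gamma> \<mu>) F"
  obtains m :: int where "\<And>x. x \<in> strip \<Longrightarrow> F x = lift x + (of_int m * L, 0)"
proof -
  note G = is_lift_lift
  have proj: "cover_proj L (F x) = cover_proj L (lift x)" if "x \<in> strip" for x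
    using F G that unfolding is_lift_def by metis
  define g where "g x = (fst (F x) - fst (lift x)) / L" for x
  have g_int: "\<exists>n::int. g x = of_int n" if x: "x \<in> strip" for x
  proof -
    have "[fst (lift x) = fst (F x)] (rmod L)"
      using proj[OF x] by (auto simp: cover_proj_def rcong_def split_beta)
    then obtain n :: int where "fst (F x) = fst (lift x) + of_int n * L"
      by (auto simp: rcong_altdef)
    then show ?thesis using L_pos by (intro exI[of _ n]) (simp add: g_def)
  qed
  have "g constant_on strip"
  proof (rule continuous_discrete_range_constant)
    show "connected strip" unfolding strip_def by (intro connected_Times) auto
    show "continuous_on strip g"
      unfolding g_def using F G L_pos unfolding is_lift_def by (intro continuous_intros) auto
    show "\<exists>e>0. \<forall>y. y \<in> strip \<and> g y \<noteq> g x \<longrightarrow> e \<le> norm (g y - g x)" if x: "x \<in> strip" for x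
    proof (intro exI[of _ 1] conjI allI impI)
      fix y assume y: "y \<in> strip \<and> g y \<noteq> g x"
      obtain n m :: int where "g x = of_int n" "g y = of_int m" using g_int x y by metis
      then show "1 \<le> norm (g y - g x)" using y by simp linarith
    qed simp
  qed
  then obtain c where c: "\<And>x. x \<in> strip \<Longrightarrow> g x = c" by (auto simp: constant_on_def)
  have "(0, 0) \<in> strip" by (simp add: strip_def)
  then obtain m :: int where m: "c = of_int m" using c g_int by metis
  show ?thesis
  proof
    fix x assume x: "x \<in> strip"
    have "fst (F x) = fst (lift x) + of_int m * L"
      using c[OF x] L_pos by (simp add: g_def m field_simps)
    moreover have "snd (F x) = snd (lift x)" using proj[OF x] by (auto simp: cover_proj_def split_beta)
    ultimately show "F x = lift x + (of_int m * L, 0)" by (simp add: prod_eq_iff)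
  qed
qed

lemma generating_function_of_lift:
  assumes F: "is_lift L (return_map \<Omega> L \<Gamma> \<mu>) F"
  obtains G where "generating_function L F G" "\<And>x. x \<in> open_strip \<Longrightarrow> G (fst x, fst (F x)) = action x"
proof -
  obtain m :: int where m: "\<And>x. x \<in> strip \<Longrightarrow> F x = lift x + (of_int m * L, 0)"
    using lift_unique[OF F] by blast
  have F_open: "F x = (entry x + of_int m * L, land x)" if "x \<in> open_strip" for x
    using m[of x] that lift_open_strip[OF that] by (auto simp: strip_decomp)
  define G where "G p = generating (fst p, snd p - of_int m * L)" for p
  have val: "G (fst x, fst (F x)) = action x" if "x \<in> open_strip" for x
    using generating_endpoints[OF that] by (simp add: G_def F_open[OF that] endpoints_def)
  have "generating_function L F G"
    unfolding generating_function_def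
  proof (intro conjI ballI; clarify)
    fix s s' assume "(s, s') \<in> generating_domain F"
    then obtain u where u: "(s, u) \<in> open_strip" "s' = fst (F (s, u))"
      by (auto simp: generating_domain_def)
    have u': "(s + L, u) \<in> open_strip" using u by (simp add: shift_open_strip)
    have "s' + L = fst (F (s + L, u))"
      using u by (simp add: F_open[OF u(1)] F_open[OF u'] entry_shift)
    then show "G (s + L, s' + L) = G (s, s')"
      using val[OF u'] val[OF u(1)] action_shift[OF u(1)] u(2) by simp
  next
    fix s u assume x: "(s, u) \<in> open_strip"
    have "((\<lambda>p. (fst p, snd p - of_int m * L)) has_derivative (\<lambda>k. k)) (at (s, fst (F (s, u))))"
      by (auto intro!: derivative_eq_intros)
    moreover have "(generating has_derivative (\<lambda>k. land (s, u) * snd k - snd (s, u) * fst k))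
        (at (fst (s, fst (F (s, u))), snd (s, fst (F (s, u))) - of_int m * L))"
      using generating_has_derivative[OF x] by (simp add: F_open[OF x] endpoints_def)
    ultimately have "((\<lambda>p. generating (fst p, snd p - of_int m * L)) has_derivative
        (\<lambda>k. land (s, u) * snd k - snd (s, u) * fst k)) (at (s, fst (F (s, u))))"
      by (rule has_derivative_compose)
    then show "(G has_derivative (\<lambda>(h, h'). snd (F (s, u)) * h' - u * h)) (at (s, fst (F (s, u))))"
      by (simp add: G_def[abs_def] F_open[OF x] split_beta')
  qed
  then show ?thesis using that val by blast
qed

text \<open>Pulled back to the convex open strip by \<open>\<Psi>\<close>, two generating functions have the same derivative.\<close>

lemma generating_function_unique:
  assumes F: "is_lift L (return_map \<Omega> L \<Gamma> \<mu>) F"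
    and G: "generating_function L F G" and G': "generating_function L F G'"
  shows "\<exists>c. \<forall>p\<in>generating_domain F. G' p = G p + c"
proof -
  obtain m :: int where m: "\<And>x. x \<in> strip \<Longrightarrow> F x = lift x + (of_int m * L, 0)"
    using lift_unique[OF F] by blast
  have F_open: "F x = (entry x + of_int m * L, land x)" if "x \<in> open_strip" for x
    using m[of x] that lift_open_strip[OF that] by (auto simp: strip_decomp)
  define \<Psi> where "\<Psi> x = (fst x, entry x + of_int m * L)" for x
  have \<Psi>: "(\<Psi> has_derivative (\<lambda>h. (fst h, dentry x h + 0))) (at x)" if "x \<in> open_strip" for x
    unfolding \<Psi>_def[abs_def]
    by (intro has_derivative_Pair has_derivative_fst has_derivative_ident has_derivative_add
        entry_has_derivative that has_derivative_const)
  have comp: "((\<lambda>x. K (\<Psi> x)) has_derivative (\<lambda>h. land x * (dentry x h + 0) - snd x * fst h)) (at x)"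
    if x: "x \<in> open_strip" and K: "generating_function L F K" for x K
  proof -
    have "(K has_derivative (\<lambda>(h, h'). snd (F x) * h' - snd x * h)) (at (fst x, fst (F x)))"
      using K x unfolding generating_function_def by (cases x) auto
    then have "(K has_derivative (\<lambda>(h, h'). land x * h' - snd x * h)) (at (\<Psi> x))"
      by (simp add: F_open[OF x] \<Psi>_def)
    from has_derivative_compose[OF \<Psi>[OF x] this] show ?thesis by simp
  qed
  have conv: "convex open_strip" unfolding open_strip_def by (intro convex_Times) auto
  have zero: "((\<lambda>x. G' (\<Psi> x) - G (\<Psi> x)) has_derivative (\<lambda>h. 0)) (at x within open_strip)" if "x \<in> open_strip" for x
    using has_derivative_diff[OF comp[OF that G'] comp[OF that G]]
    by (auto intro: has_derivative_at_withinI)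
  obtain c where c: "\<And>x. x \<in> open_strip \<Longrightarrow> G' (\<Psi> x) - G (\<Psi> x) = c"
    using has_derivative_zero_constant[OF conv zero] by blast
  show ?thesis
  proof (intro exI[of _ c] ballI)
    fix p assume "p \<in> generating_domain F"
    then obtain x where x: "x \<in> open_strip" "p = (fst x, fst (F x))" by (auto simp: generating_domain_def)
    then have "p = \<Psi> x" by (simp add: F_open \<Psi>_def)
    then show "G' p = G p + c" using c[OF x(1)] by simp
  qed
qed

theorem return_map_twist:
  "twist_map L (return_map \<Omega> L \<Gamma> \<mu>) \<and>
    (\<forall>F. is_lift L (return_map \<Omega> L \<Gamma> \<mu>) F \<longrightarrow>
      (\<exists>G. generating_function L F G \<and>
           (\<forall>(s\<^sub>0, u\<^sub>0)\<in>open_strip.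
              G (s\<^sub>0, fst (F (s\<^sub>0, u\<^sub>0))) =
                - chord_length \<Omega> \<Gamma> s\<^sub>0 u\<^sub>0 - arc_length \<Omega> \<Gamma> \<mu> s\<^sub>0 u\<^sub>0
                + (1 / \<mu>) * outer_area \<Omega> \<Gamma> \<mu> s\<^sub>0 u\<^sub>0) \<and>
           (\<forall>G'. generating_function L F G' \<longrightarrow>
              (\<exists>c. \<forall>x\<in>generating_domain F. G' x = G x + c))))"
proof (intro conjI allI impI)
  show "twist_map L (return_map \<Omega> L \<Gamma> \<mu>)"
    unfolding twist_map_def
  proof (intro conjI exI[of _ lift])
    show "return_map \<Omega> L \<Gamma> \<mu> \<in> annulus L \<rightarrow> annulus L" by (rule return_map_annulus)
    show "is_lift L (return_map \<Omega> L \<Gamma> \<mu>) lift" by (rule is_lift_lift)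
    show "symplectic lift" by (rule symplectic_lift)
    show "\<forall>(s, u)\<in>strip. lift (s + L, u) = lift (s, u) + (L, 0)" using lift_shift by blast
    show "\<forall>(s, u)\<in>open_strip. \<exists>d>0. ((\<lambda>u. fst (lift (s, u))) has_real_derivative d) (at u)"
      using lift_twist twist_positive by blast
    show "\<exists>G. generating_function L lift G"
      using generating_function_of_lift[OF is_lift_lift] by metis
  qed
  fix F assume F: "is_lift L (return_map \<Omega> L \<Gamma> \<mu>) F"
  obtain G where G: "generating_function L F G" "\<And>x. x \<in> open_strip \<Longrightarrow> G (fst x, fst (F x)) = action x"
    using generating_function_of_lift[OF F] by metis
  show "\<exists>G. generating_function L F G \<and>
           (\<forall>(s\<^sub>0, u\<^sub>0)\<in>open_strip.
              G (s\<^sub>0, fst (F (s\<^sub>0, u\<^sub>0))) =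
                - chord_length \<Omega> \<Gamma> s\<^sub>0 u\<^sub>0 - arc_length \<Omega> \<Gamma> \<mu> s\<^sub>0 u\<^sub>0
                + (1 / \<mu>) * outer_area \<Omega> \<Gamma> \<mu> s\<^sub>0 u\<^sub>0) \<and>
           (\<forall>G'. generating_function L F G' \<longrightarrow>
              (\<exists>c. \<forall>x\<in>generating_domain F. G' x = G x + c))"
    using G generating_function_unique[OF F G(1)] action_eq by (intro exI[of _ G]) fastforce
qed

end

section \<open>Billiard tables in terms of the tangent angle\<close>

lemma has_vector_derivative_periodic:
  assumes "\<And>s. (f has_vector_derivative f' s) (at s)" "\<And>s. f (s + L) = f s"
  shows "f' (s + L) = f' s"
proof -
  have "((\<lambda>s. f (s + L)) has_vector_derivative f' (s + L)) (at s)"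
  proof -
    have "((\<lambda>s. s + L) has_real_derivative 1) (at s)"
      by (auto intro!: derivative_eq_intros)
    then show ?thesis
      using vector_diff_chain_at[of "\<lambda>s. s + L" 1 s f "f' (s + L)"] assms(1)
      by (simp add: comp_def has_real_derivative_iff_has_vector_derivative)
  qed
  then show ?thesis
    unfolding assms(2) using assms(1) vector_derivative_unique_at by blast
qed

text \<open>An antiderivative of the curvature is a tangent angle, because \<open>T\<close> and \<open>cis \<phi>\<close> solve the same linear
  differential equation.\<close>

lemma unit_speed_curve_angle:
  fixes T T' :: "real \<Rightarrow> complex"
  assumes T: "\<And>s. (T has_vector_derivative T' s) (at s)" and norm: "\<And>s. norm (T s) = 1"
    and cont: "continuous_on UNIV (\<lambda>s. cross (T s) (T' s))"
  obtains \<phi> where "\<And>s. (\<phi> has_real_derivative cross (T s) (T' s)) (at s)" "\<And>s. T s = cis (\<phi> s)"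
proof -
  define \<kappa> where "\<kappa> s = cross (T s) (T' s)" for s
  have "\<exists>F. \<forall>x. -\<infinity> < ereal x \<longrightarrow> ereal x < \<infinity> \<longrightarrow> (F has_vector_derivative \<kappa> x) (at x)"
    by (rule einterval_antiderivative)
       (use cont in \<open>auto simp: \<kappa>_def continuous_on_eq_continuous_at\<close>)
  then obtain F where F: "\<And>s. (F has_vector_derivative \<kappa> s) (at s)" by auto
  obtain c where c: "T 0 = cis c"
    using norm[of 0] by (metis complex_norm_eq_1_exp cis_conv_exp)
  define \<phi> where "\<phi> s = F s - F 0 + c" for s
  have \<phi>: "(\<phi> has_real_derivative \<kappa> s) (at s)" for s
    unfolding \<phi>_def using F[of s, folded has_real_derivative_iff_has_vector_derivative]
    by (auto intro!: derivative_eq_intros)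
  have T'_eq: "T' s = \<kappa> s *\<^sub>R (\<i> * T s)" for s
  proof -
    have "((\<lambda>s. T s \<bullet> T s) has_derivative (\<lambda>h. T s \<bullet> (h *\<^sub>R T' s) + (h *\<^sub>R T' s) \<bullet> T s)) (at s)"
      by (rule has_derivative_inner) (use T in \<open>simp_all add: has_vector_derivative_def\<close>)
    moreover have "(\<lambda>s. T s \<bullet> T s) = (\<lambda>_. 1)"
      using norm by (simp add: dot_square_norm)
    ultimately have "((\<lambda>_. 1 :: real) has_derivative (\<lambda>h. T s \<bullet> (h *\<^sub>R T' s) + (h *\<^sub>R T' s) \<bullet> T s)) (at s)"
      by simp
    then have "(\<lambda>h. T s \<bullet> (h *\<^sub>R T' s) + (h *\<^sub>R T' s) \<bullet> T s) = (\<lambda>h. 0)"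
      by (rule has_derivative_unique[OF _ has_derivative_const])
    from fun_cong[OF this, of 1] have "T s \<bullet> T' s = 0" by (simp add: inner_commute)
    moreover obtain a where "T s = cis a" using norm[of s] by (metis complex_norm_eq_1_exp cis_conv_exp)
    ultimately show ?thesis
      using cis_decomp[of "T' s" a] by (simp add: \<kappa>_def scaleR_conv_of_real)
  qed
  have "((\<lambda>s. T s * cis (- \<phi> s)) has_vector_derivative 0) (at s within UNIV)" for s
  proof -
    have "((\<lambda>s. cis (- \<phi> s)) has_derivative (\<lambda>h. (- (\<kappa> s * h)) *\<^sub>R (\<i> * cis (- \<phi> s)))) (at s)"
      using \<phi>[of s] by (intro has_derivative_cis has_derivative_minus) (simp add: has_field_derivative_def)
    then have "((\<lambda>s. cis (- \<phi> s)) has_vector_derivative (- \<kappa> s) *\<^sub>R (\<i> * cis (- \<phi> s))) (at s)"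
      by (simp add: has_vector_derivative_def mult.commute)
    from has_vector_derivative_mult[OF T this] show ?thesis
      by (simp add: T'_eq scaleR_conv_of_real algebra_simps)
  qed
  then obtain d where d: "\<And>s. T s * cis (- \<phi> s) = d"
    using has_vector_derivative_zero_constant[of UNIV "\<lambda>s. T s * cis (- \<phi> s)"] by auto
  have "d = 1" using d[of 0] c by (simp add: \<phi>_def cis_mult)
  have T_eq: "T s = cis (\<phi> s)" for s
  proof -
    have "T s = T s * cis (- \<phi> s) * cis (\<phi> s)" by (simp add: mult.assoc cis_mult)
    then show ?thesis using d \<open>d = 1\<close> by simp
  qed
  show ?thesis
    by (rule that[OF \<phi>[unfolded \<kappa>_def] T_eq])
qed

text \<open>A supporting line at \<open>\<Gamma> s\<close> has to be the tangent. As the curve turns left, \<open>\<Omega>\<close> lies on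
  its left side.\<close>

lemma supporting_tangent:
  assumes "open \<Omega>" "convex \<Omega>" "\<Omega> \<noteq> {}" and fr: "range \<Gamma> = frontier \<Omega>"
    and \<Gamma>: "\<And>s. (\<Gamma> has_vector_derivative cis (\<phi> s)) (at s)"
    and \<phi>: "\<And>s. (\<phi> has_real_derivative \<kappa> s) (at s)" and \<kappa>: "\<And>s. \<kappa> s > 0"
  shows "z \<in> \<Omega> \<Longrightarrow> 0 < cross (cis (\<phi> s)) (z - \<Gamma> s)" "z \<in> closure \<Omega> \<Longrightarrow> 0 \<le> cross (cis (\<phi> s)) (z - \<Gamma> s)"
proof -
  have "\<Gamma> s \<in> frontier \<Omega>" using fr by auto
  then have s: "\<Gamma> s \<in> closure \<Omega>" "\<Gamma> s \<notin> rel_interior \<Omega>"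
    using assms(1,3) by (auto simp: frontier_def interior_open rel_interior_open)
  have cl: "\<Gamma> t \<in> closure \<Omega>" for t
    using fr by (metis Diff_iff frontier_def rangeI)
  obtain a where a: "a \<noteq> 0" "\<And>y. y \<in> closure \<Omega> \<Longrightarrow> a \<bullet> \<Gamma> s \<le> a \<bullet> y"
    "\<And>y. y \<in> rel_interior \<Omega> \<Longrightarrow> a \<bullet> \<Gamma> s < a \<bullet> y"
    using supporting_hyperplane_relative_frontier[OF assms(2) s] by metis
  have a': "a \<bullet> \<Gamma> s < a \<bullet> y" if "y \<in> \<Omega>" for y
    using a(3) that assms(1) by (simp add: rel_interior_open)
  have "((\<lambda>t. a \<bullet> \<Gamma> t) has_real_derivative a \<bullet> cis (\<phi> s)) (at s)"
    unfolding has_real_derivative_iff_has_vector_derivative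
    by (rule bounded_linear.has_vector_derivative[OF bounded_linear_inner_right \<Gamma>])
  then have "a \<bullet> cis (\<phi> s) = 0"
    by (rule DERIV_local_min[where d = 1]) (use a cl in auto)
  define c where "c = cross (cis (\<phi> s)) a"
  have a_eq: "a = c *\<^sub>R (\<i> * cis (\<phi> s))"
    using cis_decomp[of a "\<phi> s"] \<open>a \<bullet> cis (\<phi> s) = 0\<close>
    by (simp add: c_def scaleR_conv_of_real inner_commute)
  have aw: "a \<bullet> w = c * cross (cis (\<phi> s)) w" for w
    unfolding a_eq by (simp add: inner_ii_left)
  have "c > 0"
  proof -
    have \<phi>_less: "\<phi> x < \<phi> y" if "x < y" for x y
      by (rule DERIV_pos_imp_increasing[OF that]) (use \<phi> \<kappa> in blast)
    have "isCont \<phi> s" using \<phi> by (rule DERIV_isCont)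
    then obtain d where d: "d > 0" "\<And>t. \<bar>t - s\<bar> < d \<Longrightarrow> \<bar>\<phi> t - \<phi> s\<bar> < pi"
      unfolding continuous_at_eps_delta dist_real_def by (metis pi_gt_zero)
    define y where "y t = cross (cis (\<phi> s)) (\<Gamma> t - \<Gamma> s)" for t
    have y: "(y has_real_derivative sin (\<phi> t - \<phi> s)) (at t)" for t
      unfolding y_def using cross_has_real_derivative[OF \<Gamma>, of "cis (\<phi> s)" "\<Gamma> s" t] by (simp add: cross_cis)
    have "y s < y (s + d / 2)"
    proof (rule DERIV_pos_imp_increasing_open[where f = y])
      fix t assume t: "s < t" "t < s + d / 2"
      then have "0 < \<phi> t - \<phi> s" "\<phi> t - \<phi> s < pi" using \<phi>_less[of s t] d(2)[of t] by auto
      then show "\<exists>z. (y has_real_derivative z) (at t) \<and> 0 < z"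
        using y sin_gt_zero by blast
    next
      show "continuous_on {s..s + d / 2} y"
        using y by (meson DERIV_isCont continuous_at_imp_continuous_on)
    qed (use d in auto)
    then have pos: "0 < cross (cis (\<phi> s)) (\<Gamma> (s + d / 2) - \<Gamma> s)"
      by (simp add: y_def cross.zero_right)
    have "0 \<le> a \<bullet> (\<Gamma> (s + d / 2) - \<Gamma> s)" using a(2)[OF cl] by (simp add: inner_diff_right)
    then have "0 \<le> c" unfolding aw using pos by (simp add: zero_le_mult_iff)
    moreover have "c \<noteq> 0" using a_eq a(1) by auto
    ultimately show ?thesis by simp
  qed
  show "0 < cross (cis (\<phi> s)) (z - \<Gamma> s)" if "z \<in> \<Omega>"
  proof -
    have "0 < a \<bullet> (z - \<Gamma> s)" using a'[OF that] by (simp add: inner_diff_right)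
    then show ?thesis unfolding aw using \<open>c > 0\<close> by (simp add: zero_less_mult_iff)
  qed
  show "0 \<le> cross (cis (\<phi> s)) (z - \<Gamma> s)" if "z \<in> closure \<Omega>"
  proof -
    have "0 \<le> a \<bullet> (z - \<Gamma> s)" using a(2)[OF that] by (simp add: inner_diff_right)
    then show ?thesis unfolding aw using \<open>c > 0\<close> by (simp add: zero_le_mult_iff)
  qed
qed

text \<open>What needs an argument is that the tangent turns only once: if it turned more than once, it would take
  the same direction at two distinct boundary points, which would then both lie on their common supporting
  line, contrary to strict convexity.\<close>

lemma billiard_table_imp_larmor_table:
  assumes k: "k \<ge> 3" and table: "billiard_table k \<Omega> L \<Gamma>"
    and \<mu>: "\<mu> > 0" "\<mu> < min_radius_of_curvature \<Gamma>"
  obtains \<phi> \<kappa> q where "larmor_table \<Omega> \<Gamma> L \<phi> \<kappa> \<mu> q"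
proof -
  have t: "open \<Omega>" "connected \<Omega>" "\<Omega> \<noteq> {}" "strictly_convex \<Omega>" "L > 0" "C_k_curve k \<Gamma>"
    "\<And>s. \<Gamma> (s + L) = \<Gamma> s" "inj_on \<Gamma> {0..<L}" "range \<Gamma> = frontier \<Omega>"
    "\<And>s. norm (tangent \<Gamma> s) = 1" "\<And>s. curvature \<Gamma> s > 0"
    using table unfolding billiard_table_def by blast+
  obtain D where D: "D 0 = \<Gamma>" "\<And>i s. i < k \<Longrightarrow> (D i has_vector_derivative D (Suc i) s) (at s)"
    using t(6) unfolding C_k_curve_def by blast
  have D0: "(\<Gamma> has_vector_derivative D 1 s) (at s)" for s using D(2)[of 0 s] D(1) k by simp
  have D1: "(D 1 has_vector_derivative D 2 s) (at s)" for s using D(2)[of 1 s] k by (simp add: numeral_2_eq_2)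
  have D2: "(D 2 has_vector_derivative D 3 s) (at s)" for s using D(2)[of 2 s] k by (simp add: numeral_2_eq_2 numeral_3_eq_3)
  have tan: "tangent \<Gamma> = D 1"
    unfolding tangent_def using D0 by (auto intro: vector_derivative_at)
  have curv: "curvature \<Gamma> s = cross (D 1 s) (D 2 s)" for s
    unfolding curvature_def tan cross_def using vector_derivative_at[OF D1] by simp
  have "continuous_on UNIV (D 1)" "continuous_on UNIV (D 2)"
    using D1 D2 by (meson continuous_at_imp_continuous_on has_vector_derivative_continuous)+
  then have cont: "continuous_on UNIV (\<lambda>s. cross (D 1 s) (D 2 s))"
    by (rule cross.continuous_on)
  obtain \<phi> where \<phi>: "\<And>s. (\<phi> has_real_derivative cross (D 1 s) (D 2 s)) (at s)" "\<And>s. D 1 s = cis (\<phi> s)"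
    using unit_speed_curve_angle[OF D1 _ cont] t(10) tan by metis
  define \<kappa> where "\<kappa> s = cross (D 1 s) (D 2 s)" for s
  have \<kappa>_pos: "\<kappa> s > 0" for s using t(11) curv by (simp add: \<kappa>_def)
  have \<phi>_deriv: "(\<phi> has_real_derivative \<kappa> s) (at s)" for s using \<phi>(1) by (simp add: \<kappa>_def)
  have \<Gamma>_deriv: "(\<Gamma> has_vector_derivative cis (\<phi> s)) (at s)" for s using D0 \<phi>(2) by simp
  have seg: "open_segment x y \<subseteq> \<Omega>" if "x \<in> closure \<Omega>" "y \<in> closure \<Omega>" "x \<noteq> y" for x y
    using t(1,4) that unfolding strictly_convex_def by (simp add: interior_open)
  have "open_segment x y \<subseteq> \<Omega>" if "x \<in> \<Omega>" "y \<in> \<Omega>" for x y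
    using seg[of x y] that closure_subset[of \<Omega>] by (cases "x = y") auto
  then have conv: "convex \<Omega>" by (auto simp: convex_contains_open_segment)
  note support = supporting_tangent[OF t(1) conv t(3,9) \<Gamma>_deriv \<phi>_deriv \<kappa>_pos]
  have \<phi>_less: "\<phi> x < \<phi> y" if "x < y" for x y
    by (rule DERIV_pos_imp_increasing[OF that]) (use \<phi>_deriv \<kappa>_pos in blast)
  have D1_per: "D 1 (s + L) = D 1 s" for s
    by (rule has_vector_derivative_periodic[OF D0 t(7)])
  have D2_per: "D 2 (s + L) = D 2 s" for s
    by (rule has_vector_derivative_periodic[OF D1 D1_per])
  have turn0: "\<phi> L = \<phi> 0 + 2 * pi"
  proof -
    have "cis (\<phi> 0) = cis (\<phi> L)" using D1_per[of 0] \<phi>(2) by simp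
    then obtain n where n: "\<phi> L = \<phi> 0 + of_int n * (2 * pi)"
      by (auto simp: cis_eq_iff rcong_altdef)
    have "\<phi> 0 < \<phi> L" using \<phi>_less t(5) by simp
    then have "n > 0" using n by (simp add: zero_less_mult_iff)
    moreover have "\<not> n \<ge> 2"
    proof
      assume "n \<ge> 2"
      then have "of_int n * (2 * pi) \<ge> 2 * (2 * pi)" by (intro mult_right_mono) auto
      then have "\<phi> 0 + 2 * pi < \<phi> L" using n pi_gt_zero by linarith
      then obtain r where r: "0 \<le> r" "r \<le> L" "\<phi> r = \<phi> 0 + 2 * pi"
        using IVT[of \<phi> 0 "\<phi> 0 + 2 * pi" L] DERIV_isCont[OF \<phi>_deriv] t(5) pi_gt_zero by force
      then have r': "0 < r" "r < L" using \<open>\<phi> 0 + 2 * pi < \<phi> L\<close> by (auto simp: less_le)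
      have "\<Gamma> r \<noteq> \<Gamma> 0" using inj_onD[OF t(8), of r 0] r' by auto
      have cl: "\<Gamma> s \<in> closure \<Omega>" for s using t(9) by (metis Diff_iff frontier_def rangeI)
      have same: "cis (\<phi> r) = cis (\<phi> 0)" using r(3) by (simp add: cis.code)
      have "0 \<le> cross (cis (\<phi> 0)) (\<Gamma> r - \<Gamma> 0)" "0 \<le> cross (cis (\<phi> r)) (\<Gamma> 0 - \<Gamma> r)"
        using support(2)[OF cl] by blast+
      then have zero: "cross (cis (\<phi> 0)) (\<Gamma> r - \<Gamma> 0) = 0"
        unfolding same by (simp add: cross.diff_right)
      have "midpoint (\<Gamma> r) (\<Gamma> 0) \<in> \<Omega>"
        using seg[OF cl cl \<open>\<Gamma> r \<noteq> \<Gamma> 0\<close>] \<open>\<Gamma> r \<noteq> \<Gamma> 0\<close> by auto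
      then have "0 < cross (cis (\<phi> 0)) (midpoint (\<Gamma> r) (\<Gamma> 0) - \<Gamma> 0)" by (rule support(1))
      also have "midpoint (\<Gamma> r) (\<Gamma> 0) - \<Gamma> 0 = (1 / 2) *\<^sub>R (\<Gamma> r - \<Gamma> 0)"
        by (simp add: midpoint_def scaleR_conv_of_real field_simps)
      finally show False using zero by (simp add: cross.scaleR_right)
    qed
    ultimately have "n = 1" by simp
    then show ?thesis using n by simp
  qed
  have turn: "\<phi> (s + L) = \<phi> s + 2 * pi" for s
  proof -
    have "((\<lambda>s. \<phi> (s + L) - \<phi> s) has_real_derivative 0) (at s)" for s
    proof -
      have "((\<lambda>s. \<phi> (s + L)) has_real_derivative \<kappa> (s + L)) (at s)"
        by (rule DERIV_shift[THEN iffD1, OF \<phi>_deriv])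
      from DERIV_diff[OF this \<phi>_deriv[of s]] show ?thesis
        by (simp only: \<kappa>_def D1_per D2_per diff_self)
    qed
    then have "\<phi> (s + L) - \<phi> s = \<phi> (0 + L) - \<phi> 0"
      using DERIV_isconst_all by blast
    then show ?thesis using turn0 by simp
  qed
  \<comment> \<open>The constant \<open>q\<close> is \<open>\<mu> / \<rho>\<close>.\<close>
  define \<rho> where "\<rho> = min_radius_of_curvature \<Gamma>"
  have \<rho>_le: "\<rho> \<le> 1 / \<kappa> s" for s
    unfolding \<rho>_def min_radius_of_curvature_def
  proof (rule cINF_lower2)
    show "bdd_below (range (radius_of_curvature \<Gamma>))"
      by (rule bdd_belowI[of _ 0]) (use t(11) in \<open>auto simp: radius_of_curvature_def less_imp_le\<close>)
    show "radius_of_curvature \<Gamma> s \<le> 1 / \<kappa> s" by (simp add: radius_of_curvature_def curv \<kappa>_def)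
  qed simp
  have "\<rho> > 0" using \<mu> by (simp add: \<rho>_def)
  then have "\<kappa> s \<le> 1 / \<rho>" for s using \<rho>_le[of s] \<kappa>_pos[of s] by (simp add: field_simps)
  then have "\<mu> * \<kappa> s \<le> \<mu> / \<rho>" for s using mult_left_mono[of "\<kappa> s" "1 / \<rho>" \<mu>] \<mu> by simp
  moreover have "\<mu> / \<rho> < 1" using \<mu> \<open>\<rho> > 0\<close> by (simp add: \<rho>_def)
  ultimately have "larmor_table \<Omega> \<Gamma> L \<phi> \<kappa> \<mu> (\<mu> / \<rho>)"
    using t \<Gamma>_deriv \<phi>_deriv turn \<kappa>_pos \<mu> cont support(1)
    by unfold_locales (auto simp: \<kappa>_def)
  then show ?thesis by (rule that)
qed

theorem theorem1:
  fixes \<Omega> :: "complex set" and \<Gamma> :: "real \<Rightarrow> complex" and L \<mu> :: real and k :: nat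
  assumes "k \<ge> 3"
    and "billiard_table k \<Omega> L \<Gamma>"
    and "\<mu> > 0"
    and "\<mu> < min_radius_of_curvature \<Gamma>"
  shows "twist_map L (return_map \<Omega> L \<Gamma> \<mu>) \<and>
    (\<forall>F. is_lift L (return_map \<Omega> L \<Gamma> \<mu>) F \<longrightarrow>
      (\<exists>G. generating_function L F G \<and>
           (\<forall>(s\<^sub>0, u\<^sub>0)\<in>open_strip.
              G (s\<^sub>0, fst (F (s\<^sub>0, u\<^sub>0))) =
                - chord_length \<Omega> \<Gamma> s\<^sub>0 u\<^sub>0 - arc_length \<Omega> \<Gamma> \<mu> s\<^sub>0 u\<^sub>0
                + (1 / \<mu>) * outer_area \<Omega> \<Gamma> \<mu> s\<^sub>0 u\<^sub>0) \<and>
           (\<forall>G'. generating_function L F G' \<longrightarrow>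
              (\<exists>c. \<forall>x\<in>generating_domain F. G' x = G x + c))))"
proof -
  obtain \<phi> \<kappa> q where "larmor_table \<Omega> \<Gamma> L \<phi> \<kappa> \<mu> q"
    using billiard_table_imp_larmor_table[OF assms] .
  then show ?thesis
    by (rule larmor_table.return_map_twist)
qed

end
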